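(* Suppose $A_1^*>A_2^*$. Then: (a) If $v_1'(s_1)=v_1'(S_1)=-k$, then for every initial level $x\in(\underline{s},S_1-Q)$ the $(s_1,S_1)$ policy is strictly worse than the $(s_1,\{S^*(x):x\leqslant s_1\})$ policy, i.e. $\mathsf{DC}(x,(s_1,S_1))>\mathsf{DC}(x,(s_1,\{S^*(x):x\leqslant s_1\}))$. (b) If $v_1'(s_1)=v_1'(S_1)<-k$, then for every initial level $x\in(-\infty,S_1-Q)\setminus\{\underline{s}\}$ the $(s_1,S_1)$ policy is strictly worse than the $(s_1,\{S^*(x):x\leqslant s_1\})$ policy, i.e. $\mathsf{DC}(x,(s_1,S_1))>\mathsf{DC}(x,(s_1,\{S^*(x):x\leqslant s_1\}))$.
   Context: **Data and standing assumptions.** Constants $\mu>0$, $\sigma>0$, $\beta>0$, $k\geqslant 0$, $Q>0$, and $0<K_1<K_2\leqslant 2K_1$. The function $g:\mathbb{R}\to\mathbb{R}$ satisfies: (A1) $g$ is convex with $g(0)=0$; (A2) $g$ is twice continuously differentiable except at $0$; (A3) $g'(x)<0$ for $x<0$ and $g'(x)>0$ for $x>0$; (A4) $\lim_{x\to-\infty}[g'(x)+\beta k]<-\beta K_1/Q$; (A5) there are a positive integer $n$ and $a,b>0$ with $g(x)\leqslant a+b|x|^n$ for all $x$. **Control problem.** $B$ is a standard Brownian motion on a filtered probability space $(\Omega,\mathcal{F},\mathbb{F}=\{\mathcal{F}(t)\},\mathbb{P})$. A policy is $\phi=\{(\tau_n,\xi_n):n=0,1,2,\dots\}$ with ordering times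 $0=\tau_0\leqslant\tau_1\leqslant\cdots$ ($\mathbb{F}$-stopping times) and order quantities $\xi_n\geqslant0$ ($\mathcal{F}_{\tau_n}$-measurable; $\xi_0=0$ if no order is placed at time $0$). With $N(t)=\max\{n\geqslant0:\tau_n\leqslant t\}$ (finite), the inventory process is $Z(t)=x-\mu t+\sigma B(t)+\sum_{n=0}^{N(t)}\xi_n$, with $Z(0-)=x$ the initial level; $\mathbb{E}_x$ denotes expectation given $Z(0-)=x$. The setup cost is $K(\xi)=K_1\mathbf{1}_{\{0<\xi\leqslant Q\}}+K_2\mathbf{1}_{\{\xi>Q\}}$ and the discounted cost is $$\mathsf{DC}(x,\phi)=\mathbb{E}_x\Big[\int_0^\infty e^{-\beta t}g(Z(t))\,dt+\sum_{n=0}^\infty e^{-\beta\tau_n}\big(K(\xi_n)+k\xi_n\big)\Big].$$ An $(s,S)$ policy ($s<S$) orders nothing while the inventory level is $>s$, and whenever the level is $\leqslant s$ (including at time $0$) it immediately orders up to level $S$. **Policy parameters.** Let $\lambda_1=(\mu+\sqrt{\mu^2+2\beta\sigma^2})/\sigma^2$, $\lambda_2=(-\mu+\sqrt{\mu^2+2\beta\sigma^2})/\sigma^2$, $\Lambda_1(x)=\int_x^\infty e^{\lambda_1(x-y)}g(y)\,dy$, $\Lambda_2(x)=\int_0^x e^{-\lambda_2(x-y)}g(y)\,dy$. For $i=1,2$ and $s<S$ let $$A_i(s,S)=\frac{\lambda_2^2}{e^{-\lambda_2S}-e^{-\lambda_2s}}\Big[\sum_{j=1}^2(\Lambda_j(S)-\Lambda_j(s))+\frac{\sigma^2(\lambda_1+\lambda_2)}{2}\big(K_i+k(S-s)\big)\Big],$$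 $A_1^*=\max_{0<S-s\leqslant Q}A_1(s,S)$ and $A_2^*=\max_{S-s\geqslant Q}A_2(s,S)$. For $A\in\mathbb{R}$ let $v_A(x)=\frac{2}{\sigma^2(\lambda_1+\lambda_2)}\big[\Lambda_1(x)+\Lambda_2(x)-\lambda_2^{-2}Ae^{-\lambda_2x}\big]$, $x\in\mathbb{R}$, and $v_i=v_{A_i^*}$. Let $\underline{A}=\lambda_2\int_{-\infty}^0e^{\lambda_2y}g'(y)\,dy$ and $\bar{A}=\lambda_1\int_0^\infty e^{-\lambda_1y}g'(y)\,dy$. The pair $(s_1,S_1)$ is the unique finite solution with $A_1(s_1,S_1)\in(\underline{A},\bar{A})$ of the KKT conditions of the maximization problem defining $A_1^*$ ($\partial_sA_1+\eta_1=0$, $\partial_SA_1-\eta_1=0$, $\eta_1(S-s-Q)=0$, $0<S-s\leqslant Q$, $\eta_1\geqslant0$); it attains the maximum, $A_1^*=A_1(s_1,S_1)$, and it satisfies $v_1'(s_1)=v_1'(S_1)\leqslant -k$. **Generalized policy** (when $A_1^*>A_2^*$). $\bar{S}$ is the unique solution in $[S_1,\infty)$ of $v_1'(x)=-k$, and $\underline{s}$ is the unique solution in $[s_1-Q,S_1-Q]$ of $$\big(v_1(x+Q)+K_1+kQ\big)-\big(v_1(\bar{S})+K_2+k(\bar{S}-x)\big)=0.$$ The $(s_1,\{S^*(x):x\leqslant s_1\})$ policy orders nothing while the inventory level $x$ is $>s_1$, and whenever the level $x$ is $\leqslant s_1$ it immediately orders up to $S^*(x)$, where $S^*(x)=S_1$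 for $x\in(S_1-Q,s_1]$, $S^*(x)=x+Q$ for $x\in[\underline{s},S_1-Q]$, and $S^*(x)=\bar{S}$ for $x<\underline{s}$. *)

theory Defs
  imports "HOL-Probability.Probability"
begin

record inventory_data =
  drift :: real              \<comment> \<open>\<open>\<mu>\<close>\<close>
  vol :: real                \<comment> \<open>\<open>\<sigma>\<close>\<close>
  disc :: real               \<comment> \<open>\<open>\<beta>\<close>\<close>
  unit_cost :: real          \<comment> \<open>\<open>k\<close>\<close>
  qty :: real                \<comment> \<open>\<open>Q\<close>\<close>
  setup1 :: real             \<comment> \<open>\<open>K\<^sub>1\<close>\<close>
  setup2 :: real             \<comment> \<open>\<open>K\<^sub>2\<close>\<close>
  hold :: "real \<Rightarrow> real"     \<comment> \<open>\<open>g\<close>\<close>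

text \<open>The limit of \<open>g' + \<beta>k\<close> at \<open>-\<infinity>\<close> is taken in the extended reals, because \<open>g'\<close> may tend to \<open>-\<infinity>\<close>
  (e.g. for \<open>g(x) = x\<^sup>2\<close>).\<close>

definition inventory_assumptions :: "inventory_data \<Rightarrow> bool" where
  "inventory_assumptions p \<longleftrightarrow>
     drift p > 0 \<and> vol p > 0 \<and> disc p > 0 \<and> unit_cost p \<ge> 0 \<and> qty p > 0 \<and>
     0 < setup1 p \<and> setup1 p < setup2 p \<and> setup2 p \<le> 2 * setup1 p \<and>
     convex_on UNIV (hold p) \<and> hold p 0 = 0 \<and>
     (\<forall>x. x \<noteq> 0 \<longrightarrow> hold p field_differentiable (at x)) \<and>
     (\<forall>x. x \<noteq> 0 \<longrightarrow> deriv (hold p) field_differentiable (at x)) \<and>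
     continuous_on (- {0}) (deriv (deriv (hold p))) \<and>
     (\<forall>x<0. deriv (hold p) x < 0) \<and> (\<forall>x>0. deriv (hold p) x > 0) \<and>
     (\<exists>l::ereal. ((\<lambda>x. ereal (deriv (hold p) x + disc p * unit_cost p)) \<longlongrightarrow> l) at_bot \<and>
        l < ereal (- disc p * setup1 p / qty p)) \<and>
     (\<exists>n::nat. \<exists>a b::real. n > 0 \<and> a > 0 \<and> b > 0 \<and> (\<forall>x. hold p x \<le> a + b * \<bar>x\<bar> ^ n))"

text \<open>The filtration is indexed by \<open>[0,\<infinity>]\<close>, i.e. by \<open>ennreal\<close>, so that the library notions of
  stopping time and of the stopped sigma-algebra apply to stopping times that may be infinite.  The
  process is defined for all real times, but only times \<open>t \<ge> 0\<close> are constrained or used.\<close>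

definition standard_BM ::
  "'a measure \<Rightarrow> (ennreal \<Rightarrow> 'a measure) \<Rightarrow> (real \<Rightarrow> 'a \<Rightarrow> real) \<Rightarrow> bool" where
  "standard_BM M F B \<longleftrightarrow>
     prob_space M \<and> filtration (space M) F \<and> (\<forall>t. sets (F t) \<subseteq> sets M) \<and>
     (\<forall>t\<ge>0. B t \<in> borel_measurable (F (ennreal t))) \<and>
     (AE \<omega> in M. B 0 \<omega> = 0) \<and>
     (\<forall>\<omega>\<in>space M. continuous_on {0..} (\<lambda>t. B t \<omega>)) \<and>
     (\<forall>s t. 0 \<le> s \<and> s < t \<longrightarrow>
        distributed M lborel (\<lambda>\<omega>. B t \<omega> - B s \<omega>) (normal_density 0 (sqrt (t - s))) \<and>
        prob_space.indep_set M (sets (F (ennreal s)))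
          {(\<lambda>\<omega>. B t \<omega> - B s \<omega>) -` A \<inter> space M | A. A \<in> sets borel})"

text \<open>A policy consists of ordering times \<open>\<tau> n\<close> and order quantities \<open>\<xi> n\<close>.  Times may be \<open>\<infinity>\<close> (the
  order is then never placed), and quantities may be \<open>0\<close> (at no cost).\<close>

definition policy ::
  "'a measure \<Rightarrow> (ennreal \<Rightarrow> 'a measure) \<Rightarrow> (nat \<Rightarrow> 'a \<Rightarrow> ennreal) \<Rightarrow> (nat \<Rightarrow> 'a \<Rightarrow> real) \<Rightarrow> bool" where
  "policy M F \<tau> \<xi> \<longleftrightarrow>
     (\<forall>n. stopping_time F (\<tau> n)) \<and>
     (\<forall>n. \<xi> n \<in> borel_measurable (filtration.pre_sigma (space M) F (\<tau> n))) \<and>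
     (\<forall>\<omega>\<in>space M. \<tau> 0 \<omega> = 0 \<and> (\<forall>n. \<tau> n \<omega> \<le> \<tau> (Suc n) \<omega>) \<and> (\<forall>n. \<xi> n \<omega> \<ge> 0) \<and>
        (\<forall>t::real. finite {n. \<tau> n \<omega> \<le> ennreal t}))"

definition order_count :: "(nat \<Rightarrow> 'a \<Rightarrow> ennreal) \<Rightarrow> real \<Rightarrow> 'a \<Rightarrow> nat" where
  "order_count \<tau> t \<omega> = Max {n. \<tau> n \<omega> \<le> ennreal t}"

definition inventory ::
  "inventory_data \<Rightarrow> (real \<Rightarrow> 'a \<Rightarrow> real) \<Rightarrow> real \<Rightarrow> (nat \<Rightarrow> 'a \<Rightarrow> ennreal) \<Rightarrow> (nat \<Rightarrow> 'a \<Rightarrow> real)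
     \<Rightarrow> real \<Rightarrow> 'a \<Rightarrow> real" where
  "inventory p B x \<tau> \<xi> t \<omega> =
     x - drift p * t + vol p * B t \<omega> + (\<Sum>n = 0..order_count \<tau> t \<omega>. \<xi> n \<omega>)"

definition setup_cost :: "inventory_data \<Rightarrow> real \<Rightarrow> real" where
  "setup_cost p q =
     (if 0 < q \<and> q \<le> qty p then setup1 p else if q > qty p then setup2 p else 0)"

definition discount :: "inventory_data \<Rightarrow> ennreal \<Rightarrow> real" where
  "discount p t = (if t = \<infinity> then 0 else exp (- disc p * enn2real t))"

text \<open>Under the assumptions on the data \<open>g \<ge> 0\<close> and all ordering costs are nonnegative, so the
  discounted cost is a well-defined element of \<open>[0,\<infinity>]\<close>.\<close>

definition DC ::
  "inventory_data \<Rightarrow> 'a measure \<Rightarrow> (real \<Rightarrow> 'a \<Rightarrow> real) \<Rightarrow> real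
     \<Rightarrow> (nat \<Rightarrow> 'a \<Rightarrow> ennreal) \<Rightarrow> (nat \<Rightarrow> 'a \<Rightarrow> real) \<Rightarrow> ennreal" where
  "DC p M B x \<tau> \<xi> =
     (\<integral>\<^sup>+\<omega>. ((\<integral>\<^sup>+t\<in>{0..}. ennreal (exp (- disc p * t) * hold p (inventory p B x \<tau> \<xi> t \<omega>)) \<partial>lborel) +
            (\<Sum>n. ennreal (discount p (\<tau> n \<omega>) * (setup_cost p (\<xi> n \<omega>) + unit_cost p * \<xi> n \<omega>)))) \<partial>M)"

text \<open>The policy \<open>(\<tau>,\<xi>)\<close>, started from level \<open>x\<close>, carries out the rule ``order nothing while the
  level is above \<open>s\<close>; whenever the level \<open>y\<close> is at or below \<open>s\<close>, immediately order up to \<open>T y\<close>''.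
  The first conjunct fixes the size of the \<open>n\<close>-th order from the level \<open>y\<close> just before it; the
  second one (the level after all orders placed up to time \<open>t\<close> is above \<open>s\<close>) says that no order
  is omitted or delayed.\<close>

definition implements_order_up_to ::
  "inventory_data \<Rightarrow> 'a measure \<Rightarrow> (ennreal \<Rightarrow> 'a measure) \<Rightarrow> (real \<Rightarrow> 'a \<Rightarrow> real) \<Rightarrow> real
     \<Rightarrow> real \<Rightarrow> (real \<Rightarrow> real) \<Rightarrow> (nat \<Rightarrow> 'a \<Rightarrow> ennreal) \<Rightarrow> (nat \<Rightarrow> 'a \<Rightarrow> real) \<Rightarrow> bool" where
  "implements_order_up_to p M F B x s T \<tau> \<xi> \<longleftrightarrow>
     policy M F \<tau> \<xi> \<and>
     (\<forall>\<omega>\<in>space M.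
        (\<forall>n. \<tau> n \<omega> < \<infinity> \<longrightarrow>
           (let t = enn2real (\<tau> n \<omega>);
                y = x - drift p * t + vol p * B t \<omega> + (\<Sum>m<n. \<xi> m \<omega>)
            in \<xi> n \<omega> = (if y \<le> s then T y - y else 0))) \<and>
        (\<forall>t\<ge>0. inventory p B x \<tau> \<xi> t \<omega> > s))"

definition sS_policy where
  "sS_policy p M F B x s S \<tau> \<xi> \<longleftrightarrow> implements_order_up_to p M F B x s (\<lambda>_. S) \<tau> \<xi>"

definition lam1 :: "inventory_data \<Rightarrow> real" where
  "lam1 p = (drift p + sqrt ((drift p)\<^sup>2 + 2 * disc p * (vol p)\<^sup>2)) / (vol p)\<^sup>2"

definition lam2 :: "inventory_data \<Rightarrow> real" where
  "lam2 p = (- drift p + sqrt ((drift p)\<^sup>2 + 2 * disc p * (vol p)\<^sup>2)) / (vol p)\<^sup>2"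

definition Lam1 :: "inventory_data \<Rightarrow> real \<Rightarrow> real" where
  "Lam1 p x = (LBINT y=ereal x..\<infinity>. exp (lam1 p * (x - y)) * hold p y)"

text \<open>An oriented integral: its sign is reversed for \<open>x < 0\<close>.\<close>

definition Lam2 :: "inventory_data \<Rightarrow> real \<Rightarrow> real" where
  "Lam2 p x = (LBINT y=ereal 0..ereal x. exp (- lam2 p * (x - y)) * hold p y)"

text \<open>\<open>A\<^sub>i(s,S)\<close>, where \<open>c\<close> is the setup cost \<open>K\<^sub>i\<close>.\<close>

definition A_fun :: "inventory_data \<Rightarrow> real \<Rightarrow> real \<Rightarrow> real \<Rightarrow> real" where
  "A_fun p c s S =
     (lam2 p)\<^sup>2 / (exp (- lam2 p * S) - exp (- lam2 p * s)) *
     ((Lam1 p S - Lam1 p s) + (Lam2 p S - Lam2 p s) +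
      (vol p)\<^sup>2 * (lam1 p + lam2 p) / 2 * (c + unit_cost p * (S - s)))"

text \<open>The maxima are rendered as suprema of real sets, which are nonempty and bounded above under the
  assumptions on the data; the supremum is the maximum as soon as the latter exists.\<close>

definition A1_star :: "inventory_data \<Rightarrow> real" where
  "A1_star p = Sup {A_fun p (setup1 p) s S | s S. 0 < S - s \<and> S - s \<le> qty p}"

definition A2_star :: "inventory_data \<Rightarrow> real" where
  "A2_star p = Sup {A_fun p (setup2 p) s S | s S. S - s \<ge> qty p}"

definition v_fun :: "inventory_data \<Rightarrow> real \<Rightarrow> real \<Rightarrow> real" where
  "v_fun p A x =
     2 / ((vol p)\<^sup>2 * (lam1 p + lam2 p)) *
     (Lam1 p x + Lam2 p x - A / (lam2 p)\<^sup>2 * exp (- lam2 p * x))"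

definition v1 :: "inventory_data \<Rightarrow> real \<Rightarrow> real" where
  "v1 p = v_fun p (A1_star p)"

definition A_lower :: "inventory_data \<Rightarrow> real" where
  "A_lower p = lam2 p * (LBINT y=-\<infinity>..0. exp (lam2 p * y) * deriv (hold p) y)"

definition A_upper :: "inventory_data \<Rightarrow> real" where
  "A_upper p = lam1 p * (LBINT y=0..\<infinity>. exp (- lam1 p * y) * deriv (hold p) y)"

text \<open>The KKT conditions for maximizing \<open>A\<^sub>1(s,S)\<close> over \<open>0 < S - s \<le> Q\<close>, with multiplier \<open>\<eta>\<close>.\<close>

definition KKT1 :: "inventory_data \<Rightarrow> real \<Rightarrow> real \<Rightarrow> bool" where
  "KKT1 p s S \<longleftrightarrow>
     (\<exists>\<eta>::real. deriv (\<lambda>s'. A_fun p (setup1 p) s' S) s + \<eta> = 0 \<and>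
        deriv (\<lambda>S'. A_fun p (setup1 p) s S') S - \<eta> = 0 \<and>
        \<eta> * (S - s - qty p) = 0 \<and> 0 < S - s \<and> S - s \<le> qty p \<and> \<eta> \<ge> 0)"

definition optimal_pair1 :: "inventory_data \<Rightarrow> real \<Rightarrow> real \<Rightarrow> bool" where
  "optimal_pair1 p s1 S1 \<longleftrightarrow>
     (\<forall>s S. KKT1 p s S \<and> A_fun p (setup1 p) s S \<in> {A_lower p<..<A_upper p} \<longleftrightarrow> s = s1 \<and> S = S1) \<and>
     (\<forall>s S. 0 < S - s \<and> S - s \<le> qty p \<longrightarrow>
        A_fun p (setup1 p) s S \<le> A_fun p (setup1 p) s1 S1)"

text \<open>The equivalences in the next two definitions, as in the previous one, express ``is the unique
  solution'': the point is a solution, and every solution equals it.\<close>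

definition is_S_bar :: "inventory_data \<Rightarrow> real \<Rightarrow> real \<Rightarrow> bool" where
  "is_S_bar p S1 Sbar \<longleftrightarrow>
     (\<forall>x. x \<in> {S1..} \<and> deriv (v1 p) x = - unit_cost p \<longleftrightarrow> x = Sbar)"

definition is_s_low :: "inventory_data \<Rightarrow> real \<Rightarrow> real \<Rightarrow> real \<Rightarrow> real \<Rightarrow> bool" where
  "is_s_low p s1 S1 Sbar sl \<longleftrightarrow>
     (\<forall>x. x \<in> {s1 - qty p..S1 - qty p} \<and>
        (v1 p (x + qty p) + setup1 p + unit_cost p * qty p) -
        (v1 p Sbar + setup2 p + unit_cost p * (Sbar - x)) = 0 \<longleftrightarrow> x = sl)"

text \<open>Only used at levels \<open>x \<le> s\<^sub>1\<close>.\<close>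

definition S_star :: "inventory_data \<Rightarrow> real \<Rightarrow> real \<Rightarrow> real \<Rightarrow> real \<Rightarrow> real" where
  "S_star p S1 Sbar sl x =
     (if x > S1 - qty p then S1 else if x \<ge> sl then x + qty p else Sbar)"

definition generalized_policy where
  "generalized_policy p M F B x s1 S1 Sbar sl \<tau> \<xi> \<longleftrightarrow>
     implements_order_up_to p M F B x s1 (S_star p S1 Sbar sl) \<tau> \<xi>"

end

theory Submission
  imports Defs "HOL-Real_Asymp.Real_Asymp"
begin

text \<open>
  From a level \<open>x < S\<^sub>1 - Q\<close> both policies order at once, and from then on each of them only orders
  from \<open>s\<^sub>1\<close> up to \<open>S\<^sub>1\<close>.  So everything follows from the exact cost of a policy which first
  orders up to \<open>y > s\<^sub>1\<close>: it is the cost of the first order plus \<open>v\<^sub>1(y)\<close>.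

  No stochastic calculus is needed for this.  Let \<open>r(z)\<close> be the expected discounted holding cost of
  the uncontrolled process started at \<open>z\<close>.  By the strong Markov property, the expectation of
  \<open>e\<^sup>-\<^sup>\<beta>\<^sup>\<tau> r(Z(\<tau>))\<close> at an ordering time \<open>\<tau>\<close>, taken just after that order, equals the holding cost
  up to the next ordering time plus the same quantity just before the next order; and an order
  changes it by \<open>r(S\<^sub>1) - r(s\<^sub>1)\<close>.  The resulting sum telescopes.  The same identity for a source
  supported below \<open>s\<^sub>1\<close>, whose resolvent is a multiple of \<open>e\<^sup>-\<^sup>\<lambda>\<^sup>2\<^sup>z\<close> on \<open>[s\<^sub>1, \<infinity>)\<close>, yields the total
  discounted number of orders, and \<open>v\<^sub>1\<close> differs from \<open>r\<close> by a multiple of that exponential.  The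
  explicit form of \<open>r\<close> comes from the Laplace transform of the Gaussian kernel.

  In the comparison, \<open>A\<^sub>1\<^sup>* > A\<^sub>2\<^sup>*\<close> says that a larger order never pays off at \<open>s\<^sub>1\<close>; when
  \<open>v\<^sub>1' < -k\<close> at \<open>S\<^sub>1\<close>, maximality of \<open>(s\<^sub>1, S\<^sub>1)\<close> forces \<open>S\<^sub>1 - s\<^sub>1 = Q\<close>, so the equation defining
  \<open>sl\<close> has the right sign at the end point \<open>S\<^sub>1 - Q\<close>.
\<close>

section \<open>The Laplace transform of the Gaussian kernel\<close>

text \<open>A policy is given only through the relation \<open>implements_order_up_to\<close>. It
  may contain orders of size zero, placed at arbitrary stopping times while the level is above s,
  and several orders at one time. So the ordering times are not hitting times, the cycles are not
  independent copies of each other, and no renewal argument is at hand. Instead an identity is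
  proved for each single cycle; the pathwise input is that, by continuity, every later order of
  positive size starts from level exactly s. Orders of size zero also leave the level after an order
  unbounded, so discounting alone does not make the remainder of the telescoping sum vanish when g
  is unbounded. Hence the source below s comes first: its remainder is harmless, it shows that the
  order weights are summable, and this in turn controls an exponential source that dominates the
  square of r. Expectations live in \<open>ennreal\<close>, where cancellation needs finiteness: the
  identities carry every term with a plus sign and pass to the reals once all terms are known to be
  finite.\<close>

lemma exp_minus_square_antiderivative:
  obtains G :: "real \<Rightarrow> real" and L where
    "\<And>x. (G has_real_derivative exp (- x\<^sup>2)) (at x)"
    "(G \<longlongrightarrow> L + sqrt pi) at_top" "(G \<longlongrightarrow> L) at_bot"
proof -
  define G where "G x = (LBINT u=ereal 0..ereal x. exp (- u\<^sup>2))" for x :: real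
  have D: "(G has_real_derivative exp (- x\<^sup>2)) (at x)" for x
  proof -
    let ?a = "min 0 x - 1" and ?b = "max 0 x + 1"
    have "((\<lambda>u. LBINT y=ereal 0..ereal u. exp (- y\<^sup>2)) has_vector_derivative exp (- x\<^sup>2)) (at x within {?a..?b})"
      by (rule interval_integral_FTC2) (auto intro!: continuous_intros)
    then show ?thesis
      by (simp add: G_def[abs_def] has_real_derivative_iff_has_vector_derivative at_within_Icc_at)
  qed
  have int: "integrable lborel (\<lambda>u::real. indicator {0..} u *\<^sub>R exp (- u\<^sup>2))"
    using gaussian_moment_0 unfolding has_bochner_integral_iff by (rule conjunct1)
  have val: "(\<integral>u. indicator {0..} u *\<^sub>R exp (- (u::real)\<^sup>2) \<partial>lborel) = sqrt pi / 2"
    using gaussian_moment_0 unfolding has_bochner_integral_iff by (rule conjunct2)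
  have top: "(G \<longlongrightarrow> sqrt pi / 2) at_top"
  proof (rule Lim_transform_eventually)
    show "((\<lambda>y. \<integral>u. indicator {..y} u *\<^sub>R (indicator {0..} u *\<^sub>R exp (- u\<^sup>2)) \<partial>lborel) \<longlongrightarrow> sqrt pi / 2) at_top"
      using tendsto_integral_at_top[OF _ int] unfolding val by simp
    show "\<forall>\<^sub>F y in at_top. (\<integral>u. indicator {..y} u *\<^sub>R (indicator {0..} u *\<^sub>R exp (- u\<^sup>2)) \<partial>lborel) = G y"
      using eventually_ge_at_top[of 0]
    proof eventually_elim
      case (elim y)
      then show ?case
        unfolding G_def
        by (subst interval_integral_Icc)
          (auto simp: set_lebesgue_integral_def indicator_def intro!: Bochner_Integration.integral_cong)
    qed
  qed
  have odd: "G (- x) = - G x" for x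
  proof -
    have "G (- x) = - (LBINT u=ereal (-x)..ereal 0. exp (- u\<^sup>2))"
      unfolding G_def by (rule interval_integral_endpoints_reverse)
    also have "(LBINT u=ereal (-x)..ereal 0. exp (- u\<^sup>2)) = (LBINT u=ereal (-0)..ereal (-(-x)). exp (- (-u)\<^sup>2))"
      by (subst interval_integral_reflect) simp
    finally show ?thesis by (simp add: G_def)
  qed
  have bot: "(G \<longlongrightarrow> - (sqrt pi / 2)) at_bot"
  proof -
    have "((\<lambda>x. - G (- x)) \<longlongrightarrow> - (sqrt pi / 2)) at_bot"
      by (intro tendsto_minus filterlim_compose[OF top] filterlim_uminus_at_top_at_bot)
    then show ?thesis by (simp add: odd)
  qed
  \<comment> \<open>The limit L comes from the base point 0; callers rely only on the distance sqrt
    pi between the two limits.\<close>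
  show thesis by (rule that[of G "- (sqrt pi / 2)"]) (use D top bot in auto)
qed

text \<open>The integrand has the elementary antiderivative
  \<open>(e\<^sup>2\<^sup>a\<^sup>b G (a \<surd>t + b / \<surd>t) + e\<^sup>-\<^sup>2\<^sup>a\<^sup>b G (a \<surd>t - b / \<surd>t)) / a\<close>, where \<open>G' x = e\<^sup>-\<^sup>x\<^sup>2\<close>.\<close>

lemma nn_integral_exp_minus_inverse:
  fixes a b :: real
  assumes a: "a > 0" and b: "b > 0"
  shows "(\<integral>\<^sup>+t\<in>{0<..}. ennreal (exp (- a\<^sup>2 * t - b\<^sup>2 / t) / sqrt t) \<partial>lborel)
    = ennreal (sqrt pi / a * exp (- 2 * a * b))"
proof -
  obtain G L where G: "\<And>x::real. (G has_real_derivative exp (- x\<^sup>2)) (at x)"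
    and top: "(G \<longlongrightarrow> L + sqrt pi) at_top" and bot: "(G \<longlongrightarrow> L) at_bot"
    by (rule exp_minus_square_antiderivative) blast
  define f where "f t = exp (- a\<^sup>2 * t - b\<^sup>2 / t) / sqrt t" for t
  define H where "H t = (exp (2 * a * b) * G (a * sqrt t + b / sqrt t) +
      exp (- 2 * a * b) * G (a * sqrt t - b / sqrt t)) / a" for t
  have DH: "(H has_real_derivative f t) (at t)" if t: "t > 0" for t
  proof -
    have s: "sqrt t > 0" "sqrt t * sqrt t = t" using t by auto
    have e1: "exp (2 * a * b) * exp (- (a * sqrt t + b / sqrt t)\<^sup>2) = exp (- a\<^sup>2 * t - b\<^sup>2 / t)"
      using s t by (simp add: exp_add[symmetric] power2_eq_square field_simps)
    have e2: "exp (- 2 * a * b) * exp (- (a * sqrt t - b / sqrt t)\<^sup>2) = exp (- a\<^sup>2 * t - b\<^sup>2 / t)"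
      using s t by (simp add: exp_add[symmetric] power2_eq_square field_simps)
    let ?d1 = "a * (inverse (sqrt t) / 2) - b * (inverse (sqrt t) / 2) / t"
    let ?d2 = "a * (inverse (sqrt t) / 2) + b * (inverse (sqrt t) / 2) / t"
    have i1: "((\<lambda>t. a * sqrt t + b / sqrt t) has_real_derivative ?d1) (at t)"
      using t s by (auto intro!: derivative_eq_intros simp: field_simps)
    have i2: "((\<lambda>t. a * sqrt t - b / sqrt t) has_real_derivative ?d2) (at t)"
      using t s by (auto intro!: derivative_eq_intros simp: field_simps)
    have "(H has_real_derivative
        (exp (2 * a * b) * (exp (- (a * sqrt t + b / sqrt t)\<^sup>2) * ?d1) +
         exp (- 2 * a * b) * (exp (- (a * sqrt t - b / sqrt t)\<^sup>2) * ?d2)) / a) (at t)"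
      unfolding H_def
      by (intro DERIV_cdivide DERIV_add DERIV_cmult DERIV_chain2[OF G i1] DERIV_chain2[OF G i2])
    also have "exp (2 * a * b) * (exp (- (a * sqrt t + b / sqrt t)\<^sup>2) * ?d1) +
         exp (- 2 * a * b) * (exp (- (a * sqrt t - b / sqrt t)\<^sup>2) * ?d2)
         = exp (- a\<^sup>2 * t - b\<^sup>2 / t) * (?d1 + ?d2)"
      unfolding mult.assoc[symmetric] e1 e2 by (simp add: algebra_simps)
    also have "\<dots> / a = f t"
      using a t s by (simp add: f_def field_simps)
    finally show ?thesis .
  qed
  have l1: "filterlim (\<lambda>t. a * sqrt t + b / sqrt t) at_top (at_right 0)"
    using a b by real_asymp
  have l2: "filterlim (\<lambda>t. a * sqrt t - b / sqrt t) at_bot (at_right 0)"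
    using a b by real_asymp
  have l3: "filterlim (\<lambda>t. a * sqrt t + b / sqrt t) at_top at_top"
    using a b by real_asymp
  have l4: "filterlim (\<lambda>t. a * sqrt t - b / sqrt t) at_top at_top"
    using a b by real_asymp
  \<comment> \<open>Near 0 the two arguments of G go to opposite infinities, at infinity both go to
    plus infinity. So in \<open>?B - ?A\<close> the terms with exp(2ab) and with L cancel.\<close>
  let ?A = "(exp (2 * a * b) * (L + sqrt pi) + exp (- 2 * a * b) * L) / a"
  let ?B = "(exp (2 * a * b) * (L + sqrt pi) + exp (- 2 * a * b) * (L + sqrt pi)) / a"
  have A: "(H \<longlongrightarrow> ?A) (at_right 0)"
    unfolding H_def using a
    by (intro tendsto_intros filterlim_compose[OF top l1] filterlim_compose[OF bot l2]) auto
  have B: "(H \<longlongrightarrow> ?B) at_top"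
    unfolding H_def using a
    by (intro tendsto_intros filterlim_compose[OF top l3] filterlim_compose[OF top l4]) auto
  have f_cont: "isCont f t" if "t > 0" for t
    unfolding f_def using that by (intro continuous_intros) auto
  have f_nonneg: "0 \<le> f t" if "t > 0" for t
    unfolding f_def using that by auto
  have 1: "set_integrable lborel (einterval 0 \<infinity>) f" and 2: "(LBINT t=0..\<infinity>. f t) = ?B - ?A"
  proof -
    have A': "((H \<circ> real_of_ereal) \<longlongrightarrow> ?A) (at_right 0)"
      using A by (simp add: ereal_tendsto_simps1 zero_ereal_def)
    have B': "((H \<circ> real_of_ereal) \<longlongrightarrow> ?B) (at_left \<infinity>)"
      using B by (simp add: ereal_tendsto_simps1)
    show "set_integrable lborel (einterval 0 \<infinity>) f" "(LBINT t=0..\<infinity>. f t) = ?B - ?A"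
      by (rule interval_integral_FTC_nonneg[of 0 \<infinity> H f, OF _ DH f_cont _ A' B'];
        use f_nonneg in \<open>auto\<close>)+
  qed
  have ei: "einterval 0 \<infinity> = {0::real<..}" by (auto simp: einterval_def)
  have "(\<integral>\<^sup>+t\<in>{0<..}. ennreal (f t) \<partial>lborel) = (\<integral>\<^sup>+t. ennreal (indicator {0<..} t *\<^sub>R f t) \<partial>lborel)"
    by (intro nn_integral_cong) (auto simp: indicator_def)
  also have "\<dots> = ennreal (\<integral>t. indicator {0<..} t *\<^sub>R f t \<partial>lborel)"
    using 1 f_nonneg unfolding ei set_integrable_def
    by (intro nn_integral_eq_integral) (auto simp: indicator_def)
  also have "(\<integral>t. indicator {0<..} t *\<^sub>R f t \<partial>lborel) = (LBINT t=0..\<infinity>. f t)"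
    by (simp add: interval_lebesgue_integral_def ei set_lebesgue_integral_def)
  also have "(LBINT t=0..\<infinity>. f t) = sqrt pi / a * exp (- 2 * a * b)"
    unfolding 2 using a by (simp add: field_simps)
  finally show ?thesis unfolding f_def .
qed

section \<open>The strong Markov property\<close>

text \<open>Rounding goes upwards, so that the event that the rounded time equals a given grid point
  is decided by that grid point. Rounding down would look into the future.\<close>

lemma tendsto_ceiling_grid:
  fixes t :: real
  assumes "0 \<le> t"
  shows "(\<lambda>m. real (nat \<lceil>real (Suc m) * t\<rceil>) / real (Suc m)) \<longlonglongrightarrow> t"
proof (rule real_tendsto_sandwich)
  show "\<forall>\<^sub>F m in sequentially. t \<le> real (nat \<lceil>real (Suc m) * t\<rceil>) / real (Suc m)"
  proof (rule always_eventually, rule allI)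
    fix m
    have "real (Suc m) * t \<le> real (nat \<lceil>real (Suc m) * t\<rceil>)" by (rule real_nat_ceiling_ge)
    then show "t \<le> real (nat \<lceil>real (Suc m) * t\<rceil>) / real (Suc m)"
      by (simp add: field_simps)
  qed
  show "\<forall>\<^sub>F m in sequentially. real (nat \<lceil>real (Suc m) * t\<rceil>) / real (Suc m) \<le> t + 1 / real (Suc m)"
  proof (rule always_eventually, rule allI)
    fix m
    have "0 \<le> real (Suc m) * t" using assms by simp
    then have "real (nat \<lceil>real (Suc m) * t\<rceil>) \<le> real (Suc m) * t + 1" by linarith
    then have "real (nat \<lceil>real (Suc m) * t\<rceil>) / real (Suc m) \<le> (real (Suc m) * t + 1) / real (Suc m)"
      by (intro divide_right_mono) auto
    then show "real (nat \<lceil>real (Suc m) * t\<rceil>) / real (Suc m) \<le> t + 1 / real (Suc m)"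
      by (simp add: add_divide_distrib)
  qed
  show "(\<lambda>m. t + 1 / real (Suc m)) \<longlonglongrightarrow> t"
    using tendsto_add[OF tendsto_const lim_inverse_n'[THEN LIMSEQ_Suc], of t] by simp
qed auto

text \<open>At a grid-valued random time only countably many variables are involved; path continuity
  carries measurability to the limit. The measure N is free because this serves for
  \<open>F t\<close>, for M and for products with \<open>lborel\<close>.\<close>

lemma borel_measurable_continuous_paths:
  fixes Y :: "real \<Rightarrow> 'a \<Rightarrow> real"
  assumes Y: "\<And>u. u \<ge> 0 \<Longrightarrow> Y u \<in> borel_measurable N"
    and cont: "\<And>\<omega>. \<omega> \<in> space N \<Longrightarrow> continuous_on {0..} (\<lambda>u. Y u \<omega>)"
    and T[measurable]: "T \<in> borel_measurable N" and T0: "\<And>\<omega>. \<omega> \<in> space N \<Longrightarrow> 0 \<le> T \<omega>"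
  shows "(\<lambda>\<omega>. Y (T \<omega>) \<omega>) \<in> borel_measurable N"
proof (rule borel_measurable_LIMSEQ_real)
  define q where "q m t = real (nat \<lceil>real (Suc m) * t\<rceil>) / real (Suc m)" for m and t :: real
  show "(\<lambda>\<omega>. Y (q m (T \<omega>)) \<omega>) \<in> borel_measurable N" for m
    unfolding q_def
    by (rule measurable_compose_countable[where f = "\<lambda>i. Y (real i / real (Suc m))"]) (auto intro!: Y)
  fix \<omega> assume \<omega>: "\<omega> \<in> space N"
  have "(\<lambda>m. q m (T \<omega>)) \<longlonglongrightarrow> T \<omega>"
    unfolding q_def by (rule tendsto_ceiling_grid[OF T0[OF \<omega>]])
  moreover have "0 \<le> q m (T \<omega>)" for m
    unfolding q_def by (intro divide_nonneg_nonneg of_nat_0_le_iff)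
  ultimately show "(\<lambda>m. Y (q m (T \<omega>)) \<omega>) \<longlonglongrightarrow> Y (T \<omega>) \<omega>"
    using T0[OF \<omega>] by (intro continuous_on_tendsto_compose[OF cont[OF \<omega>]]) auto
qed

section \<open>Brownian paths and quantities known at a stopping time\<close>

locale brownian_motion =
  fixes M :: "'a measure" and F :: "ennreal \<Rightarrow> 'a measure" and B :: "real \<Rightarrow> 'a \<Rightarrow> real"
  assumes standard_BM: "standard_BM M F B"
begin

sublocale prob_space M using standard_BM by (simp add: standard_BM_def)

lemma filtration: "filtration (space M) F" using standard_BM by (simp add: standard_BM_def)

lemma space_F: "space (F t) = space M" by (rule filtration.space_F[OF filtration])

lemma sets_F_mono: "s \<le> t \<Longrightarrow> sets (F s) \<subseteq> sets (F t)"
  by (rule filtration.sets_F_mono[OF filtration])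

lemma sets_F: "sets (F t) \<subseteq> sets M" using standard_BM by (simp add: standard_BM_def)

lemma measurable_F: "f \<in> measurable (F t) N \<Longrightarrow> f \<in> measurable M N"
  using sets_F[of t] space_F[of t] by (auto simp: measurable_def)

lemma measurable_F_mono: "s \<le> t \<Longrightarrow> f \<in> measurable (F s) N \<Longrightarrow> f \<in> measurable (F t) N"
  using sets_F_mono[of s t] space_F by (auto simp: measurable_def)

lemma B_adapted: "t \<ge> 0 \<Longrightarrow> B t \<in> borel_measurable (F (ennreal t))"
  using standard_BM by (simp add: standard_BM_def)

lemma B_measurable: "t \<ge> 0 \<Longrightarrow> B t \<in> borel_measurable M"
  by (rule measurable_F[OF B_adapted])

lemma B_continuous: "\<omega> \<in> space M \<Longrightarrow> continuous_on {0..} (\<lambda>t. B t \<omega>)"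
  using standard_BM by (simp add: standard_BM_def)

lemma B_0: "AE \<omega> in M. B 0 \<omega> = 0"
  using standard_BM by (simp add: standard_BM_def)

lemma B_at_measurable:
  assumes T: "T \<in> borel_measurable N" "\<And>x. x \<in> space N \<Longrightarrow> 0 \<le> T x" and f: "f \<in> measurable N M"
  shows "(\<lambda>x. B (T x) (f x)) \<in> borel_measurable N"
  by (rule borel_measurable_continuous_paths[where Y = "\<lambda>u x. B u (f x)", OF _ _ T])
    (simp_all add: measurable_compose[OF f B_measurable] B_continuous measurable_space[OF f])

lemma stopping_time_measurable: "stopping_time F \<tau> \<Longrightarrow> \<tau> \<in> borel_measurable M"
  by (rule measurable_stopping_time[OF _ sets_F space_F])

text \<open>A form of measurability with respect to the sigma-algebra of \<open>\<tau>\<close> which does not constrain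
  \<open>\<zeta>\<close> where \<open>\<tau> = \<infinity>\<close>.\<close>

definition known_at :: "('a \<Rightarrow> ennreal) \<Rightarrow> ('a \<Rightarrow> real) \<Rightarrow> bool" where
  "known_at \<tau> \<zeta> \<longleftrightarrow>
     (\<forall>s\<ge>0. (\<lambda>\<omega>. if \<tau> \<omega> \<le> ennreal s then \<zeta> \<omega> else 0) \<in> borel_measurable (F (ennreal s)))"

lemma known_at_pre_sigma:
  assumes \<tau>: "stopping_time F \<tau>"
    and \<zeta>: "\<zeta> \<in> borel_measurable (filtration.pre_sigma (space M) F \<tau>)"
  shows "known_at \<tau> \<zeta>"
  unfolding known_at_def
proof (intro allI impI)
  fix s :: real assume "s \<ge> 0"
  have \<tau>s[measurable]: "Measurable.pred (F (ennreal s)) (\<lambda>\<omega>. \<tau> \<omega> \<le> ennreal s)"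
    using \<tau> by (rule stopping_timeD)
  have sp: "space (filtration.pre_sigma (space M) F \<tau>) = space M"
    by (rule filtration.space_pre_sigma[OF filtration])
  show "(\<lambda>\<omega>. if \<tau> \<omega> \<le> ennreal s then \<zeta> \<omega> else 0) \<in> borel_measurable (F (ennreal s))"
  proof (rule measurableI)
    fix A :: "real set" assume A[measurable]: "A \<in> sets borel"
    have "\<zeta> -` A \<inter> space M \<in> sets (filtration.pre_sigma (space M) F \<tau>)"
      using measurable_sets[OF \<zeta> A] sp by simp
    then have 1: "{\<omega> \<in> \<zeta> -` A \<inter> space M. \<tau> \<omega> \<le> ennreal s} \<in> sets (F (ennreal s))"
      by (rule filtration.sets_pre_sigmaD[OF filtration \<tau>])
    have 2: "{\<omega> \<in> space (F (ennreal s)). \<not> \<tau> \<omega> \<le> ennreal s \<and> 0 \<in> A} \<in> sets (F (ennreal s))"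
      by measurable
    have "(\<lambda>\<omega>. if \<tau> \<omega> \<le> ennreal s then \<zeta> \<omega> else 0) -` A \<inter> space (F (ennreal s)) =
      {\<omega> \<in> \<zeta> -` A \<inter> space M. \<tau> \<omega> \<le> ennreal s} \<union> {\<omega> \<in> space (F (ennreal s)). \<not> \<tau> \<omega> \<le> ennreal s \<and> 0 \<in> A}"
      by (auto simp: space_F split: if_splits)
    also have "\<dots> \<in> sets (F (ennreal s))" using 1 2 by (rule sets.Un)
    finally show "(\<lambda>\<omega>. if \<tau> \<omega> \<le> ennreal s then \<zeta> \<omega> else 0) -` A \<inter> space (F (ennreal s)) \<in> sets (F (ennreal s))" .
  qed auto
qed

lemma known_at_compose2:
  assumes \<tau>: "stopping_time F \<tau>" and f: "known_at \<tau> f" and g: "known_at \<tau> g"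
    and h[measurable]: "case_prod h \<in> borel_measurable (borel \<Otimes>\<^sub>M borel)"
  shows "known_at \<tau> (\<lambda>\<omega>. h (f \<omega>) (g \<omega>))"
  unfolding known_at_def
proof (intro allI impI)
  fix s :: real assume s: "s \<ge> 0"
  have \<tau>s[measurable]: "Measurable.pred (F (ennreal s)) (\<lambda>\<omega>. \<tau> \<omega> \<le> ennreal s)"
    using \<tau> by (rule stopping_timeD)
  have [measurable]: "(\<lambda>\<omega>. if \<tau> \<omega> \<le> ennreal s then f \<omega> else 0) \<in> borel_measurable (F (ennreal s))"
     "(\<lambda>\<omega>. if \<tau> \<omega> \<le> ennreal s then g \<omega> else 0) \<in> borel_measurable (F (ennreal s))"
    using f g s by (auto simp: known_at_def)
  \<comment> \<open>The inner masks make the arguments measurable; the outer one is there because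
    \<open>h 0 0\<close> may differ from 0.\<close>
  have "(\<lambda>\<omega>. if \<tau> \<omega> \<le> ennreal s then case_prod h (if \<tau> \<omega> \<le> ennreal s then f \<omega> else 0,
      if \<tau> \<omega> \<le> ennreal s then g \<omega> else 0) else 0) \<in> borel_measurable (F (ennreal s))"
    by measurable
  also have "(\<lambda>\<omega>. if \<tau> \<omega> \<le> ennreal s then case_prod h (if \<tau> \<omega> \<le> ennreal s then f \<omega> else 0,
      if \<tau> \<omega> \<le> ennreal s then g \<omega> else 0) else 0) = (\<lambda>\<omega>. if \<tau> \<omega> \<le> ennreal s then h (f \<omega>) (g \<omega>) else 0)"
    by auto
  finally show "(\<lambda>\<omega>. if \<tau> \<omega> \<le> ennreal s then h (f \<omega>) (g \<omega>) else 0) \<in> borel_measurable (F (ennreal s))" .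
qed

lemma known_at_mono:
  assumes \<tau>': "stopping_time F \<tau>'" and f: "known_at \<tau> f"
    and le: "\<And>\<omega>. \<omega> \<in> space M \<Longrightarrow> \<tau> \<omega> \<le> \<tau>' \<omega>"
  shows "known_at \<tau>' f"
  unfolding known_at_def
proof (intro allI impI)
  fix s :: real assume s: "s \<ge> 0"
  have \<tau>s[measurable]: "Measurable.pred (F (ennreal s)) (\<lambda>\<omega>. \<tau>' \<omega> \<le> ennreal s)"
    using \<tau>' by (rule stopping_timeD)
  have [measurable]: "(\<lambda>\<omega>. if \<tau> \<omega> \<le> ennreal s then f \<omega> else 0) \<in> borel_measurable (F (ennreal s))"
    using f s by (auto simp: known_at_def)
  have "(\<lambda>\<omega>. if \<tau>' \<omega> \<le> ennreal s then (if \<tau> \<omega> \<le> ennreal s then f \<omega> else 0) else 0) \<in> borel_measurable (F (ennreal s))"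
    by measurable
  then show "(\<lambda>\<omega>. if \<tau>' \<omega> \<le> ennreal s then f \<omega> else 0) \<in> borel_measurable (F (ennreal s))"
    by (rule measurable_cong[THEN iffD1, rotated]) (use le order_trans in \<open>auto simp: space_F\<close>)
qed

lemma known_at_const: "stopping_time F \<tau> \<Longrightarrow> known_at \<tau> (\<lambda>_. c)"
  unfolding known_at_def
  by (intro allI impI measurable_If measurable_const) (simp_all add: stopping_timeD[unfolded pred_def])

lemma known_at_add:
  "stopping_time F \<tau> \<Longrightarrow> known_at \<tau> f \<Longrightarrow> known_at \<tau> g \<Longrightarrow> known_at \<tau> (\<lambda>\<omega>. f \<omega> + g \<omega>)"
  by (rule known_at_compose2[where h = "(+)"]) simp_all

lemma known_at_compose:
  "stopping_time F \<tau> \<Longrightarrow> known_at \<tau> f \<Longrightarrow> h \<in> borel_measurable borel \<Longrightarrow> known_at \<tau> (\<lambda>\<omega>. h (f \<omega>))"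
  by (rule known_at_compose2[where h = "\<lambda>x _. h x" and g = f]) simp_all

lemma known_at_sum:
  "stopping_time F \<tau> \<Longrightarrow> (\<And>i. i \<in> I \<Longrightarrow> known_at \<tau> (f i)) \<Longrightarrow> known_at \<tau> (\<lambda>\<omega>. \<Sum>i\<in>I. f i \<omega>)"
  by (induction I rule: infinite_finite_induct) (auto intro: known_at_const known_at_add)

text \<open>Below s the sublevel sets are those of the stopping time itself, and from s on they are
  the whole space.\<close>

lemma stopping_time_capped_measurable:
  assumes \<tau>: "stopping_time F \<tau>" and s: "s \<ge> 0"
  shows "(\<lambda>\<omega>. enn2real (min (\<tau> \<omega>) (ennreal s))) \<in> borel_measurable (F (ennreal s))"
proof -
  have "(\<lambda>\<omega>. min (\<tau> \<omega>) (ennreal s)) \<in> borel_measurable (F (ennreal s))"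
  proof (rule borel_measurableI_le)
    fix t
    show "{\<omega> \<in> space (F (ennreal s)). min (\<tau> \<omega>) (ennreal s) \<le> t} \<in> sets (F (ennreal s))"
    proof (cases "ennreal s \<le> t")
      case True
      then show ?thesis by (simp add: min_le_iff_disj)
    next
      case False
      then show ?thesis
        using filtration.stopping_time_le_const[OF filtration \<tau>, of t "ennreal s"]
        by (simp add: min_le_iff_disj pred_def)
    qed
  qed
  then show ?thesis by measurable
qed

lemma known_at_time:
  assumes \<tau>: "stopping_time F \<tau>"
  shows "known_at \<tau> (\<lambda>\<omega>. enn2real (\<tau> \<omega>))"
  unfolding known_at_def
proof (intro allI impI)
  fix s :: real assume s: "s \<ge> 0"
  note [measurable] = stopping_timeD[OF \<tau>, of "ennreal s"] stopping_time_capped_measurable[OF \<tau> s]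
  have "(\<lambda>\<omega>. if \<tau> \<omega> \<le> ennreal s then enn2real (min (\<tau> \<omega>) (ennreal s)) else 0) \<in> borel_measurable (F (ennreal s))"
    by measurable
  also have "(\<lambda>\<omega>. if \<tau> \<omega> \<le> ennreal s then enn2real (min (\<tau> \<omega>) (ennreal s)) else 0) =
    (\<lambda>\<omega>. if \<tau> \<omega> \<le> ennreal s then enn2real (\<tau> \<omega>) else 0)"
    by (auto simp: fun_eq_iff)
  finally show "(\<lambda>\<omega>. if \<tau> \<omega> \<le> ennreal s then enn2real (\<tau> \<omega>) else 0) \<in> borel_measurable (F (ennreal s))" .
qed

lemma known_at_B:
  assumes \<tau>: "stopping_time F \<tau>"
  shows "known_at \<tau> (\<lambda>\<omega>. B (enn2real (\<tau> \<omega>)) \<omega>)"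
  unfolding known_at_def
proof (intro allI impI)
  fix s :: real assume s: "s \<ge> 0"
  note [measurable] = stopping_timeD[OF \<tau>, of "ennreal s"]
  let ?T = "\<lambda>\<omega>. enn2real (min (\<tau> \<omega>) (ennreal s))"
  \<comment> \<open>The path is frozen at s, which makes all its values known by time s; where
    \<open>\<tau> \<omega> \<le> ennreal s\<close> this changes nothing.\<close>
  have [measurable]: "(\<lambda>\<omega>. B (min (?T \<omega>) s) \<omega>) \<in> borel_measurable (F (ennreal s))"
  proof (rule borel_measurable_continuous_paths[where Y = "\<lambda>u. B (min u s)"])
    show "B (min u s) \<in> borel_measurable (F (ennreal s))" if "u \<ge> 0" for u
      using that s by (intro measurable_F_mono[OF _ B_adapted]) (auto intro: ennreal_leI)
    show "continuous_on {0..} (\<lambda>u. B (min u s) \<omega>)" if "\<omega> \<in> space (F (ennreal s))" for \<omega>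
      using that s
      by (intro continuous_on_compose2[OF B_continuous, of \<omega>]) (auto intro!: continuous_intros simp: space_F)
  qed (use s in \<open>auto intro: stopping_time_capped_measurable[OF \<tau>]\<close>)
  have "(\<lambda>\<omega>. if \<tau> \<omega> \<le> ennreal s then B (min (?T \<omega>) s) \<omega> else 0) \<in> borel_measurable (F (ennreal s))"
    by measurable
  also have "(\<lambda>\<omega>. if \<tau> \<omega> \<le> ennreal s then B (min (?T \<omega>) s) \<omega> else 0) =
    (\<lambda>\<omega>. if \<tau> \<omega> \<le> ennreal s then B (enn2real (\<tau> \<omega>)) \<omega> else 0)"
    using s enn2real_mono[of "\<tau> _" "ennreal s"] by (auto simp: fun_eq_iff min_absorb1)
  finally show "(\<lambda>\<omega>. if \<tau> \<omega> \<le> ennreal s then B (enn2real (\<tau> \<omega>)) \<omega> else 0) \<in> borel_measurable (F (ennreal s))" .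
qed

text \<open>The value 0 replaces the unconstrained values at infinite times. Later integrands carry
  a weight that vanishes there, so \<open>\<zeta>\<close> can be exchanged for such a measurable
  version \<open>\<zeta>'\<close>.\<close>

lemma known_at_measurable:
  assumes \<tau>: "stopping_time F \<tau>" and f: "known_at \<tau> f"
  shows "(\<lambda>\<omega>. if \<tau> \<omega> = \<infinity> then 0 else f \<omega>) \<in> borel_measurable M"
proof (rule borel_measurable_LIMSEQ_real)
  show "(\<lambda>\<omega>. if \<tau> \<omega> \<le> ennreal (real n) then f \<omega> else 0) \<in> borel_measurable M" for n
    using f by (intro measurable_F[of _ "ennreal (real n)"]) (auto simp: known_at_def)
  fix \<omega>
  show "(\<lambda>n. if \<tau> \<omega> \<le> ennreal (real n) then f \<omega> else 0) \<longlonglongrightarrow> (if \<tau> \<omega> = \<infinity> then 0 else f \<omega>)"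
  proof (cases "\<tau> \<omega>" rule: ennreal_cases)
    case (real r)
    have "\<forall>\<^sub>F n in sequentially. (if \<tau> \<omega> \<le> ennreal (real n) then f \<omega> else 0) = f \<omega>"
      using eventually_ge_at_top[of "nat \<lceil>r\<rceil>"]
    proof eventually_elim
      case (elim n)
      then have "r \<le> real n" by linarith
      then show ?case using real by (simp add: ennreal_leI)
    qed
    then show ?thesis using real by (simp add: tendsto_eventually)
  qed (simp add: top_unique)
qed

section \<open>From independent increments at fixed times to stopping times\<close>

lemma increment:
  assumes "0 \<le> s" "s < t"
  shows "distributed M lborel (\<lambda>\<omega>. B t \<omega> - B s \<omega>) (normal_density 0 (sqrt (t - s)))"
    and "indep_set (sets (F (ennreal s))) {(\<lambda>\<omega>. B t \<omega> - B s \<omega>) -` A \<inter> space M | A. A \<in> sets borel}"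
proof -
  have "\<forall>s t. 0 \<le> s \<and> s < t \<longrightarrow>
      distributed M lborel (\<lambda>\<omega>. B t \<omega> - B s \<omega>) (normal_density 0 (sqrt (t - s))) \<and>
      indep_set (sets (F (ennreal s))) {(\<lambda>\<omega>. B t \<omega> - B s \<omega>) -` A \<inter> space M | A. A \<in> sets borel}"
    using standard_BM unfolding standard_BM_def by (elim conjE)
  note this[rule_format, OF conjI[OF assms]]
  then show "distributed M lborel (\<lambda>\<omega>. B t \<omega> - B s \<omega>) (normal_density 0 (sqrt (t - s)))"
    "indep_set (sets (F (ennreal s))) {(\<lambda>\<omega>. B t \<omega> - B s \<omega>) -` A \<inter> space M | A. A \<in> sets borel}"
    by (rule conjunct1, rule conjunct2)
qed

text \<open>W and \<open>\<zeta>\<close> may depend on each other, so they are kept together as one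
  vector. Independence makes the joint law of this vector and the increment a product measure, and
  Tonelli integrates out the increment.\<close>

lemma nn_integral_increment:
  fixes \<phi> :: "real \<times> real \<Rightarrow> ennreal"
  assumes s: "s \<ge> 0" and t: "t > 0"
    and W: "W \<in> borel_measurable (F (ennreal s))" and \<zeta>: "\<zeta> \<in> borel_measurable (F (ennreal s))"
    and \<phi>[measurable]: "\<phi> \<in> borel_measurable (borel \<Otimes>\<^sub>M borel)"
  shows "(\<integral>\<^sup>+\<omega>. ennreal (W \<omega>) * \<phi> (\<zeta> \<omega>, B (s + t) \<omega> - B s \<omega>) \<partial>M) =
    (\<integral>\<^sup>+\<omega>. ennreal (W \<omega>) * (\<integral>\<^sup>+w. normal_density 0 (sqrt t) w * \<phi> (\<zeta> \<omega>, w) \<partial>lborel) \<partial>M)"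
proof -
  let ?D = "\<lambda>\<omega>. B (s + t) \<omega> - B s \<omega>" and ?X = "\<lambda>\<omega>. (W \<omega>, \<zeta> \<omega>)"
  let ?FX = "{?X -` A \<inter> space M | A. A \<in> sets (borel \<Otimes>\<^sub>M borel)}"
  let ?FD = "{?D -` A \<inter> space M | A. A \<in> sets borel}"
  have dist: "distributed M lborel ?D (normal_density 0 (sqrt t))"
    and ind: "indep_set (sets (F (ennreal s))) ?FD"
    using increment[of s "s + t"] s t by simp_all
  have [measurable]: "W \<in> borel_measurable M" "\<zeta> \<in> borel_measurable M"
    by (rule measurable_F[OF W] measurable_F[OF \<zeta>])+
  have [measurable]: "B (s + t) \<in> borel_measurable M" "B s \<in> borel_measurable M"
    using s t by (auto intro!: B_measurable)
  have X[measurable]: "?X \<in> measurable M (borel \<Otimes>\<^sub>M borel)" by measurable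
  have XF: "?X \<in> measurable (F (ennreal s)) (borel \<Otimes>\<^sub>M borel)"
    using W \<zeta> by measurable
  interpret D: prob_space "distr M borel ?D" by (rule prob_space_distr) measurable
  interpret X: prob_space "distr M (borel \<Otimes>\<^sub>M borel) ?X" by (rule prob_space_distr) measurable
  have eq: "distr M (borel \<Otimes>\<^sub>M borel) ?X \<Otimes>\<^sub>M distr M borel ?D =
      distr M ((borel \<Otimes>\<^sub>M borel) \<Otimes>\<^sub>M borel) (\<lambda>\<omega>. (?X \<omega>, ?D \<omega>))"
  proof (rule pair_measure_eqI)
    fix A C assume "A \<in> sets (distr M (borel \<Otimes>\<^sub>M borel) ?X)" "C \<in> sets (distr M borel ?D)"
    then have [measurable]: "A \<in> sets (borel \<Otimes>\<^sub>M borel)" "C \<in> sets borel" by auto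
    have XA: "?X -` A \<inter> space M \<in> sets (F (ennreal s))"
      using measurable_sets[OF XF, of A] by (simp add: space_F)
    have "prob ((?X -` A \<inter> space M) \<inter> (?D -` C \<inter> space M)) =
      prob (?X -` A \<inter> space M) * prob (?D -` C \<inter> space M)"
      by (rule indep_setD[OF ind XA]) auto
    moreover have "(?X -` A \<inter> space M) \<inter> (?D -` C \<inter> space M) =
        (\<lambda>\<omega>. (?X \<omega>, ?D \<omega>)) -` (A \<times> C) \<inter> space M" by auto
    ultimately show "emeasure (distr M (borel \<Otimes>\<^sub>M borel) ?X) A * emeasure (distr M borel ?D) C =
        emeasure (distr M ((borel \<Otimes>\<^sub>M borel) \<Otimes>\<^sub>M borel) (\<lambda>\<omega>. (?X \<omega>, ?D \<omega>))) (A \<times> C)"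
      by (simp add: emeasure_distr emeasure_eq_measure ennreal_mult'')
  qed (auto intro: X.sigma_finite_measure_axioms D.sigma_finite_measure_axioms)
  have "(\<integral>\<^sup>+\<omega>. ennreal (W \<omega>) * \<phi> (\<zeta> \<omega>, ?D \<omega>) \<partial>M) =
    (\<integral>\<^sup>+q. ennreal (fst (fst q)) * \<phi> (snd (fst q), snd q) \<partial>distr M ((borel \<Otimes>\<^sub>M borel) \<Otimes>\<^sub>M borel) (\<lambda>\<omega>. (?X \<omega>, ?D \<omega>)))"
    by (subst nn_integral_distr) auto
  also have "\<dots> = (\<integral>\<^sup>+x. \<integral>\<^sup>+w. ennreal (fst x) * \<phi> (snd x, w) \<partial>distr M borel ?D \<partial>distr M (borel \<Otimes>\<^sub>M borel) ?X)"
    unfolding eq[symmetric] by (subst D.nn_integral_fst[symmetric]) auto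
  also have "\<dots> = (\<integral>\<^sup>+\<omega>. \<integral>\<^sup>+w. ennreal (W \<omega>) * \<phi> (\<zeta> \<omega>, w) \<partial>distr M borel ?D \<partial>M)"
    by (subst nn_integral_distr) auto
  also have "\<dots> = (\<integral>\<^sup>+\<omega>. ennreal (W \<omega>) * (\<integral>\<^sup>+w. \<phi> (\<zeta> \<omega>, w) \<partial>distr M borel ?D) \<partial>M)"
    by (intro nn_integral_cong nn_integral_cmult) auto
  also have "\<dots> = (\<integral>\<^sup>+\<omega>. ennreal (W \<omega>) * (\<integral>\<^sup>+w. normal_density 0 (sqrt t) w * \<phi> (\<zeta> \<omega>, w) \<partial>lborel) \<partial>M)"
  proof (intro nn_integral_cong arg_cong2[where f = "(*)"] refl)
    fix \<omega>
    have "(\<integral>\<^sup>+w. \<phi> (\<zeta> \<omega>, w) \<partial>distr M borel ?D) = (\<integral>\<^sup>+\<omega>'. \<phi> (\<zeta> \<omega>, ?D \<omega>') \<partial>M)"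
      by (subst nn_integral_distr) auto
    also have "\<dots> = (\<integral>\<^sup>+w. normal_density 0 (sqrt t) w * \<phi> (\<zeta> \<omega>, w) \<partial>lborel)"
      by (rule distributed_nn_integral[OF dist, symmetric]) measurable
    finally show "(\<integral>\<^sup>+w. \<phi> (\<zeta> \<omega>, w) \<partial>distr M borel ?D) = (\<integral>\<^sup>+w. normal_density 0 (sqrt t) w * \<phi> (\<zeta> \<omega>, w) \<partial>lborel)" .
  qed
  finally show ?thesis .
qed

end

lemma SUP_ennreal_min_nat: "(SUP n. ennreal (min x (real n))) = ennreal x"
proof (rule antisym)
  show "(SUP n. ennreal (min x (real n))) \<le> ennreal x"
    by (intro SUP_least ennreal_leI) simp
  have "x \<le> real (nat \<lceil>x\<rceil>)" by (rule real_nat_ceiling_ge)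
  then have "ennreal x = ennreal (min x (real (nat \<lceil>x\<rceil>)))" by simp
  also have "\<dots> \<le> (SUP n. ennreal (min x (real n)))" by (rule SUP_upper) simp
  finally show "ennreal x \<le> (SUP n. ennreal (min x (real n)))" .
qed

text \<open>Lifts identities from functions bounded above to unbounded ones by monotone
  convergence.\<close>

lemma nn_integral_SUP_min_nat:
  assumes f[measurable]: "f \<in> borel_measurable N" and h[measurable]: "h \<in> borel_measurable N"
  shows "(\<integral>\<^sup>+x. h x * ennreal (f x) \<partial>N) = (SUP n. \<integral>\<^sup>+x. h x * ennreal (min (f x) (real n)) \<partial>N)"
proof -
  have "(\<integral>\<^sup>+x. h x * ennreal (f x) \<partial>N) = (\<integral>\<^sup>+x. (SUP n. h x * ennreal (min (f x) (real n))) \<partial>N)"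
    by (simp add: SUP_mult_left_ennreal[symmetric] SUP_ennreal_min_nat)
  also have "\<dots> = (SUP n. \<integral>\<^sup>+x. h x * ennreal (min (f x) (real n)) \<partial>N)"
    by (intro nn_integral_monotone_convergence_SUP)
      (auto simp: incseq_def le_fun_def intro!: mult_left_mono ennreal_leI)
  finally show ?thesis .
qed

text \<open>The case i = 0 is separate: \<open>nat\<close> sends all nonpositive ceilings to 0, so
  there is no lower bound on r.\<close>

lemma nat_ceiling_mult_eq_iff:
  fixes r :: real
  assumes "S > 0"
  shows "nat \<lceil>S * r\<rceil> = i \<longleftrightarrow> r \<le> real i / S \<and> (i = 0 \<or> \<not> r \<le> real (i - 1) / S)"
proof -
  have "nat \<lceil>S * r\<rceil> = i \<longleftrightarrow> nat \<lceil>S * r\<rceil> \<le> i \<and> (i = 0 \<or> \<not> nat \<lceil>S * r\<rceil> \<le> i - 1)"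
    by linarith
  also have "\<dots> \<longleftrightarrow> S * r \<le> real i \<and> (i = 0 \<or> \<not> S * r \<le> real (i - 1))"
    unfolding nat_ceiling_le_eq ..
  finally show ?thesis using assms by (simp add: field_simps)
qed

context brownian_motion
begin

text \<open>On each event that the rounded time equals the grid point s i, both W and
  \<open>\<zeta>\<close> are known by s i, so the fixed-time result applies; then sum over i. Only
  the increment is moved to the rounded time, while W and \<open>\<zeta>\<close> stay attached to
  \<open>\<tau>\<close>.\<close>

lemma strong_markov_grid:
  fixes g :: "real \<Rightarrow> real" and m :: nat
  assumes \<tau>: "stopping_time F \<tau>" and W: "known_at \<tau> W" and \<zeta>: "known_at \<tau> \<zeta>"
    and W_top: "\<And>\<omega>. \<omega> \<in> space M \<Longrightarrow> \<tau> \<omega> = \<infinity> \<Longrightarrow> W \<omega> = 0"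
    and t: "t > 0" and g[measurable]: "g \<in> borel_measurable borel"
  defines "q \<equiv> \<lambda>\<omega>. real (nat \<lceil>real (Suc m) * enn2real (\<tau> \<omega>)\<rceil>) / real (Suc m)"
  shows "(\<integral>\<^sup>+\<omega>. ennreal (W \<omega>) * ennreal (g (\<zeta> \<omega> + c * (B (q \<omega> + t) \<omega> - B (q \<omega>) \<omega>))) \<partial>M) =
    (\<integral>\<^sup>+\<omega>. ennreal (W \<omega>) * (\<integral>\<^sup>+w. normal_density 0 (sqrt t) w * ennreal (g (\<zeta> \<omega> + c * w)) \<partial>lborel) \<partial>M)"
proof -
  define S where "S = real (Suc m)"
  have S: "S > 0" by (simp add: S_def)
  define k where "k \<omega> = nat \<lceil>S * enn2real (\<tau> \<omega>)\<rceil>" for \<omega>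
  define s where "s i = real i / S" for i
  have s0: "s i \<ge> 0" for i using S by (simp add: s_def)
  \<comment> \<open>The rounding event is expressed by comparisons of \<open>\<tau>\<close> with
    grid points up to s i, which shows that it belongs to \<open>F (ennreal (s i))\<close>.\<close>
  define A where "A i \<omega> \<longleftrightarrow> \<tau> \<omega> \<le> ennreal (s i) \<and> (i = 0 \<or> \<not> \<tau> \<omega> \<le> ennreal (s (i - 1)))" for i \<omega>
  have A_iff: "A i \<omega> \<longleftrightarrow> \<tau> \<omega> \<noteq> \<infinity> \<and> k \<omega> = i" for i \<omega>
  proof (cases "\<tau> \<omega>" rule: ennreal_cases)
    case (real r)
    then show ?thesis
      using nat_ceiling_mult_eq_iff[OF S, of r i] s0 by (simp add: A_def k_def s_def)
  qed (simp add: A_def top_unique)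
  define Wi where "Wi i \<omega> = (if A i \<omega> then W \<omega> else 0)" for i \<omega>
  define \<zeta>i where "\<zeta>i i \<omega> = (if \<tau> \<omega> \<le> ennreal (s i) then \<zeta> \<omega> else 0)" for i \<omega>
  have Wi: "Wi i \<in> borel_measurable (F (ennreal (s i)))" for i
  proof -
    have [measurable]: "(\<lambda>\<omega>. if \<tau> \<omega> \<le> ennreal (s i) then W \<omega> else 0) \<in> borel_measurable (F (ennreal (s i)))"
      using W s0 by (auto simp: known_at_def)
    have [measurable]: "Measurable.pred (F (ennreal (s i))) (\<lambda>\<omega>. \<tau> \<omega> \<le> ennreal (s (i - 1)))"
      using S by (intro filtration.stopping_time_le_const[OF filtration \<tau>] ennreal_leI)
        (auto simp: s_def divide_right_mono)
    have "(\<lambda>\<omega>. if i \<noteq> 0 \<and> \<tau> \<omega> \<le> ennreal (s (i - 1)) then 0 else if \<tau> \<omega> \<le> ennreal (s i) then W \<omega> else 0)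
      \<in> borel_measurable (F (ennreal (s i)))"
      by measurable
    also have "(\<lambda>\<omega>. if i \<noteq> 0 \<and> \<tau> \<omega> \<le> ennreal (s (i - 1)) then 0 else if \<tau> \<omega> \<le> ennreal (s i) then W \<omega> else 0) = Wi i"
      by (auto simp: Wi_def A_def fun_eq_iff)
    finally show ?thesis .
  qed
  have \<zeta>i: "\<zeta>i i \<in> borel_measurable (F (ennreal (s i)))" for i
    using \<zeta> s0[of i] by (auto simp: known_at_def \<zeta>i_def[abs_def])
  note [measurable] = measurable_F[OF Wi] measurable_F[OF \<zeta>i]
  have [measurable]: "B (s i + t) \<in> borel_measurable M" "B (s i) \<in> borel_measurable M" for i
    using s0[of i] t by (auto intro!: B_measurable)
  \<comment> \<open>At most one summand is nonzero; when
    \<open>\<tau> \<omega> = \<infinity>\<close> there is none, in agreement with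
    \<open>W \<omega> = 0\<close>.\<close>
  have sum: "(\<Sum>i. ennreal (Wi i \<omega>) * h i) = ennreal (W \<omega>) * h (k \<omega>)" if "\<omega> \<in> space M" for \<omega> and h :: "nat \<Rightarrow> ennreal"
  proof -
    have "(\<Sum>i. ennreal (Wi i \<omega>) * h i) = (\<Sum>i\<in>{k \<omega>}. ennreal (Wi i \<omega>) * h i)"
      by (rule suminf_finite) (auto simp: Wi_def A_iff)
    then show ?thesis using W_top[OF that] by (auto simp: Wi_def A_iff)
  qed
  let ?L = "\<lambda>i \<omega>. ennreal (Wi i \<omega>) * ennreal (g (\<zeta>i i \<omega> + c * (B (s i + t) \<omega> - B (s i) \<omega>)))"
  let ?R = "\<lambda>i \<omega>. ennreal (Wi i \<omega>) * (\<integral>\<^sup>+w. normal_density 0 (sqrt t) w * ennreal (g (\<zeta>i i \<omega> + c * w)) \<partial>lborel)"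
  have 1: "(\<integral>\<^sup>+\<omega>. ?L i \<omega> \<partial>M) = (\<integral>\<^sup>+\<omega>. ?R i \<omega> \<partial>M)" for i
    using nn_integral_increment[OF s0 t Wi \<zeta>i, where \<phi> = "\<lambda>(z, w). ennreal (g (z + c * w))"] by simp
  have "(\<integral>\<^sup>+\<omega>. ennreal (W \<omega>) * ennreal (g (\<zeta> \<omega> + c * (B (q \<omega> + t) \<omega> - B (q \<omega>) \<omega>))) \<partial>M) =
    (\<integral>\<^sup>+\<omega>. (\<Sum>i. ?L i \<omega>) \<partial>M)"
  proof (rule nn_integral_cong)
    fix \<omega> assume \<omega>: "\<omega> \<in> space M"
    have "(\<Sum>i. ?L i \<omega>) = (\<Sum>i. ennreal (Wi i \<omega>) * ennreal (g (\<zeta> \<omega> + c * (B (s i + t) \<omega> - B (s i) \<omega>))))"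
      by (intro arg_cong[where f = suminf] ext) (auto simp: Wi_def A_def \<zeta>i_def)
    also have "\<dots> = ennreal (W \<omega>) * ennreal (g (\<zeta> \<omega> + c * (B (s (k \<omega>) + t) \<omega> - B (s (k \<omega>)) \<omega>)))"
      by (rule sum[OF \<omega>])
    finally show "ennreal (W \<omega>) * ennreal (g (\<zeta> \<omega> + c * (B (q \<omega> + t) \<omega> - B (q \<omega>) \<omega>))) = (\<Sum>i. ?L i \<omega>)"
      by (simp only: q_def s_def k_def S_def)
  qed
  also have "\<dots> = (\<Sum>i. \<integral>\<^sup>+\<omega>. ?L i \<omega> \<partial>M)" by (rule nn_integral_suminf) measurable
  also have "\<dots> = (\<Sum>i. \<integral>\<^sup>+\<omega>. ?R i \<omega> \<partial>M)" by (simp only: 1)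
  also have "\<dots> = (\<integral>\<^sup>+\<omega>. (\<Sum>i. ?R i \<omega>) \<partial>M)" by (rule nn_integral_suminf[symmetric]) measurable
  also have "\<dots> = (\<integral>\<^sup>+\<omega>. ennreal (W \<omega>) * (\<integral>\<^sup>+w. normal_density 0 (sqrt t) w * ennreal (g (\<zeta> \<omega> + c * w)) \<partial>lborel) \<partial>M)"
  proof (rule nn_integral_cong)
    fix \<omega> assume \<omega>: "\<omega> \<in> space M"
    have "(\<Sum>i. ?R i \<omega>) = (\<Sum>i. ennreal (Wi i \<omega>) * (\<integral>\<^sup>+w. normal_density 0 (sqrt t) w * ennreal (g (\<zeta> \<omega> + c * w)) \<partial>lborel))"
      by (intro arg_cong[where f = suminf] ext) (auto simp: Wi_def A_def \<zeta>i_def)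
    then show "(\<Sum>i. ?R i \<omega>) = ennreal (W \<omega>) * (\<integral>\<^sup>+w. normal_density 0 (sqrt t) w * ennreal (g (\<zeta> \<omega> + c * w)) \<partial>lborel)"
      by (rule trans[OF _ sum[OF \<omega>]])
  qed
  finally show ?thesis .
qed

text \<open>The right-hand side of the grid identity does not depend on the mesh, so only the
  left-hand side needs a limit. For functions bounded above this is dominated convergence along
  continuous paths (\<open>ennreal\<close> cuts off negative values); truncation then gives the
  general case.\<close>

lemma strong_markov_marginal:
  fixes g :: "real \<Rightarrow> real"
  assumes \<tau>: "stopping_time F \<tau>" and W: "known_at \<tau> W" and \<zeta>: "known_at \<tau> \<zeta>"
    and W_top: "\<And>\<omega>. \<omega> \<in> space M \<Longrightarrow> \<tau> \<omega> = \<infinity> \<Longrightarrow> W \<omega> = 0"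
    and W_le: "\<And>\<omega>. \<omega> \<in> space M \<Longrightarrow> W \<omega> \<le> 1"
    and t: "t > 0" and g: "continuous_on UNIV g"
  shows "(\<integral>\<^sup>+\<omega>. ennreal (W \<omega>) *
      ennreal (g (\<zeta> \<omega> + c * (B (enn2real (\<tau> \<omega>) + t) \<omega> - B (enn2real (\<tau> \<omega>)) \<omega>))) \<partial>M) =
    (\<integral>\<^sup>+\<omega>. ennreal (W \<omega>) * (\<integral>\<^sup>+w. normal_density 0 (sqrt t) w * ennreal (g (\<zeta> \<omega> + c * w)) \<partial>lborel) \<partial>M)"
    (is "?L g = ?R g")
proof -
  define \<zeta>' where "\<zeta>' \<omega> = (if \<tau> \<omega> = \<infinity> then 0 else \<zeta> \<omega>)" for \<omega>
  have [measurable]: "g \<in> borel_measurable borel"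
    using g by (simp add: borel_measurable_continuous_onI)
  have \<zeta>'[measurable]: "\<zeta>' \<in> borel_measurable M"
    unfolding \<zeta>'_def[abs_def] by (rule known_at_measurable[OF \<tau> \<zeta>])
  have [measurable]: "W \<in> borel_measurable M"
    using known_at_measurable[OF \<tau> W] by (rule measurable_cong[THEN iffD1, rotated]) (simp add: W_top)
  have \<tau>_m[measurable]: "\<tau> \<in> borel_measurable M" by (rule stopping_time_measurable[OF \<tau>])
  let ?T = "\<lambda>\<omega>. enn2real (\<tau> \<omega>)"
  have [measurable]: "(\<lambda>\<omega>. B (?T \<omega> + t) \<omega>) \<in> borel_measurable M" "(\<lambda>\<omega>. B (?T \<omega>) \<omega>) \<in> borel_measurable M"
    using t by (auto intro!: B_at_measurable[where f = "\<lambda>\<omega>. \<omega>"])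
  have bounded: "?L f = ?R f" if f: "continuous_on UNIV f" and f_le: "\<And>x. f x \<le> N" for f and N :: real
  proof -
    have [measurable]: "f \<in> borel_measurable borel"
      using f by (simp add: borel_measurable_continuous_onI)
    define q where "q m \<omega> = real (nat \<lceil>real (Suc m) * ?T \<omega>\<rceil>) / real (Suc m)" for m \<omega>
    have q0: "0 \<le> q m \<omega>" for m \<omega> unfolding q_def by (intro divide_nonneg_nonneg of_nat_0_le_iff)
    have [measurable]: "q m \<in> borel_measurable M" for m unfolding q_def[abs_def] by measurable
    have [measurable]: "(\<lambda>\<omega>. B (q m \<omega> + t) \<omega>) \<in> borel_measurable M" "(\<lambda>\<omega>. B (q m \<omega>) \<omega>) \<in> borel_measurable M" for m
      using t q0 by (auto intro!: B_at_measurable[where f = "\<lambda>\<omega>. \<omega>"] add_nonneg_nonneg)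
    let ?h = "\<lambda>m \<omega>. ennreal (W \<omega>) * ennreal (f (\<zeta> \<omega> + c * (B (q m \<omega> + t) \<omega> - B (q m \<omega>) \<omega>)))"
    let ?h' = "\<lambda>m \<omega>. ennreal (W \<omega>) * ennreal (f (\<zeta>' \<omega> + c * (B (q m \<omega> + t) \<omega> - B (q m \<omega>) \<omega>)))"
    let ?k' = "\<lambda>\<omega>. ennreal (W \<omega>) * ennreal (f (\<zeta>' \<omega> + c * (B (?T \<omega> + t) \<omega> - B (?T \<omega>) \<omega>)))"
    have "(\<lambda>m. \<integral>\<^sup>+\<omega>. ?h' m \<omega> \<partial>M) \<longlonglongrightarrow> (\<integral>\<^sup>+\<omega>. ?k' \<omega> \<partial>M)"
    proof (rule nn_integral_dominated_convergence[where w = "\<lambda>_. ennreal N"])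
      show "AE \<omega> in M. ?h' m \<omega> \<le> ennreal N" for m
      proof (rule AE_I2)
        fix \<omega> assume "\<omega> \<in> space M"
        then have "?h' m \<omega> \<le> 1 * ennreal N"
          using W_le f_le by (intro mult_mono ennreal_leI) (auto simp flip: ennreal_1)
        then show "?h' m \<omega> \<le> ennreal N" by simp
      qed
      show "(\<integral>\<^sup>+\<omega>. ennreal N \<partial>M) < \<infinity>" by (simp add: emeasure_space_1)
      show "AE \<omega> in M. (\<lambda>m. ?h' m \<omega>) \<longlonglongrightarrow> ?k' \<omega>"
      proof (rule AE_I2)
        fix \<omega> assume \<omega>: "\<omega> \<in> space M"
        have q: "(\<lambda>m. q m \<omega>) \<longlonglongrightarrow> ?T \<omega>" unfolding q_def by (rule tendsto_ceiling_grid) simp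
        have 1: "(\<lambda>m. B (q m \<omega>) \<omega>) \<longlonglongrightarrow> B (?T \<omega>) \<omega>"
          using q q0 by (intro continuous_on_tendsto_compose[OF B_continuous[OF \<omega>]]) auto
        have 2: "(\<lambda>m. B (q m \<omega> + t) \<omega>) \<longlonglongrightarrow> B (?T \<omega> + t) \<omega>"
          using q q0 t by (intro continuous_on_tendsto_compose[OF B_continuous[OF \<omega>]] tendsto_intros)
            (auto intro!: always_eventually add_nonneg_nonneg)
        have "(\<lambda>m. f (\<zeta>' \<omega> + c * (B (q m \<omega> + t) \<omega> - B (q m \<omega>) \<omega>)))
          \<longlonglongrightarrow> f (\<zeta>' \<omega> + c * (B (?T \<omega> + t) \<omega> - B (?T \<omega>) \<omega>))"
          by (rule continuous_on_tendsto_compose[OF f]) (auto intro!: tendsto_intros 1 2)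
        then show "(\<lambda>m. ?h' m \<omega>) \<longlonglongrightarrow> ?k' \<omega>"
          by (intro ennreal_tendsto_cmult tendsto_ennrealI) auto
      qed
    qed measurable
    also have "(\<lambda>m. \<integral>\<^sup>+\<omega>. ?h' m \<omega> \<partial>M) = (\<lambda>m. \<integral>\<^sup>+\<omega>. ?h m \<omega> \<partial>M)"
      by (intro ext nn_integral_cong) (auto simp: \<zeta>'_def W_top)
    also have "\<dots> = (\<lambda>m. ?R f)"
      unfolding q_def by (intro ext strong_markov_grid[OF \<tau> W \<zeta> W_top t]) measurable
    finally have "(\<integral>\<^sup>+\<omega>. ?k' \<omega> \<partial>M) = ?R f"
      by (rule LIMSEQ_unique[OF _ tendsto_const])
    also have "(\<integral>\<^sup>+\<omega>. ?k' \<omega> \<partial>M) = ?L f"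
      by (intro nn_integral_cong) (auto simp: \<zeta>'_def W_top)
    finally show ?thesis .
  qed
  let ?L' = "\<lambda>g. \<integral>\<^sup>+\<omega>. ennreal (W \<omega>) *
      ennreal (g (\<zeta>' \<omega> + c * (B (enn2real (\<tau> \<omega>) + t) \<omega> - B (enn2real (\<tau> \<omega>)) \<omega>))) \<partial>M"
  let ?K = "\<lambda>g z. \<integral>\<^sup>+w. normal_density 0 (sqrt t) w * ennreal (g (z + c * w)) \<partial>lborel"
  let ?R' = "\<lambda>g. \<integral>\<^sup>+\<omega>. ennreal (W \<omega>) * ?K g (\<zeta>' \<omega>) \<partial>M"
  have L: "?L h = ?L' h" and R: "?R h = ?R' h" for h
    by (intro nn_integral_cong; auto simp: \<zeta>'_def W_top)+
  have "?L' g = (SUP n. ?L' (\<lambda>x. min (g x) (real n)))"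
    by (rule nn_integral_SUP_min_nat) measurable
  also have "\<dots> = (SUP n. ?R' (\<lambda>x. min (g x) (real n)))"
  proof (rule SUP_cong[OF refl])
    fix n
    have "continuous_on UNIV (\<lambda>x. min (g x) (real n))" by (intro continuous_intros g)
    then have "?L (\<lambda>x. min (g x) (real n)) = ?R (\<lambda>x. min (g x) (real n))"
      by (rule bounded) (rule min.cobounded2)
    then show "?L' (\<lambda>x. min (g x) (real n)) = ?R' (\<lambda>x. min (g x) (real n))"
      by (rule trans[OF trans[OF L[symmetric]] R])
  qed
  also have "\<dots> = (\<integral>\<^sup>+\<omega>. (SUP n. ennreal (W \<omega>) * ?K (\<lambda>x. min (g x) (real n)) (\<zeta>' \<omega>)) \<partial>M)"
    by (rule nn_integral_monotone_convergence_SUP[symmetric])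
      (auto simp: incseq_def le_fun_def intro!: mult_left_mono nn_integral_mono ennreal_leI)
  also have "\<dots> = ?R' g"
  proof (rule nn_integral_cong)
    fix \<omega>
    have "?K g (\<zeta>' \<omega>) = (SUP n. ?K (\<lambda>x. min (g x) (real n)) (\<zeta>' \<omega>))"
      by (rule nn_integral_SUP_min_nat) measurable
    then show "(SUP n. ennreal (W \<omega>) * ?K (\<lambda>x. min (g x) (real n)) (\<zeta>' \<omega>)) = ennreal (W \<omega>) * ?K g (\<zeta>' \<omega>)"
      by (simp only: SUP_mult_left_ennreal)
  qed
  finally have "?L' g = ?R' g" .
  then show ?thesis by (rule trans[OF trans[OF L] R[symmetric]])
qed

end

text \<open>The potential operator of the uncontrolled process at rate \<open>disc p\<close>,
  written with Gaussian marginals so that neither a path nor a probability space enters. The time 0,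
  where the density degenerates, is left out.\<close>

definition resolvent :: "inventory_data \<Rightarrow> (real \<Rightarrow> real) \<Rightarrow> real \<Rightarrow> ennreal" where
  "resolvent p g z = (\<integral>\<^sup>+t\<in>{0<..}. ennreal (exp (- disc p * t)) *
     (\<integral>\<^sup>+w. normal_density 0 (sqrt t) w * ennreal (g (z - drift p * t + vol p * w)) \<partial>lborel) \<partial>lborel)"

lemma discount_nonneg: "0 \<le> discount p t"
  by (simp add: discount_def)

lemma discount_le_1: "disc p \<ge> 0 \<Longrightarrow> discount p t \<le> 1"
  by (simp add: discount_def)

lemma discount_measurable[measurable]: "discount p \<in> borel_measurable borel"
  unfolding discount_def[abs_def] by measurable

context brownian_motion
begin

lemma known_at_discount: "stopping_time F \<tau> \<Longrightarrow> known_at \<tau> (\<lambda>\<omega>. discount p (\<tau> \<omega>))"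
proof -
  assume \<tau>: "stopping_time F \<tau>"
  have "known_at \<tau> (\<lambda>\<omega>. exp (- disc p * enn2real (\<tau> \<omega>)))"
    by (rule known_at_compose[OF \<tau> known_at_time[OF \<tau>]]) measurable
  moreover have "(if \<tau> \<omega> \<le> ennreal s then discount p (\<tau> \<omega>) else 0) =
      (if \<tau> \<omega> \<le> ennreal s then exp (- disc p * enn2real (\<tau> \<omega>)) else 0)" for s \<omega>
    by (auto simp: discount_def top_unique)
  ultimately show ?thesis by (simp only: known_at_def)
qed

text \<open>Strong Markov property of \<open>x - \<mu> t + \<sigma> B(t)\<close>, in terms of one-dimensional marginals only.\<close>

lemma strong_markov:
  fixes g :: "real \<Rightarrow> real"
  assumes \<tau>: "stopping_time F \<tau>" and \<zeta>: "known_at \<tau> \<zeta>" and g: "continuous_on UNIV g"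
    and disc: "disc p \<ge> 0"
  shows "(\<integral>\<^sup>+\<omega>. ennreal (discount p (\<tau> \<omega>)) * resolvent p g (\<zeta> \<omega>) \<partial>M) =
    (\<integral>\<^sup>+\<omega>. (\<integral>\<^sup>+u\<in>{u. 0 \<le> u \<and> \<tau> \<omega> \<le> ennreal u}. ennreal (exp (- disc p * u)) *
       ennreal (g (\<zeta> \<omega> - drift p * (u - enn2real (\<tau> \<omega>)) +
         vol p * (B u \<omega> - B (enn2real (\<tau> \<omega>)) \<omega>))) \<partial>lborel) \<partial>M)"
proof -
  define \<zeta>' where "\<zeta>' \<omega> = (if \<tau> \<omega> = \<infinity> then 0 else \<zeta> \<omega>)" for \<omega>
  have [measurable]: "g \<in> borel_measurable borel"
    using g by (simp add: borel_measurable_continuous_onI)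
  have \<zeta>'[measurable]: "\<zeta>' \<in> borel_measurable M"
    unfolding \<zeta>'_def[abs_def] by (rule known_at_measurable[OF \<tau> \<zeta>])
  have [measurable]: "\<tau> \<in> borel_measurable M" by (rule stopping_time_measurable[OF \<tau>])
  let ?T = "\<lambda>\<omega>. enn2real (\<tau> \<omega>)"
  let ?W = "\<lambda>\<omega>. discount p (\<tau> \<omega>)"
  \<comment> \<open>\<open>B\<close> is constrained at nonnegative times only; the maximum gives
    joint measurability over all real t.\<close>
  let ?D = "\<lambda>t \<omega>. B (?T \<omega> + max 0 t) \<omega> - B (?T \<omega>) \<omega>"
  have [measurable]: "(\<lambda>x. B (?T (fst x) + max 0 (snd x)) (fst x)) \<in> borel_measurable (M \<Otimes>\<^sub>M lborel)"
    by (rule B_at_measurable) (auto intro: add_nonneg_nonneg)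
  have [measurable]: "(\<lambda>x. B (?T (fst x)) (fst x)) \<in> borel_measurable (M \<Otimes>\<^sub>M lborel)"
    by (rule B_at_measurable) auto
  let ?K = "\<lambda>t z. \<integral>\<^sup>+w. normal_density 0 (sqrt t) w * ennreal (g (z - drift p * t + vol p * w)) \<partial>lborel"
  let ?e = "\<lambda>t. ennreal (exp (- disc p * t)) * indicator {0<..} t"
  let ?h = "\<lambda>t \<omega>. ?e t * (ennreal (?W \<omega>) * ennreal (g (\<zeta>' \<omega> - drift p * t + vol p * ?D t \<omega>)))"
  interpret lb: pair_sigma_finite M lborel ..
  have K[measurable]: "(\<lambda>x. ?K (snd x) (\<zeta>' (fst x))) \<in> borel_measurable (M \<Otimes>\<^sub>M lborel)"
    unfolding normal_density_def by measurable
  have "(\<integral>\<^sup>+\<omega>. ennreal (?W \<omega>) * resolvent p g (\<zeta> \<omega>) \<partial>M) =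
    (\<integral>\<^sup>+\<omega>. ennreal (?W \<omega>) * resolvent p g (\<zeta>' \<omega>) \<partial>M)"
    by (intro nn_integral_cong) (simp add: \<zeta>'_def discount_def)
  also have "\<dots> = (\<integral>\<^sup>+\<omega>. (\<integral>\<^sup>+t. ?e t * (ennreal (?W \<omega>) * ?K t (\<zeta>' \<omega>)) \<partial>lborel) \<partial>M)"
  proof (rule nn_integral_cong)
    fix \<omega> assume \<omega>: "\<omega> \<in> space M"
    have [measurable]: "(\<lambda>t. ?K t (\<zeta>' \<omega>)) \<in> borel_measurable lborel"
      using measurable_compose[OF measurable_Pair1' K, OF \<omega>] by simp
    show "ennreal (?W \<omega>) * resolvent p g (\<zeta>' \<omega>) = (\<integral>\<^sup>+t. ?e t * (ennreal (?W \<omega>) * ?K t (\<zeta>' \<omega>)) \<partial>lborel)"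
      unfolding resolvent_def
    proof (subst nn_integral_cmult[symmetric])
      show "(\<lambda>t. ennreal (exp (- disc p * t)) * ?K t (\<zeta>' \<omega>) * indicator {0<..} t) \<in> borel_measurable lborel"
        by measurable
    qed (intro nn_integral_cong, simp add: mult_ac)
  qed
  also have "\<dots> = (\<integral>\<^sup>+t. (\<integral>\<^sup>+\<omega>. ?e t * (ennreal (?W \<omega>) * ?K t (\<zeta>' \<omega>)) \<partial>M) \<partial>lborel)"
    by (rule lb.Fubini'[symmetric]) measurable
  also have "\<dots> = (\<integral>\<^sup>+t. (\<integral>\<^sup>+\<omega>. ?h t \<omega> \<partial>M) \<partial>lborel)"
  proof (rule nn_integral_cong)
    fix t :: real
    have [measurable]: "(\<lambda>\<omega>. ?K t (\<zeta>' \<omega>)) \<in> borel_measurable M"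
      unfolding normal_density_def by measurable
    have [measurable]: "(\<lambda>\<omega>. ?D t \<omega>) \<in> borel_measurable M"
      by (intro borel_measurable_diff B_at_measurable) auto
    show "(\<integral>\<^sup>+\<omega>. ?e t * (ennreal (?W \<omega>) * ?K t (\<zeta>' \<omega>)) \<partial>M) = (\<integral>\<^sup>+\<omega>. ?h t \<omega> \<partial>M)"
    proof (cases "t > 0")
      case True
      \<comment> \<open>For fixed t the drift is a deterministic shift of the starting point, so the
        driftless statement applies.\<close>
      have "known_at \<tau> (\<lambda>\<omega>. \<zeta> \<omega> - drift p * t)"
        by (rule known_at_compose[OF \<tau> \<zeta>]) measurable
      note strong_markov_marginal[OF \<tau> known_at_discount[OF \<tau>] this _ _ True g, of p "vol p"]
      then have "(\<integral>\<^sup>+\<omega>. ennreal (?W \<omega>) * ennreal (g (\<zeta> \<omega> - drift p * t + vol p * (B (?T \<omega> + t) \<omega> - B (?T \<omega>) \<omega>))) \<partial>M) =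
          (\<integral>\<^sup>+\<omega>. ennreal (?W \<omega>) * ?K t (\<zeta> \<omega>) \<partial>M)"
        using disc by (simp add: discount_le_1) (simp add: discount_def)
      also have "(\<integral>\<^sup>+\<omega>. ennreal (?W \<omega>) * ?K t (\<zeta> \<omega>) \<partial>M) = (\<integral>\<^sup>+\<omega>. ennreal (?W \<omega>) * ?K t (\<zeta>' \<omega>) \<partial>M)"
        by (intro nn_integral_cong) (simp add: \<zeta>'_def discount_def)
      also have "(\<integral>\<^sup>+\<omega>. ennreal (?W \<omega>) * ennreal (g (\<zeta> \<omega> - drift p * t + vol p * (B (?T \<omega> + t) \<omega> - B (?T \<omega>) \<omega>))) \<partial>M) =
        (\<integral>\<^sup>+\<omega>. ennreal (?W \<omega>) * ennreal (g (\<zeta>' \<omega> - drift p * t + vol p * ?D t \<omega>)) \<partial>M)"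
        using True by (intro nn_integral_cong) (simp add: \<zeta>'_def discount_def)
      finally show ?thesis
        by (simp add: nn_integral_cmult)
    qed simp
  qed
  also have "\<dots> = (\<integral>\<^sup>+\<omega>. (\<integral>\<^sup>+t. ?h t \<omega> \<partial>lborel) \<partial>M)"
    by (rule lb.Fubini') measurable
  also have "\<dots> = (\<integral>\<^sup>+\<omega>. (\<integral>\<^sup>+u\<in>{u. 0 \<le> u \<and> \<tau> \<omega> \<le> ennreal u}. ennreal (exp (- disc p * u)) *
       ennreal (g (\<zeta> \<omega> - drift p * (u - enn2real (\<tau> \<omega>)) +
         vol p * (B u \<omega> - B (enn2real (\<tau> \<omega>)) \<omega>))) \<partial>lborel) \<partial>M)"
  proof (rule nn_integral_cong)
    fix \<omega> assume \<omega>: "\<omega> \<in> space M"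
    show "(\<integral>\<^sup>+t. ?h t \<omega> \<partial>lborel) = (\<integral>\<^sup>+u\<in>{u. 0 \<le> u \<and> \<tau> \<omega> \<le> ennreal u}. ennreal (exp (- disc p * u)) *
       ennreal (g (\<zeta> \<omega> - drift p * (u - enn2real (\<tau> \<omega>)) +
         vol p * (B u \<omega> - B (enn2real (\<tau> \<omega>)) \<omega>))) \<partial>lborel)"
    proof (cases "\<tau> \<omega>" rule: ennreal_cases)
      case (real r)
      let ?f = "\<lambda>u. ennreal (exp (- disc p * u)) *
         ennreal (g (\<zeta> \<omega> - drift p * (u - r) + vol p * (B (max 0 u) \<omega> - B r \<omega>))) * indicator {r..} u"
      have [measurable]: "(\<lambda>u. B (max 0 u) \<omega>) \<in> borel_measurable borel"
        using \<omega> by (intro B_at_measurable) auto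
      have "(\<integral>\<^sup>+u\<in>{u. 0 \<le> u \<and> \<tau> \<omega> \<le> ennreal u}. ennreal (exp (- disc p * u)) *
         ennreal (g (\<zeta> \<omega> - drift p * (u - enn2real (\<tau> \<omega>)) +
         vol p * (B u \<omega> - B (enn2real (\<tau> \<omega>)) \<omega>))) \<partial>lborel) = (\<integral>\<^sup>+u. ?f u \<partial>lborel)"
        using real by (intro nn_integral_cong) (auto simp: indicator_def)
      also have "\<dots> = (\<integral>\<^sup>+t. ?f (r + 1 * t) \<partial>lborel)"
        by (subst nn_integral_real_affine[where c = 1 and t = r]) auto
      also have "\<dots> = (\<integral>\<^sup>+t. ?h t \<omega> \<partial>lborel)"
      proof (rule nn_integral_cong_AE)
        \<comment> \<open>The resolvent integrates over t > 0, the path integral over a closed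
          half-line; they differ in one point.\<close>
        have "AE t in lborel. t \<noteq> (0::real)" by (rule AE_lborel_singleton)
        then show "AE t in lborel. ?f (r + 1 * t) = ?h t \<omega>"
        proof eventually_elim
          case (elim t)
          show ?case
          proof (cases "t > 0")
            case True
            have "exp (- disc p * (r + t)) = exp (- disc p * t) * exp (- disc p * r)"
              by (simp add: exp_add[symmetric] algebra_simps)
            then show ?thesis using real True
              by (simp add: discount_def \<zeta>'_def ennreal_mult mult_ac)
          qed (use elim in auto)
        qed
      qed
      finally show ?thesis ..
    qed (simp add: discount_def top_unique)
  qed
  finally show ?thesis .
qed

end

section \<open>Resolvent and Green function\<close>

locale inventory_model =
  fixes p :: inventory_data
  assumes inventory_assumptions: "inventory_assumptions p"
begin

abbreviation "\<mu> \<equiv> drift p"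
abbreviation "\<sigma> \<equiv> vol p"
abbreviation "\<beta> \<equiv> disc p"
abbreviation "k \<equiv> unit_cost p"
abbreviation "Q \<equiv> qty p"
abbreviation "K1 \<equiv> setup1 p"
abbreviation "K2 \<equiv> setup2 p"
abbreviation "g \<equiv> hold p"
abbreviation "l1 \<equiv> lam1 p"
abbreviation "l2 \<equiv> lam2 p"

lemma param_pos: "\<mu> > 0" "\<sigma> > 0" "\<beta> > 0" "k \<ge> 0" "Q > 0" "K1 > 0" "K1 < K2" "K2 > 0"
  using inventory_assumptions unfolding inventory_assumptions_def by auto

text \<open>The discriminant of the characteristic equation of the generator: \<open>l1\<close> and
  \<open>- l2\<close> are the roots of (\<sigma>^2/2) l^2 - \<mu> l - \<beta> = 0.\<close>

definition \<gamma> :: real where "\<gamma> = sqrt (\<mu>\<^sup>2 + 2 * \<beta> * \<sigma>\<^sup>2)"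

lemma \<gamma>_gt: "\<gamma> > \<mu>"
proof -
  have "sqrt (\<mu>\<^sup>2) < \<gamma>" unfolding \<gamma>_def using param_pos by (intro real_sqrt_less_mono) auto
  then show ?thesis using param_pos by simp
qed

lemma lam_eq: "l1 = (\<mu> + \<gamma>) / \<sigma>\<^sup>2" "l2 = (\<gamma> - \<mu>) / \<sigma>\<^sup>2"
  by (simp_all add: lam1_def lam2_def \<gamma>_def)

lemma lam_pos: "l2 > 0" "l1 > 0" "l2 < l1"
  using \<gamma>_gt param_pos by (auto simp: lam_eq field_simps)

definition C :: real where "C = 2 / (\<sigma>\<^sup>2 * (l1 + l2))"

lemma C_eq: "C = 1 / \<gamma>" and C_pos: "C > 0"
  using \<gamma>_gt param_pos by (auto simp: C_def lam_eq field_simps)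

text \<open>The Green function of the killed process as a function of target minus start. Targets
  above the start decay at the larger rate \<open>l1\<close>, since the drift points
  downwards.\<close>

definition green :: "real \<Rightarrow> real" where
  "green v = C * (if v \<ge> 0 then exp (- l1 * v) else exp (l2 * v))"

lemma green_measurable[measurable]: "green \<in> borel_measurable borel"
  unfolding green_def[abs_def] by measurable

text \<open>Expanding the square in the Gaussian exponent leaves a term linear in t, a term in 1/t
  and a constant; a, b and c below are read off from these. The diagonal is excluded because b must
  be positive.\<close>

lemma nn_integral_discounted_normal_density:
  assumes "y \<noteq> z"
  shows "(\<integral>\<^sup>+t\<in>{0<..}. ennreal (exp (- \<beta> * t) * normal_density (z - \<mu> * t) (\<sigma> * sqrt t) y) \<partial>lborel)
    = ennreal (green (y - z))"
proof -
  define v where "v = y - z"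
  define a where "a = \<gamma> / (sqrt 2 * \<sigma>)"
  define b where "b = \<bar>v\<bar> / (sqrt 2 * \<sigma>)"
  define c where "c = exp (- \<mu> * v / \<sigma>\<^sup>2) / (\<sigma> * sqrt (2 * pi))"
  have \<sigma>: "\<sigma> > 0" and \<gamma>: "\<gamma> > 0" using param_pos \<gamma>_gt by auto
  have ab: "a > 0" "b > 0" using \<sigma> \<gamma> assms by (auto simp: a_def b_def v_def)
  have c: "c \<ge> 0" using \<sigma> by (simp add: c_def)
  have \<gamma>2: "\<gamma>\<^sup>2 = \<mu>\<^sup>2 + 2 * \<beta> * \<sigma>\<^sup>2"
    unfolding \<gamma>_def using param_pos by simp
  have eq: "exp (- \<beta> * t) * normal_density (z - \<mu> * t) (\<sigma> * sqrt t) y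
      = c * (exp (- a\<^sup>2 * t - b\<^sup>2 / t) / sqrt t)" if t: "t > 0" for t
  proof -
    have "- \<beta> * t + (- (y - (z - \<mu> * t))\<^sup>2 / (2 * (\<sigma> * sqrt t)\<^sup>2)) =
        - \<mu> * v / \<sigma>\<^sup>2 + (- a\<^sup>2 * t - b\<^sup>2 / t)"
    proof -
      have a2: "a\<^sup>2 = (\<mu>\<^sup>2 + 2 * \<beta> * \<sigma>\<^sup>2) / (2 * \<sigma>\<^sup>2)" and b2: "b\<^sup>2 = v\<^sup>2 / (2 * \<sigma>\<^sup>2)"
        by (simp_all add: a_def b_def power_divide power_mult_distrib \<gamma>2)
      have s2: "(\<sigma> * sqrt t)\<^sup>2 = \<sigma>\<^sup>2 * t" using t by (simp add: power_mult_distrib)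
      show ?thesis
        unfolding a2 b2 s2 v_def using \<sigma> t by (simp add: field_simps power2_eq_square)
    qed
    moreover have "sqrt (2 * pi * (\<sigma> * sqrt t)\<^sup>2) = \<sigma> * sqrt (2 * pi) * sqrt t"
      using \<sigma> t by (simp add: real_sqrt_mult)
    ultimately show ?thesis
      unfolding normal_density_def c_def by (simp add: exp_add[symmetric])
  qed
  have "(\<integral>\<^sup>+t\<in>{0<..}. ennreal (exp (- \<beta> * t) * normal_density (z - \<mu> * t) (\<sigma> * sqrt t) y) \<partial>lborel)
    = (\<integral>\<^sup>+t. ennreal c * (ennreal (exp (- a\<^sup>2 * t - b\<^sup>2 / t) / sqrt t) * indicator {0<..} t) \<partial>lborel)"
  proof (rule nn_integral_cong)
    fix t
    show "ennreal (exp (- \<beta> * t) * normal_density (z - \<mu> * t) (\<sigma> * sqrt t) y) * indicator {0<..} t =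
      ennreal c * (ennreal (exp (- a\<^sup>2 * t - b\<^sup>2 / t) / sqrt t) * indicator {0<..} t)"
    proof (cases "t > 0")
      case True
      show ?thesis unfolding eq[OF True] ennreal_mult'[OF c] mult.assoc ..
    qed simp
  qed
  also have "\<dots> = ennreal c * ennreal (sqrt pi / a * exp (- 2 * a * b))"
    by (subst nn_integral_cmult) (use nn_integral_exp_minus_inverse[OF ab] in auto)
  also have "\<dots> = ennreal (c * (sqrt pi / a * exp (- 2 * a * b)))"
    by (rule ennreal_mult'[OF c, symmetric])
  also have "c * (sqrt pi / a * exp (- 2 * a * b)) = green v"
  proof -
    have ab2: "2 * a * b = \<gamma> * \<bar>v\<bar> / \<sigma>\<^sup>2"
    proof -
      have "2 * a * b = 2 * (\<gamma> * \<bar>v\<bar>) / (sqrt 2 * \<sigma> * (sqrt 2 * \<sigma>))" by (simp add: a_def b_def)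
      also have "sqrt 2 * \<sigma> * (sqrt 2 * \<sigma>) = 2 * \<sigma>\<^sup>2" by (simp add: power2_eq_square mult_ac)
      finally show ?thesis by simp
    qed
    have "c * (sqrt pi / a * exp (- 2 * a * b)) = C * (exp (- \<mu> * v / \<sigma>\<^sup>2) * exp (- (2 * a * b)))"
      using \<sigma> \<gamma> by (simp add: c_def a_def C_eq real_sqrt_mult field_simps)
    also have "\<dots> = C * exp (- (\<mu> * v + \<gamma> * \<bar>v\<bar>) / \<sigma>\<^sup>2)"
      unfolding ab2 exp_add[symmetric] by (simp add: add_divide_distrib diff_divide_distrib)
    also have "\<dots> = green v"
      unfolding green_def lam_eq using \<sigma> by (auto simp: field_simps)
    finally show ?thesis .
  qed
  finally show ?thesis unfolding v_def .
qed

text \<open>With y = z - \<mu> t + \<sigma> w the Gaussian weight becomes the transition density at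
  y, and Tonelli lets time be integrated first, for almost every y.\<close>

lemma resolvent_eq_green:
  assumes f[measurable]: "f \<in> borel_measurable borel"
  shows "resolvent p f z = (\<integral>\<^sup>+y. ennreal (green (y - z)) * ennreal (f y) \<partial>lborel)"
proof -
  have \<sigma>: "\<sigma> > 0" using param_pos by auto
  let ?N = "\<lambda>t y. exp (- \<beta> * t) * normal_density (z - \<mu> * t) (\<sigma> * sqrt t) y"
  have [measurable]: "(\<lambda>x. ?N (fst x) (snd x)) \<in> borel_measurable (borel \<Otimes>\<^sub>M borel)"
    "(\<lambda>x. ?N (snd x) (fst x)) \<in> borel_measurable (borel \<Otimes>\<^sub>M borel)"
    "(\<lambda>t. ?N t y) \<in> borel_measurable borel" for y
    unfolding normal_density_def by measurable
  have "resolvent p f z = (\<integral>\<^sup>+t. (\<integral>\<^sup>+y. ennreal (?N t y) * ennreal (f y) * indicator {0<..} t \<partial>lborel) \<partial>lborel)"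
    unfolding resolvent_def
  proof (rule nn_integral_cong)
    fix t :: real
    show "ennreal (exp (- \<beta> * t)) *
      (\<integral>\<^sup>+w. normal_density 0 (sqrt t) w * ennreal (f (z - \<mu> * t + \<sigma> * w)) \<partial>lborel) * indicator {0<..} t =
      (\<integral>\<^sup>+y. ennreal (?N t y) * ennreal (f y) * indicator {0<..} t \<partial>lborel)"
    proof (cases "t > 0")
      case t: True
      have nd: "normal_density 0 (sqrt t) w = \<sigma> * normal_density (z - \<mu> * t) (\<sigma> * sqrt t) (z - \<mu> * t + \<sigma> * w)" for w
        using \<sigma> t unfolding normal_density_def by (simp add: power_mult_distrib real_sqrt_mult)
      have "(\<integral>\<^sup>+y. ennreal (?N t y) * ennreal (f y) \<partial>lborel) =
        ennreal \<bar>\<sigma>\<bar> * (\<integral>\<^sup>+w. ennreal (?N t ((z - \<mu> * t) + \<sigma> * w)) * ennreal (f ((z - \<mu> * t) + \<sigma> * w)) \<partial>lborel)"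
        using \<sigma> by (intro nn_integral_real_affine) auto
      also have "\<dots> = (\<integral>\<^sup>+w. ennreal (exp (- \<beta> * t)) * (normal_density 0 (sqrt t) w * ennreal (f (z - \<mu> * t + \<sigma> * w))) \<partial>lborel)"
        using \<sigma> by (subst nn_integral_cmult[symmetric]) (auto intro!: nn_integral_cong simp: nd ennreal_mult'' ennreal_mult' mult_ac)
      also have "\<dots> = ennreal (exp (- \<beta> * t)) * (\<integral>\<^sup>+w. normal_density 0 (sqrt t) w * ennreal (f (z - \<mu> * t + \<sigma> * w)) \<partial>lborel)"
        by (rule nn_integral_cmult) measurable
      finally show ?thesis using t by simp
    qed simp
  qed
  also have "\<dots> = (\<integral>\<^sup>+y. (\<integral>\<^sup>+t. ennreal (?N t y) * ennreal (f y) * indicator {0<..} t \<partial>lborel) \<partial>lborel)"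
    by (rule lborel_pair.Fubini') (simp only: split_beta', measurable)
  also have "\<dots> = (\<integral>\<^sup>+y. ennreal (green (y - z)) * ennreal (f y) \<partial>lborel)"
  proof (rule nn_integral_cong_AE)
    have "AE y in lborel. y \<noteq> z" by (rule AE_lborel_singleton)
    then show "AE y in lborel. (\<integral>\<^sup>+t. ennreal (?N t y) * ennreal (f y) * indicator {0<..} t \<partial>lborel) = ennreal (green (y - z)) * ennreal (f y)"
    proof eventually_elim
      case (elim y)
      have "(\<integral>\<^sup>+t. ennreal (?N t y) * ennreal (f y) * indicator {0<..} t \<partial>lborel) =
        (\<integral>\<^sup>+t\<in>{0<..}. ennreal (?N t y) \<partial>lborel) * ennreal (f y)"
      proof (subst nn_integral_multc[symmetric])
        show "(\<lambda>t. ennreal (?N t y) * indicator {0<..} t) \<in> borel_measurable lborel" by measurable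
      qed (intro nn_integral_cong, simp add: mult_ac)
      then show ?case using nn_integral_discounted_normal_density[OF elim] by simp
    qed
  qed
  finally show ?thesis .
qed

lemma nn_integral_exp_atLeast:
  assumes "c > 0"
  shows "(\<integral>\<^sup>+v\<in>{a..}. ennreal (exp (- c * v)) \<partial>lborel) = ennreal (exp (- c * a) / c)"
proof -
  have "(\<integral>\<^sup>+v\<in>{a..}. ennreal (exp (- c * v)) \<partial>lborel) = ennreal (0 - (- exp (- c * a) / c))"
  proof (rule nn_integral_FTC_atLeast)
    show "((\<lambda>v. - exp (- c * v) / c) \<longlongrightarrow> 0) at_top" using assms by real_asymp
  qed (use assms in \<open>auto intro!: derivative_eq_intros\<close>)
  then show ?thesis by simp
qed

lemma nn_integral_exp_atMost:
  assumes "c > 0"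
  shows "(\<integral>\<^sup>+v\<in>{..a}. ennreal (exp (c * v)) \<partial>lborel) = ennreal (exp (c * a) / c)"
proof -
  have "(\<integral>\<^sup>+v\<in>{..a}. ennreal (exp (c * v)) \<partial>lborel) =
    (\<integral>\<^sup>+v. ennreal (exp (c * (0 + -1 * v))) * indicator {..a} (0 + -1 * v) \<partial>lborel)"
    by (subst nn_integral_real_affine[where c = "-1" and t = 0]) auto
  also have "\<dots> = (\<integral>\<^sup>+v\<in>{-a..}. ennreal (exp (- c * v)) \<partial>lborel)"
    by (intro nn_integral_cong) (auto simp: indicator_def)
  finally show ?thesis using nn_integral_exp_atLeast[OF assms, of "-a"] by simp
qed

text \<open>The threshold is \<open>l2\<close>, the smaller of the two decay rates of the
  kernel.\<close>

lemma green_exp_finite: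
  assumes "0 \<le> \<theta>" "\<theta> < l2"
  shows "(\<integral>\<^sup>+v. ennreal (green v) * ennreal (exp (\<theta> * \<bar>v\<bar>)) \<partial>lborel) < \<infinity>"
proof -
  have "(\<integral>\<^sup>+v. ennreal (green v) * ennreal (exp (\<theta> * \<bar>v\<bar>)) \<partial>lborel) \<le>
    (\<integral>\<^sup>+v. ennreal C * (ennreal (exp (- (l1 - \<theta>) * v)) * indicator {0..} v) +
        ennreal C * (ennreal (exp ((l2 - \<theta>) * v)) * indicator {..0} v) \<partial>lborel)"
    using C_pos by (intro nn_integral_mono)
      (auto simp: green_def indicator_def ennreal_mult'[symmetric] exp_add[symmetric] algebra_simps
        intro!: ennreal_leI)
  also have "\<dots> = ennreal C * ennreal (exp (- (l1 - \<theta>) * 0) / (l1 - \<theta>)) +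
     ennreal C * ennreal (exp ((l2 - \<theta>) * 0) / (l2 - \<theta>))"
    using assms lam_pos nn_integral_exp_atLeast[of "l1 - \<theta>" 0] nn_integral_exp_atMost[of "l2 - \<theta>" 0]
    by (subst nn_integral_add) (simp_all add: nn_integral_cmult)
  also have "\<dots> < \<infinity>" by (simp add: ennreal_mult_less_top)
  finally show ?thesis .
qed

lemma green_shift:
  assumes [measurable]: "h \<in> borel_measurable borel"
  shows "(\<integral>\<^sup>+y. ennreal (green (y - z)) * h y \<partial>lborel) = (\<integral>\<^sup>+v. ennreal (green v) * h (z + v) \<partial>lborel)"
  by (subst nn_integral_real_affine[where c = 1 and t = z]) auto

definition J :: "real \<Rightarrow> ennreal" where
  "J \<theta> = (\<integral>\<^sup>+v. ennreal (green v) * ennreal (exp (\<theta> * \<bar>v\<bar>)) \<partial>lborel)"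

lemma resolvent_le:
  assumes [measurable]: "f \<in> borel_measurable borel" and f: "\<And>y. f y \<le> c * exp (\<theta> * \<bar>y\<bar>)"
    and c: "c \<ge> 0" and \<theta>: "\<theta> \<ge> 0"
  shows "resolvent p f z \<le> ennreal (c * exp (\<theta> * \<bar>z\<bar>)) * J \<theta>"
proof -
  have "resolvent p f z = (\<integral>\<^sup>+v. ennreal (green v) * ennreal (f (z + v)) \<partial>lborel)"
    by (simp add: resolvent_eq_green green_shift)
  also have "\<dots> \<le> (\<integral>\<^sup>+v. ennreal (c * exp (\<theta> * \<bar>z\<bar>)) * (ennreal (green v) * ennreal (exp (\<theta> * \<bar>v\<bar>))) \<partial>lborel)"
  proof (rule nn_integral_mono)
    fix v
    have "f (z + v) \<le> c * exp (\<theta> * \<bar>z + v\<bar>)" by (rule f)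
    also have "\<dots> \<le> c * exp (\<theta> * (\<bar>z\<bar> + \<bar>v\<bar>))"
      using c \<theta> by (intro mult_left_mono iffD2[OF exp_le_cancel_iff]) auto
    also have "\<dots> = c * exp (\<theta> * \<bar>z\<bar>) * exp (\<theta> * \<bar>v\<bar>)"
      by (simp add: distrib_left exp_add)
    finally have "ennreal (f (z + v)) \<le> ennreal (c * exp (\<theta> * \<bar>z\<bar>)) * ennreal (exp (\<theta> * \<bar>v\<bar>))"
      using c by (simp add: ennreal_mult'[symmetric] ennreal_leI)
    then have "ennreal (green v) * ennreal (f (z + v)) \<le> ennreal (green v) * (ennreal (c * exp (\<theta> * \<bar>z\<bar>)) * ennreal (exp (\<theta> * \<bar>v\<bar>)))"
      by (rule mult_left_mono) simp
    then show "ennreal (green v) * ennreal (f (z + v)) \<le> ennreal (c * exp (\<theta> * \<bar>z\<bar>)) * (ennreal (green v) * ennreal (exp (\<theta> * \<bar>v\<bar>)))"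
      by (simp add: mult_ac)
  qed
  also have "\<dots> = ennreal (c * exp (\<theta> * \<bar>z\<bar>)) * J \<theta>"
    unfolding J_def by (rule nn_integral_cmult) measurable
  finally show ?thesis .
qed

text \<open>Translation invariance of the kernel makes exponentials eigenfunctions. Strict
  positivity of the eigenvalue is recorded because it is divided by in the transversality
  argument.\<close>

lemma resolvent_exp:
  assumes "0 \<le> \<theta>" "\<theta> < l2"
  obtains c where "c > 0" "\<And>z. resolvent p (\<lambda>y. exp (\<theta> * y)) z = ennreal (c * exp (\<theta> * z))"
proof -
  define c where "c = (\<integral>\<^sup>+v. ennreal (green v) * ennreal (exp (\<theta> * v)) \<partial>lborel)"
  have "c \<le> J \<theta>"
    unfolding c_def J_def using assms
    by (intro nn_integral_mono mult_left_mono ennreal_leI) (auto intro!: mult_left_mono)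
  also have "\<dots> < \<infinity>" unfolding J_def by (rule green_exp_finite[OF assms])
  finally have fin: "c < \<infinity>" .
  have pos: "c \<noteq> 0"
  proof
    assume "c = 0"
    then have "AE v in lborel. ennreal (green v) * ennreal (exp (\<theta> * v)) = 0"
      unfolding c_def by (subst (asm) nn_integral_0_iff_AE) auto
    \<comment> \<open>The kernel is positive everywhere, so a vanishing integral would make the
      whole line a null set.\<close>
    then have "AE v in (lborel :: real measure). False"
      using C_pos by (auto simp: green_def ennreal_mult'[symmetric] ennreal_eq_0_iff not_le zero_less_mult_iff split: if_splits elim!: eventually_mono)
    then have "ae_filter (lborel :: real measure) = bot" by (simp add: trivial_limit_def)
    then show False by (simp add: ae_filter_eq_bot_iff)
  qed
  have "resolvent p (\<lambda>y. exp (\<theta> * y)) z = ennreal (exp (\<theta> * z)) * c" for z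
  proof -
    have "resolvent p (\<lambda>y. exp (\<theta> * y)) z = (\<integral>\<^sup>+v. ennreal (green v) * ennreal (exp (\<theta> * (z + v))) \<partial>lborel)"
      by (simp add: resolvent_eq_green green_shift)
    also have "\<dots> = (\<integral>\<^sup>+v. ennreal (exp (\<theta> * z)) * (ennreal (green v) * ennreal (exp (\<theta> * v))) \<partial>lborel)"
      by (intro nn_integral_cong) (simp add: distrib_left exp_add ennreal_mult mult_ac)
    finally show ?thesis unfolding c_def by (simp add: nn_integral_cmult)
  qed
  moreover have "c = ennreal (enn2real c)" using fin by simp
  moreover have "enn2real c > 0" using fin pos by (simp add: enn2real_positive_iff zero_less_iff_neq_zero)
  ultimately show thesis
    by (intro that[of "enn2real c"]) (auto simp: ennreal_mult' mult.commute)
qed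

text \<open>A source below \<open>s\<close> is not felt by a path as long as it stays above \<open>s\<close>, so that the decreasing
  exponential is, up to a factor, the resolvent of such a source.\<close>

lemma resolvent_below:
  obtains c where "c > 0"
    "\<And>z. s \<le> z \<Longrightarrow> resolvent p (\<lambda>y. max 0 (min 1 (s - y))) z = ennreal (c * exp (- l2 * z))"
proof -
  \<comment> \<open>A ramp instead of an indicator, because the strong Markov property is available
    for continuous functions.\<close>
  let ?f = "\<lambda>y. max 0 (min 1 (s - y))"
  define c where "c = (\<integral>\<^sup>+y. ennreal (C * exp (l2 * y)) * ennreal (?f y) \<partial>lborel)"
  have eq: "resolvent p ?f z = ennreal (exp (- l2 * z)) * c" if "s \<le> z" for z
  proof -
    have "resolvent p ?f z = (\<integral>\<^sup>+y. ennreal (green (y - z)) * ennreal (?f y) \<partial>lborel)"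
      by (rule resolvent_eq_green) measurable
    also have "\<dots> = (\<integral>\<^sup>+y. ennreal (exp (- l2 * z)) * (ennreal (C * exp (l2 * y)) * ennreal (?f y)) \<partial>lborel)"
    proof (rule nn_integral_cong)
      fix y
      show "ennreal (green (y - z)) * ennreal (?f y) = ennreal (exp (- l2 * z)) * (ennreal (C * exp (l2 * y)) * ennreal (?f y))"
      proof (cases "y < s")
        case True
        then have "green (y - z) = exp (- l2 * z) * (C * exp (l2 * y))"
          using that by (simp add: green_def exp_add[symmetric] algebra_simps)
        then show ?thesis using C_pos by (simp add: ennreal_mult mult_ac)
      qed simp
    qed
    also have "\<dots> = ennreal (exp (- l2 * z)) * c"
      unfolding c_def by (rule nn_integral_cmult) measurable
    finally show ?thesis .
  qed
  have "c \<le> (\<integral>\<^sup>+y. ennreal C * (ennreal (exp (l2 * y)) * indicator {..s} y) \<partial>lborel)"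
    unfolding c_def using C_pos
    by (intro nn_integral_mono) (auto simp: indicator_def ennreal_mult'[symmetric] max_def min_def intro!: ennreal_leI mult_left_le)
  also have "\<dots> = ennreal C * ennreal (exp (l2 * s) / l2)"
    using lam_pos nn_integral_exp_atMost[of l2 s] by (simp add: nn_integral_cmult)
  also have "\<dots> < \<infinity>" by (simp add: ennreal_mult_less_top)
  finally have fin: "c < \<infinity>" .
  \<comment> \<open>Below s - 1 the ramp equals 1, which bounds the factor c away from 0.\<close>
  have "0 < ennreal C * ennreal (exp (l2 * (s - 1)) / l2)"
    using C_pos lam_pos by (simp add: ennreal_zero_less_mult_iff)
  also have "\<dots> = (\<integral>\<^sup>+y. ennreal C * (ennreal (exp (l2 * y)) * indicator {..s - 1} y) \<partial>lborel)"
    using lam_pos nn_integral_exp_atMost[of l2 "s - 1"] by (simp add: nn_integral_cmult)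
  also have "\<dots> \<le> c"
    unfolding c_def using C_pos
    by (intro nn_integral_mono) (auto simp: indicator_def ennreal_mult'[symmetric])
  finally have pos: "c > 0" .
  have "c = ennreal (enn2real c)" using fin by simp
  moreover have "enn2real c > 0" using fin pos by (simp add: enn2real_positive_iff)
  ultimately show thesis
    using eq by (intro that[of "enn2real c"]) (auto simp: ennreal_mult' mult.commute)
qed

section \<open>Sign, monotonicity and growth of the holding cost\<close>

lemma hold_continuous: "continuous_on S g"
proof -
  have "convex_on UNIV g" using inventory_assumptions unfolding inventory_assumptions_def by auto
  then have "continuous_on UNIV g" by (rule convex_on_continuous[OF open_UNIV])
  then show ?thesis by (rule continuous_on_subset) simp
qed

lemma hold_measurable[measurable]: "g \<in> borel_measurable borel"
  by (rule borel_measurable_continuous_onI[OF hold_continuous])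

lemma hold_0: "g 0 = 0"
  using inventory_assumptions unfolding inventory_assumptions_def by auto

lemma hold_deriv: "x \<noteq> 0 \<Longrightarrow> (g has_real_derivative deriv g x) (at x)"
  using inventory_assumptions unfolding inventory_assumptions_def
  by (simp add: DERIV_deriv_iff_field_differentiable)

lemma hold_strict_mono: "0 \<le> x \<Longrightarrow> x < y \<Longrightarrow> g x < g y"
proof (rule DERIV_pos_imp_increasing_open[OF _ _ hold_continuous])
  fix u assume "0 \<le> x" "x < u"
  then show "\<exists>d. (g has_real_derivative d) (at u) \<and> 0 < d"
    using hold_deriv[of u] inventory_assumptions unfolding inventory_assumptions_def by force
qed

lemma hold_nonneg: "g x \<ge> 0"
proof (cases x "0::real" rule: linorder_cases)
  case less
  have "g x > g 0"
  proof (rule DERIV_neg_imp_decreasing_open[OF less _ hold_continuous])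
    fix u :: real assume "u < 0"
    then show "\<exists>d. (g has_real_derivative d) (at u) \<and> d < 0"
      using hold_deriv[of u] inventory_assumptions unfolding inventory_assumptions_def by force
  qed
  then show ?thesis by (simp add: hold_0)
next
  case greater
  then show ?thesis using hold_strict_mono[of 0 x] by (simp add: hold_0)
qed (simp add: hold_0)

lemma hold_mono: "0 \<le> x \<Longrightarrow> x \<le> y \<Longrightarrow> g x \<le> g y"
  using hold_strict_mono[of x y] by (cases "x = y") auto

lemma hold_growth:
  assumes \<delta>: "\<delta> > 0"
  obtains c where "c > 0" "\<And>y. g y \<le> c * exp (\<delta> * \<bar>y\<bar>)"
proof -
  obtain n :: nat and a b :: real where n: "n > 0" and ab: "a > 0" "b > 0" and le: "\<And>x. g x \<le> a + b * \<bar>x\<bar> ^ n"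
    using inventory_assumptions unfolding inventory_assumptions_def by blast
  \<comment> \<open>Taken from (1 + u/n)^n \<le> exp u with u = \<delta> |y|; the factor m undoes
    the scaling of |y|.\<close>
  define m where "m = (real n / \<delta>) ^ n"
  have m: "m > 0" using n \<delta> by (simp add: m_def)
  have "\<bar>y\<bar> ^ n \<le> m * exp (\<delta> * \<bar>y\<bar>)" for y :: real
  proof -
    have "(\<delta> * \<bar>y\<bar> / real n) ^ n \<le> (1 + \<delta> * \<bar>y\<bar> / real n) ^ n"
      using \<delta> by (intro power_mono) auto
    also have "\<dots> \<le> exp (\<delta> * \<bar>y\<bar>)"
      using \<delta> n by (intro exp_ge_one_plus_x_over_n_power_n) (auto intro: order_trans[of _ 0])
    finally have "m * (\<delta> * \<bar>y\<bar> / real n) ^ n \<le> m * exp (\<delta> * \<bar>y\<bar>)" using m by simp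
    also have "m * (\<delta> * \<bar>y\<bar> / real n) ^ n = \<bar>y\<bar> ^ n"
      unfolding m_def power_mult_distrib[symmetric] using \<delta> n by (simp add: field_simps)
    finally show ?thesis .
  qed
  then have "g y \<le> (a + b * m) * exp (\<delta> * \<bar>y\<bar>)" for y
  proof -
    have "g y \<le> a * 1 + b * (m * exp (\<delta> * \<bar>y\<bar>))"
      using le[of y] \<open>\<bar>y\<bar> ^ n \<le> m * exp (\<delta> * \<bar>y\<bar>)\<close> ab by (smt (verit) mult_left_mono)
    also have "\<dots> \<le> a * exp (\<delta> * \<bar>y\<bar>) + b * (m * exp (\<delta> * \<bar>y\<bar>))"
      using ab \<delta> by (intro add_right_mono mult_left_mono) auto
    finally show ?thesis by (simp add: algebra_simps)
  qed
  then show thesis using ab m by (intro that[of "a + b * m"]) (auto intro: add_pos_pos)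
qed

lemma resolvent_hold_finite: "resolvent p g z < \<infinity>"
proof -
  have \<theta>: "0 < l2 / 2" "l2 / 2 < l2" using lam_pos by auto
  obtain c where c: "c > 0" "\<And>y. g y \<le> c * exp (l2 / 2 * \<bar>y\<bar>)"
    using hold_growth[OF \<theta>(1)] by blast
  have "resolvent p g z \<le> ennreal (c * exp (l2 / 2 * \<bar>z\<bar>)) * J (l2 / 2)"
    by (rule resolvent_le) (use c \<theta> in auto)
  also have "\<dots> < \<infinity>"
    using green_exp_finite[of "l2 / 2"] \<theta> by (simp add: J_def ennreal_mult_less_top)
  finally show ?thesis .
qed

end

section \<open>The functions \<open>v\<^sub>A\<close>\<close>

context inventory_model
begin

text \<open>\<open>Lam2\<close> integrates from 0, the resolvent from minus infinity. The missing
  piece contributes \<kappa> times the decreasing exponential.\<close>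

definition \<kappa> :: real where "\<kappa> = (LBINT y=-\<infinity>..ereal 0. exp (l2 * y) * g y)"

text \<open>Splits the Green function at its kink. Both halves are nonnegative, so their
  integrability is read off from the finiteness of the resolvent.\<close>

lemma hold_exp_integrable:
  "set_integrable lborel {z<..} (\<lambda>y. exp (l1 * (z - y)) * g y)"
  "set_integrable lborel {..z} (\<lambda>y. exp (l2 * y) * g y)"
  "resolvent p g z = ennreal (C * (\<integral>y\<in>{z<..}. exp (l1 * (z - y)) * g y \<partial>lborel) +
     C * exp (- l2 * z) * (\<integral>y\<in>{..z}. exp (l2 * y) * g y \<partial>lborel))"
proof -
  let ?u = "\<lambda>y. indicator {z<..} y * (exp (l1 * (z - y)) * g y)"
  let ?v = "\<lambda>y. indicator {..z} y * (exp (l2 * y) * g y)"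
  have u0: "?u y \<ge> 0" and v0: "?v y \<ge> 0" for y by (auto simp: hold_nonneg)
  have "resolvent p g z = (\<integral>\<^sup>+y. ennreal C * ennreal (?u y) + ennreal (C * exp (- l2 * z)) * ennreal (?v y) \<partial>lborel)"
    unfolding resolvent_eq_green[OF hold_measurable]
  proof (rule nn_integral_cong)
    fix y
    show "ennreal (green (y - z)) * ennreal (g y) = ennreal C * ennreal (?u y) + ennreal (C * exp (- l2 * z)) * ennreal (?v y)"
    proof (cases "y > z")
      case True
      then have "green (y - z) = C * exp (l1 * (z - y))" by (simp add: green_def algebra_simps)
      then show ?thesis using C_pos True hold_nonneg by (simp add: ennreal_mult[symmetric] mult_ac)
    next
      case False
      then have "green (y - z) = C * exp (- l2 * z) * exp (l2 * y)"
        by (cases "y = z") (auto simp: green_def mult.assoc exp_add[symmetric] algebra_simps)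
      then show ?thesis using C_pos False hold_nonneg by (simp add: ennreal_mult[symmetric] mult_ac)
    qed
  qed
  also have "\<dots> = ennreal C * (\<integral>\<^sup>+y. ennreal (?u y) \<partial>lborel) + ennreal (C * exp (- l2 * z)) * (\<integral>\<^sup>+y. ennreal (?v y) \<partial>lborel)"
    by (subst nn_integral_add) (simp_all add: nn_integral_cmult)
  finally have eq: "resolvent p g z = ennreal C * (\<integral>\<^sup>+y. ennreal (?u y) \<partial>lborel) + ennreal (C * exp (- l2 * z)) * (\<integral>\<^sup>+y. ennreal (?v y) \<partial>lborel)" .
  then have "ennreal C * (\<integral>\<^sup>+y. ennreal (?u y) \<partial>lborel) < \<infinity>" "ennreal (C * exp (- l2 * z)) * (\<integral>\<^sup>+y. ennreal (?v y) \<partial>lborel) < \<infinity>"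
    using resolvent_hold_finite[of z] by auto
  then have fin: "(\<integral>\<^sup>+y. ennreal (?u y) \<partial>lborel) < \<infinity>" "(\<integral>\<^sup>+y. ennreal (?v y) \<partial>lborel) < \<infinity>"
    using C_pos by (auto simp: ennreal_mult_less_top)
  have iu: "integrable lborel ?u" and iv: "integrable lborel ?v"
    using fin u0 v0 by (auto intro!: integrableI_nonneg)
  then show "set_integrable lborel {z<..} (\<lambda>y. exp (l1 * (z - y)) * g y)"
    "set_integrable lborel {..z} (\<lambda>y. exp (l2 * y) * g y)"
    by (simp_all add: set_integrable_def)
  have "(\<integral>\<^sup>+y. ennreal (?u y) \<partial>lborel) = ennreal (\<integral>y. ?u y \<partial>lborel)"
    "(\<integral>\<^sup>+y. ennreal (?v y) \<partial>lborel) = ennreal (\<integral>y. ?v y \<partial>lborel)"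
    by (rule nn_integral_eq_integral; use iu iv u0 v0 in auto)+
  moreover have "(\<integral>y. ?u y \<partial>lborel) \<ge> 0" "(\<integral>y. ?v y \<partial>lborel) \<ge> 0"
    using u0 v0 by (auto intro!: integral_nonneg_AE)
  ultimately show "resolvent p g z = ennreal (C * (\<integral>y\<in>{z<..}. exp (l1 * (z - y)) * g y \<partial>lborel) +
     C * exp (- l2 * z) * (\<integral>y\<in>{..z}. exp (l2 * y) * g y \<partial>lborel))"
    using eq C_pos by (simp add: set_lebesgue_integral_def ennreal_mult[symmetric] ennreal_plus[symmetric] del: ennreal_plus)
qed

lemma Lam1_eq: "Lam1 p z = (\<integral>y\<in>{z<..}. exp (l1 * (z - y)) * g y \<partial>lborel)"
  unfolding Lam1_def by (subst interval_integral_Ioi) auto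

lemma Lam2_eq: "Lam2 p z = exp (- l2 * z) * (LBINT y=ereal 0..ereal z. exp (l2 * y) * g y)"
proof -
  have "Lam2 p z = (LBINT y=ereal 0..ereal z. exp (- l2 * z) * (exp (l2 * y) * g y))"
    unfolding Lam2_def by (intro interval_integral_cong) (simp add: algebra_simps exp_diff exp_minus divide_simps)
  then show ?thesis by simp
qed

lemma Lam2_plus: "(\<integral>y\<in>{..z}. exp (l2 * y) * g y \<partial>lborel) = \<kappa> + exp (l2 * z) * Lam2 p z"
proof -
  let ?f = "\<lambda>y. exp (l2 * y) * g y"
  \<comment> \<open>The end point max 0 z covers both 0 and z, so that the oriented integrals add up
    for either sign of z.\<close>
  have "set_integrable lborel (einterval (-\<infinity>) (ereal (max 0 z))) ?f"
    by (rule set_integrable_subset[OF hold_exp_integrable(2)[of "max 0 z"]]; cases "0 \<le> z") (auto simp: einterval_def max_def)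
  then have int: "interval_lebesgue_integrable lborel (min (-\<infinity>) (min (ereal 0) (ereal z))) (max (-\<infinity>) (max (ereal 0) (ereal z))) ?f"
    by (cases "0 \<le> z") (auto simp: interval_lebesgue_integrable_def max_def min_def zero_ereal_def)
  have "(LBINT y=-\<infinity>..ereal z. ?f y) = \<kappa> + (LBINT y=ereal 0..ereal z. ?f y)"
    using interval_integral_sum[OF int] by (simp add: \<kappa>_def)
  also have "(LBINT y=-\<infinity>..ereal z. ?f y) = (\<integral>y\<in>{..z}. ?f y \<partial>lborel)"
    unfolding interval_lebesgue_integral_def
    by (auto intro!: set_integral_discrete_difference[where X = "{z}"] simp: einterval_def)
  finally show ?thesis by (simp add: Lam2_eq exp_minus)
qed

lemma resolvent_hold: "resolvent p g z = ennreal (C * (Lam1 p z + Lam2 p z + \<kappa> * exp (- l2 * z)))"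
  unfolding hold_exp_integrable(3) Lam2_plus Lam1_eq by (simp add: algebra_simps exp_minus)

lemma resolvent_hold_nonneg: "C * (Lam1 p z + Lam2 p z + \<kappa> * exp (- l2 * z)) \<ge> 0"
proof -
  have "0 \<le> (\<integral>y\<in>{z<..}. exp (l1 * (z - y)) * g y \<partial>lborel)"
    "0 \<le> exp (- l2 * z) * (\<integral>y\<in>{..z}. exp (l2 * y) * g y \<partial>lborel)"
    unfolding set_lebesgue_integral_def by (auto intro!: mult_nonneg_nonneg integral_nonneg_AE simp: hold_nonneg)
  then have "0 \<le> Lam1 p z + exp (- l2 * z) * (\<kappa> + exp (l2 * z) * Lam2 p z)"
    unfolding Lam2_plus Lam1_eq by (rule add_nonneg_nonneg)
  also have "\<dots> = Lam1 p z + Lam2 p z + \<kappa> * exp (- l2 * z)"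
    by (simp add: algebra_simps exp_minus)
  finally show ?thesis using C_pos by simp
qed

lemma v_fun_eq: "v_fun p A z = C * (Lam1 p z + Lam2 p z + \<kappa> * exp (- l2 * z)) - C * (\<kappa> + A / l2\<^sup>2) * exp (- l2 * z)"
  unfolding v_fun_def C_def[symmetric] by (simp add: algebra_simps)

section \<open>Derivatives of the functions \<open>Lam1\<close>, \<open>Lam2\<close> and
  \<open>v_fun\<close>, and monotonicity\<close>

lemma DERIV_interval_integral:
  fixes f :: "real \<Rightarrow> real"
  assumes "continuous_on UNIV f"
  shows "((\<lambda>u. LBINT y=ereal 0..ereal u. f y) has_real_derivative f x) (at x)"
proof -
  let ?a = "min 0 x - 1" and ?b = "max 0 x + 1"
  have "((\<lambda>u. LBINT y=ereal 0..ereal u. f y) has_vector_derivative f x) (at x within {?a..?b})"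
    by (rule interval_integral_FTC2) (auto intro!: continuous_on_subset[OF assms])
  then show ?thesis
    by (simp add: has_real_derivative_iff_has_vector_derivative at_within_Icc_at)
qed

lemma Lam2_deriv: "(Lam2 p has_real_derivative g x - l2 * Lam2 p x) (at x)"
proof -
  have "((\<lambda>z. exp (- l2 * z) * (LBINT y=ereal 0..ereal z. exp (l2 * y) * g y)) has_real_derivative g x - l2 * Lam2 p x) (at x)"
    by (rule derivative_eq_intros DERIV_interval_integral continuous_intros hold_continuous refl)+
      (simp add: Lam2_eq exp_minus algebra_simps)
  then show ?thesis by (simp add: Lam2_eq[abs_def])
qed

text \<open>Moves the variable end point of the improper integral into an integral over a bounded
  interval, where the fundamental theorem of calculus applies.\<close>

lemma Lam1_eq2: "Lam1 p z = exp (l1 * z) * (Lam1 p 0 - (LBINT y=ereal 0..ereal z. exp (- l1 * y) * g y))"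
proof -
  let ?f = "\<lambda>y. exp (- l1 * y) * g y"
  have L: "Lam1 p x = exp (l1 * x) * (LBINT y=ereal x..\<infinity>. ?f y)" for x
  proof -
    have "Lam1 p x = (LBINT y=ereal x..\<infinity>. exp (l1 * x) * (exp (- l1 * y) * g y))"
      unfolding Lam1_def by (intro interval_integral_cong) (simp add: algebra_simps exp_diff exp_minus divide_simps)
    then show ?thesis by simp
  qed
  have "set_integrable lborel {min 0 z<..} (\<lambda>y. exp (- l1 * min 0 z) * (exp (l1 * (min 0 z - y)) * g y))"
    using hold_exp_integrable(1)[of "min 0 z"] by (rule set_integrable_mult_right)
  also have "(\<lambda>y. exp (- l1 * min 0 z) * (exp (l1 * (min 0 z - y)) * g y)) = ?f"
    unfolding mult.assoc[symmetric] exp_add[symmetric] by (simp add: algebra_simps)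
  finally have "set_integrable lborel (einterval (ereal (min 0 z)) \<infinity>) ?f"
    by (cases "0 \<le> z") (auto simp: einterval_def greaterThan_def min_def)
  then have int: "interval_lebesgue_integrable lborel (min (ereal 0) (min (ereal z) \<infinity>)) (max (ereal 0) (max (ereal z) \<infinity>)) ?f"
    by (cases "0 \<le> z") (auto simp: interval_lebesgue_integrable_def max_def min_def zero_ereal_def)
  have "(LBINT y=ereal 0..ereal z. ?f y) + (LBINT y=ereal z..\<infinity>. ?f y) = (LBINT y=ereal 0..\<infinity>. ?f y)"
    by (rule interval_integral_sum[OF int])
  then show ?thesis using L[of z] L[of 0] by simp
qed

lemma Lam1_deriv: "(Lam1 p has_real_derivative l1 * Lam1 p x - g x) (at x)"
proof -
  have "((\<lambda>z. exp (l1 * z) * (Lam1 p 0 - (LBINT y=ereal 0..ereal z. exp (- l1 * y) * g y))) has_real_derivative l1 * Lam1 p x - g x) (at x)"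
    by (rule derivative_eq_intros DERIV_interval_integral continuous_intros hold_continuous refl)+
      (simp add: Lam1_eq2[of x] exp_minus algebra_simps)
  then show ?thesis by (subst Lam1_eq2[abs_def])
qed

definition v_deriv :: "real \<Rightarrow> real \<Rightarrow> real" where
  "v_deriv A x = C * (l1 * Lam1 p x - l2 * Lam2 p x + A / l2 * exp (- l2 * x))"

lemma v_fun_deriv: "(v_fun p A has_real_derivative v_deriv A x) (at x)"
proof -
  have "((\<lambda>x. C * (Lam1 p x + Lam2 p x - A / l2\<^sup>2 * exp (- l2 * x))) has_real_derivative v_deriv A x) (at x)"
    using lam_pos
    by (auto intro!: derivative_eq_intros Lam1_deriv Lam2_deriv simp: v_deriv_def algebra_simps power2_eq_square)
  then show ?thesis by (simp add: v_fun_def[abs_def] C_def)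
qed

lemma deriv_v_fun: "deriv (v_fun p A) x = v_deriv A x"
  by (rule DERIV_imp_deriv[OF v_fun_deriv])

lemma v_deriv_continuous: "continuous_on S (v_deriv A)"
proof -
  have "continuous_on S (Lam1 p)" "continuous_on S (Lam2 p)"
    by (auto intro!: DERIV_isCont Lam1_deriv Lam2_deriv continuous_at_imp_continuous_on)
  then show ?thesis unfolding v_deriv_def by (intro continuous_intros)
qed

text \<open>g is nondecreasing on [0, \<infinity>), so \<open>Lam1\<close> integrates values at
  least g x against an exponential of mass 1/l1. The bound for \<open>Lam2\<close> is the mirror
  image, with values at most g x and mass at most 1/l2.\<close>

lemma Lam1_ge: "x \<ge> 0 \<Longrightarrow> g x \<le> l1 * Lam1 p x"
proof -
  assume x: "x \<ge> 0"
  let ?u = "\<lambda>y. indicator {x<..} y * (exp (l1 * (x - y)) * g y)"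
  have u: "integrable lborel ?u" using hold_exp_integrable(1)[of x] by (simp add: set_integrable_def)
  have "ennreal (g x / l1) = ennreal (g x * exp (l1 * x)) * ennreal (exp (- l1 * x) / l1)"
    using lam_pos by (simp add: ennreal_mult'[symmetric] hold_nonneg exp_minus field_simps)
  also have "\<dots> = (\<integral>\<^sup>+y. ennreal (g x * exp (l1 * x)) * (ennreal (exp (- l1 * y)) * indicator {x..} y) \<partial>lborel)"
    using nn_integral_exp_atLeast[of l1 x] lam_pos by (simp add: nn_integral_cmult)
  also have "\<dots> \<le> (\<integral>\<^sup>+y. ennreal (?u y) \<partial>lborel)"
  proof (rule nn_integral_mono_AE)
    have "AE y in lborel. y \<noteq> x" by (rule AE_lborel_singleton)
    then show "AE y in lborel. ennreal (g x * exp (l1 * x)) * (ennreal (exp (- l1 * y)) * indicator {x..} y) \<le> ennreal (?u y)"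
    proof eventually_elim
      case (elim y)
      show ?case
      proof (cases "y > x")
        case True
        have "g x * exp (l1 * x) * exp (- l1 * y) = exp (l1 * (x - y)) * g x"
          by (simp add: mult.assoc exp_add[symmetric] algebra_simps)
        also have "\<dots> \<le> exp (l1 * (x - y)) * g y"
          using hold_mono[OF x, of y] True by (intro mult_left_mono) auto
        finally show ?thesis using True by (simp add: ennreal_mult'[symmetric] hold_nonneg ennreal_leI)
      qed (use elim in auto)
    qed
  qed
  also have "\<dots> = ennreal (Lam1 p x)"
    unfolding Lam1_eq set_lebesgue_integral_def using u
    by (subst nn_integral_eq_integral) (auto simp: hold_nonneg)
  finally have "g x / l1 \<le> Lam1 p x"
    by (subst (asm) ennreal_le_iff)
      (auto simp: Lam1_eq set_lebesgue_integral_def hold_nonneg intro!: integral_nonneg_AE)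
  then show ?thesis using lam_pos by (simp add: field_simps)
qed

lemma Lam2_le: "x \<ge> 0 \<Longrightarrow> l2 * Lam2 p x \<le> g x"
proof -
  assume x: "x \<ge> 0"
  have "(LBINT y=ereal 0..ereal x. exp (l2 * y) * g y) \<le> (LBINT y=ereal 0..ereal x. exp (l2 * y) * g x)"
    using x unfolding interval_integral_Icc[OF x]
    by (intro set_integral_mono borel_integrable_atLeastAtMost' continuous_intros hold_continuous mult_left_mono hold_mono) auto
  also have "\<dots> = exp (l2 * x) * g x / l2 - exp (l2 * 0) * g x / l2"
  proof (rule interval_integral_FTC_finite[where F = "\<lambda>u. exp (l2 * u) * g x / l2"])
    fix u
    have "((\<lambda>u. exp (l2 * u) * g x / l2) has_real_derivative exp (l2 * u) * g x) (at u within {min 0 x..max 0 x})"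
      using lam_pos by (auto intro!: derivative_eq_intros)
    then show "((\<lambda>u. exp (l2 * u) * g x / l2) has_vector_derivative exp (l2 * u) * g x) (at u within {min 0 x..max 0 x})"
      by (simp add: has_real_derivative_iff_has_vector_derivative)
  qed (intro continuous_intros)
  also have "\<dots> \<le> exp (l2 * x) * g x / l2"
    using lam_pos hold_nonneg[of x] by simp
  finally have "exp (- l2 * x) * (LBINT y=ereal 0..ereal x. exp (l2 * y) * g y) \<le> exp (- l2 * x) * (exp (l2 * x) * g x / l2)"
    by (intro mult_left_mono) auto
  then show ?thesis using lam_pos by (simp add: Lam2_eq exp_minus field_simps)
qed

text \<open>In the derivative the two terms with g cancel. For u \<ge> 0 the value g u separates
  what remains; for u < 0 the orientation of the integral makes \<open>Lam2\<close>
  nonpositive.\<close>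

lemma Lam_mono:
  assumes "x \<le> y"
  shows "Lam1 p x + Lam2 p x \<le> Lam1 p y + Lam2 p y"
proof (rule DERIV_nonneg_imp_nondecreasing[OF assms, of "\<lambda>x. Lam1 p x + Lam2 p x"])
  fix u :: real
  have "l1 * Lam1 p u - l2 * Lam2 p u \<ge> 0"
  proof (cases "u \<ge> 0")
    case True
    then show ?thesis using Lam1_ge[OF True] Lam2_le[OF True] by simp
  next
    case False
    have "Lam1 p u \<ge> 0"
      by (auto simp: Lam1_eq set_lebesgue_integral_def hold_nonneg intro!: integral_nonneg_AE)
    moreover have "Lam2 p u \<le> 0"
    proof -
      have "(LBINT y=ereal u..ereal 0. exp (l2 * y) * g y) \<ge> 0"
        using False by (subst interval_integral_Icc)
          (auto simp: set_lebesgue_integral_def hold_nonneg intro!: integral_nonneg_AE)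
      then have "(LBINT y=ereal 0..ereal u. exp (l2 * y) * g y) \<le> 0"
        using interval_integral_endpoints_reverse[of "ereal 0" "ereal u" "\<lambda>y. exp (l2 * y) * g y"] by linarith
      then show ?thesis unfolding Lam2_eq by (intro mult_nonneg_nonpos) auto
    qed
    ultimately show ?thesis using lam_pos by (smt (verit) mult_nonneg_nonneg mult_nonneg_nonpos)
  qed
  then show "\<exists>d. ((\<lambda>x. Lam1 p x + Lam2 p x) has_real_derivative d) (at u) \<and> 0 \<le> d"
    using DERIV_add[OF Lam1_deriv[of u] Lam2_deriv[of u]] by (intro exI conjI) auto
qed

end

section \<open>The cost of an order-up-to policy\<close>

lemma (in inventory_model) resolvent_measurable[measurable]:
  assumes [measurable]: "f \<in> borel_measurable borel"
  shows "resolvent p f \<in> borel_measurable borel"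
  unfolding resolvent_eq_green[OF assms, abs_def] by measurable

text \<open>T is constrained at the levels x and s alone: after the first order, continuity lets the
  level reach s but not pass it before the next order. Hence both policies of the theorem are
  instances that differ in y. \<open>S - s \<le> Q\<close> makes every later order of positive size
  pay K1.\<close>

locale order_up_to = brownian_motion M F B + inventory_model p
  for M :: "'a measure" and F B p +
  fixes x s y S :: real and T :: "real \<Rightarrow> real" and \<tau> :: "nat \<Rightarrow> 'a \<Rightarrow> ennreal" and \<xi> :: "nat \<Rightarrow> 'a \<Rightarrow> real"
  assumes impl: "implements_order_up_to p M F B x s T \<tau> \<xi>"
    and x_le: "x \<le> s" and Tx: "T x = y" and y_gt: "s < y"
    and Ts: "T s = S" and S_gt: "s < S" and S_le: "S - s \<le> Q"
begin

lemma policy: "policy M F \<tau> \<xi>"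
  using impl by (simp add: implements_order_up_to_def)

lemma \<tau>_stopping: "stopping_time F (\<tau> n)"
  using policy by (simp add: policy_def)

lemma \<tau>_measurable[measurable]: "\<tau> n \<in> borel_measurable M"
  by (rule stopping_time_measurable[OF \<tau>_stopping])

lemma \<tau>_0: "\<omega> \<in> space M \<Longrightarrow> \<tau> 0 \<omega> = 0"
  using policy by (simp add: policy_def)

lemma \<tau>_mono: "\<omega> \<in> space M \<Longrightarrow> m \<le> n \<Longrightarrow> \<tau> m \<omega> \<le> \<tau> n \<omega>"
  using policy lift_Suc_mono_le[of "\<lambda>n. \<tau> n \<omega>" m n] by (simp add: policy_def)

lemma \<tau>_finite: "\<omega> \<in> space M \<Longrightarrow> finite {n. \<tau> n \<omega> \<le> ennreal t}"
  using policy by (simp add: policy_def)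

lemma \<xi>_known: "known_at (\<tau> n) (\<xi> n)"
  using policy by (intro known_at_pre_sigma \<tau>_stopping) (simp add: policy_def)

lemma \<xi>_measurable[measurable]: "\<xi> n \<in> borel_measurable M"
proof -
  have "sets (filtration.pre_sigma (space M) F (\<tau> n)) \<subseteq> sets M"
  proof
    fix A assume "A \<in> sets (filtration.pre_sigma (space M) F (\<tau> n))"
    \<comment> \<open>At time top the condition on \<open>\<tau> n\<close> is void and leaves A
      itself; \<open>known_at\<close> would say nothing where the time is infinite.\<close>
    then have "{\<omega> \<in> A. \<tau> n \<omega> \<le> top} \<in> sets (F top)"
      by (rule filtration.sets_pre_sigmaD[OF filtration \<tau>_stopping])
    then show "A \<in> sets M" using sets_F by auto
  qed
  moreover have "\<xi> n \<in> borel_measurable (filtration.pre_sigma (space M) F (\<tau> n))"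
    using policy by (simp add: policy_def)
  ultimately show ?thesis
    by (auto simp: measurable_def filtration.space_pre_sigma[OF filtration])
qed

definition ordered :: "nat \<Rightarrow> 'a \<Rightarrow> real" where
  "ordered n \<omega> = (\<Sum>m<n. \<xi> m \<omega>)"

text \<open>n counts orders independently of u, so outside its cycle the path simply continues
  uncontrolled, which is what the strong Markov property sees. The level before order n has n orders
  in it, the level after it \<open>Suc n\<close>.\<close>

definition level :: "nat \<Rightarrow> real \<Rightarrow> 'a \<Rightarrow> real" where
  "level n u \<omega> = x - \<mu> * max 0 u + \<sigma> * B (max 0 u) \<omega> + ordered n \<omega>"

definition pre :: "nat \<Rightarrow> 'a \<Rightarrow> real" where
  "pre n \<omega> = level n (enn2real (\<tau> n \<omega>)) \<omega>"

definition post :: "nat \<Rightarrow> 'a \<Rightarrow> real" where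
  "post n \<omega> = level (Suc n) (enn2real (\<tau> n \<omega>)) \<omega>"

lemma post_eq: "post n \<omega> = pre n \<omega> + \<xi> n \<omega>"
  by (simp add: post_def pre_def level_def ordered_def)

lemma ordered_measurable[measurable]: "ordered n \<in> borel_measurable M"
  unfolding ordered_def[abs_def] by measurable

lemma level_measurable[measurable]:
  assumes [measurable]: "f \<in> borel_measurable N" "h \<in> measurable N M"
  shows "(\<lambda>q. level n (f q) (h q)) \<in> borel_measurable N"
proof -
  have [measurable]: "(\<lambda>q. B (max 0 (f q)) (h q)) \<in> borel_measurable N"
    by (rule B_at_measurable) auto
  show ?thesis unfolding level_def by measurable
qed

lemma pre_measurable[measurable]: "pre n \<in> borel_measurable M"
  and post_measurable[measurable]: "post n \<in> borel_measurable M"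
  unfolding pre_def[abs_def] post_def[abs_def] by measurable

lemma known_at_level:
  assumes "m \<le> Suc n"
  shows "known_at (\<tau> n) (\<lambda>\<omega>. level m (enn2real (\<tau> n \<omega>)) \<omega>)"
proof -
  note \<tau> = \<tau>_stopping[of n]
  have "known_at (\<tau> n) (\<lambda>\<omega>. x - \<mu> * enn2real (\<tau> n \<omega>) + \<sigma> * B (enn2real (\<tau> n \<omega>)) \<omega>)"
    by (rule known_at_compose2[OF \<tau> known_at_time[OF \<tau>] known_at_B[OF \<tau>], where h = "\<lambda>a b. x - \<mu> * a + \<sigma> * b"])
      measurable
  moreover have "known_at (\<tau> n) (ordered m)"
    unfolding ordered_def[abs_def] using assms
    by (intro known_at_sum[OF \<tau>] known_at_mono[OF \<tau> \<xi>_known] \<tau>_mono) auto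
  ultimately show ?thesis
    using known_at_add[OF \<tau>, of _ "ordered m"] by (simp add: level_def)
qed

lemma order_count_eq:
  assumes "\<omega> \<in> space M" "\<tau> n \<omega> \<le> ennreal u" "ennreal u < \<tau> (Suc n) \<omega>"
  shows "order_count \<tau> u \<omega> = n"
proof -
  have "{m. \<tau> m \<omega> \<le> ennreal u} = {..n}"
  proof (intro set_eqI iffI)
    fix m assume "m \<in> {m. \<tau> m \<omega> \<le> ennreal u}"
    then have "\<not> Suc n \<le> m" using \<tau>_mono[OF assms(1), of "Suc n" m] assms(3) by auto
    then show "m \<in> {..n}" by simp
  next
    fix m assume "m \<in> {..n}"
    then show "m \<in> {m. \<tau> m \<omega> \<le> ennreal u}" using \<tau>_mono[OF assms(1), of m n] assms(2) by auto
  qed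
  then show ?thesis unfolding order_count_def by (simp add: Max_eq_iff)
qed

lemma order_count_bounds:
  assumes \<omega>: "\<omega> \<in> space M"
  shows "\<tau> (order_count \<tau> u \<omega>) \<omega> \<le> ennreal u" "ennreal u < \<tau> (Suc (order_count \<tau> u \<omega>)) \<omega>"
proof -
  let ?A = "{n. \<tau> n \<omega> \<le> ennreal u}"
  have fin: "finite ?A" and ne: "0 \<in> ?A" using \<tau>_finite[OF \<omega>] \<tau>_0[OF \<omega>] by auto
  have "Max ?A \<in> ?A" using fin ne by (intro Max_in) auto
  then show "\<tau> (order_count \<tau> u \<omega>) \<omega> \<le> ennreal u" by (simp add: order_count_def)
  have "Suc (Max ?A) \<notin> ?A" using Max_ge[OF fin, of "Suc (Max ?A)"] by auto
  then show "ennreal u < \<tau> (Suc (order_count \<tau> u \<omega>)) \<omega>" by (simp add: order_count_def not_le)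
qed

lemma inventory_eq_level:
  assumes "u \<ge> 0"
  shows "inventory p B x \<tau> \<xi> u \<omega> = level (Suc (order_count \<tau> u \<omega>)) u \<omega>"
  using assms unfolding inventory_def level_def ordered_def
  by (simp only: lessThan_Suc_atMost atLeast0AtMost max_absorb2)

lemma level_gt:
  assumes "\<omega> \<in> space M" "0 \<le> u" "\<tau> n \<omega> \<le> ennreal u" "ennreal u < \<tau> (Suc n) \<omega>"
  shows "level (Suc n) u \<omega> > s"
proof -
  have "\<forall>u\<ge>0. inventory p B x \<tau> \<xi> u \<omega> > s"
    using impl assms(1) unfolding implements_order_up_to_def by blast
  then show ?thesis
    using assms(2) inventory_eq_level[of u \<omega>] order_count_eq[OF assms(1,3,4)] by auto
qed

lemma order_size:
  assumes \<omega>: "\<omega> \<in> space M" and "\<tau> n \<omega> < \<infinity>"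
  shows "\<xi> n \<omega> = (if pre n \<omega> \<le> s then T (pre n \<omega>) - pre n \<omega> else 0)"
proof -
  have "pre n \<omega> = x - \<mu> * enn2real (\<tau> n \<omega>) + \<sigma> * B (enn2real (\<tau> n \<omega>)) \<omega> + (\<Sum>m<n. \<xi> m \<omega>)"
    by (simp add: pre_def level_def ordered_def)
  then show ?thesis using impl assms by (simp add: implements_order_up_to_def Let_def)
qed

lemma level_continuous: "\<omega> \<in> space M \<Longrightarrow> continuous_on A (\<lambda>u. level n u \<omega>)"
  unfolding level_def
  by (intro continuous_intros continuous_on_compose2[OF B_continuous]) auto

text \<open>During a cycle the level is above s, so by continuity it is at least s when the next
  order comes; the ordering rule then acts only at equality. Off the event
  \<open>B 0 \<omega> = 0\<close> the starting level may differ from x.\<close>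

lemma levels:
  assumes \<omega>: "\<omega> \<in> space M" and B0: "B 0 \<omega> = 0" and fin: "\<tau> n \<omega> < \<infinity>"
  shows "post n \<omega> > s \<and> (if n = 0 then pre n \<omega> = x \<and> post n \<omega> = y
    else pre n \<omega> \<ge> s \<and> post n \<omega> = (if pre n \<omega> = s then S else pre n \<omega>))"
  using fin
proof (induction n)
  case 0
  have "pre 0 \<omega> = x" using \<tau>_0[OF \<omega>] B0 by (simp add: pre_def level_def ordered_def)
  then show ?case
    using order_size[OF \<omega>, of 0] \<tau>_0[OF \<omega>] x_le Tx y_gt by (simp add: post_eq)
next
  case (Suc n)
  have le: "\<tau> n \<omega> \<le> \<tau> (Suc n) \<omega>" by (rule \<tau>_mono[OF \<omega>]) simp
  then have finn: "\<tau> n \<omega> < \<infinity>" using Suc.prems by auto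
  then have IH: "post n \<omega> > s" using Suc.IH by blast
  have "pre (Suc n) \<omega> \<ge> s"
  \<comment> \<open>With simultaneous orders the cycle is empty and offers no path to take a limit
    along.\<close>
  proof (cases "\<tau> n \<omega> = \<tau> (Suc n) \<omega>")
    case True
    then have "pre (Suc n) \<omega> = post n \<omega>" by (simp add: pre_def post_def)
    then show ?thesis using IH by simp
  next
    case False
    define a b where "a = enn2real (\<tau> n \<omega>)" and "b = enn2real (\<tau> (Suc n) \<omega>)"
    have ab: "\<tau> n \<omega> = ennreal a" "\<tau> (Suc n) \<omega> = ennreal b" "0 \<le> a"
      using finn Suc.prems by (auto simp: a_def b_def)
    have "ennreal a < ennreal b" using False le ab by auto
    then have "a < b" using ab(3) by (simp add: ennreal_less_iff)
    have cl: "closure {a..<b} = {a..b}" using \<open>a < b\<close> by simp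
    have "level (Suc n) b \<omega> \<ge> s"
    proof (rule continuous_ge_on_closure[of "{a..<b}" "\<lambda>u. level (Suc n) u \<omega>"])
      show "continuous_on (closure {a..<b}) (\<lambda>u. level (Suc n) u \<omega>)" by (rule level_continuous[OF \<omega>])
      show "b \<in> closure {a..<b}" unfolding cl using \<open>a < b\<close> by simp
      fix u assume "u \<in> {a..<b}"
      then have "level (Suc n) u \<omega> > s"
        using ab by (intro level_gt[OF \<omega>]) (auto simp: ennreal_less_iff intro: ennreal_leI)
      then show "level (Suc n) u \<omega> \<ge> s" by simp
    qed
    then show ?thesis by (simp add: pre_def b_def)
  qed
  then show ?case
    using order_size[OF \<omega> Suc.prems] Ts S_gt by (auto simp: post_eq)
qed

section \<open>Balance of holding costs and orders over one cycle\<close>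

definition cost_flow :: "(real \<Rightarrow> real) \<Rightarrow> nat \<Rightarrow> 'a \<Rightarrow> real \<Rightarrow> ennreal" where
  "cost_flow f n \<omega> u = ennreal (exp (- \<beta> * u)) * ennreal (f (level (Suc n) u \<omega>))"

lemma cost_flow_measurable:
  assumes [measurable]: "f \<in> borel_measurable borel"
  shows "(\<lambda>q. cost_flow f n (fst q) (snd q)) \<in> borel_measurable (M \<Otimes>\<^sub>M lborel)"
  unfolding cost_flow_def by measurable

definition cycle_cost :: "(real \<Rightarrow> real) \<Rightarrow> nat \<Rightarrow> ennreal" where
  "cycle_cost f n = (\<integral>\<^sup>+\<omega>. (\<integral>\<^sup>+u\<in>{u. 0 \<le> u \<and> \<tau> n \<omega> \<le> ennreal u \<and> ennreal u < \<tau> (Suc n) \<omega>}.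
     cost_flow f n \<omega> u \<partial>lborel) \<partial>M)"

text \<open>The discounted holding cost if no order is ever placed after order n; in
  \<open>value_pre\<close> order n is dropped too. Infinite ordering times contribute nothing,
  because \<open>discount\<close> is 0 there.\<close>

definition value_post :: "(real \<Rightarrow> real) \<Rightarrow> nat \<Rightarrow> ennreal" where
  "value_post f n = (\<integral>\<^sup>+\<omega>. ennreal (discount p (\<tau> n \<omega>)) * resolvent p f (post n \<omega>) \<partial>M)"

definition value_pre :: "(real \<Rightarrow> real) \<Rightarrow> nat \<Rightarrow> ennreal" where
  "value_pre f n = (\<integral>\<^sup>+\<omega>. ennreal (discount p (\<tau> n \<omega>)) * resolvent p f (pre n \<omega>) \<partial>M)"

text \<open>The expected discount factor of order n on the event that it has positive size. This
  reading is meant for n > 0, since order 0 starts from x.\<close>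

definition order_prob :: "nat \<Rightarrow> ennreal" where
  "order_prob n = (\<integral>\<^sup>+\<omega>. ennreal (discount p (\<tau> n \<omega>)) * indicator {s} (pre n \<omega>) \<partial>M)"

lemma strong_markov_level:
  assumes f: "continuous_on UNIV f" and n: "n' \<le> Suc m"
  shows "(\<integral>\<^sup>+\<omega>. ennreal (discount p (\<tau> m \<omega>)) * resolvent p f (level n' (enn2real (\<tau> m \<omega>)) \<omega>) \<partial>M) =
    (\<integral>\<^sup>+\<omega>. (\<integral>\<^sup>+u\<in>{u. 0 \<le> u \<and> \<tau> m \<omega> \<le> ennreal u}. ennreal (exp (- \<beta> * u)) * ennreal (f (level n' u \<omega>)) \<partial>lborel) \<partial>M)"
proof -
  have "\<beta> \<ge> 0" using param_pos by simp
  note strong_markov[OF \<tau>_stopping known_at_level[OF n] f this]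
  also have "(\<integral>\<^sup>+\<omega>. (\<integral>\<^sup>+u\<in>{u. 0 \<le> u \<and> \<tau> m \<omega> \<le> ennreal u}. ennreal (exp (- \<beta> * u)) *
       ennreal (f (level n' (enn2real (\<tau> m \<omega>)) \<omega> - \<mu> * (u - enn2real (\<tau> m \<omega>)) +
         \<sigma> * (B u \<omega> - B (enn2real (\<tau> m \<omega>)) \<omega>))) \<partial>lborel) \<partial>M) =
    (\<integral>\<^sup>+\<omega>. (\<integral>\<^sup>+u\<in>{u. 0 \<le> u \<and> \<tau> m \<omega> \<le> ennreal u}. ennreal (exp (- \<beta> * u)) * ennreal (f (level n' u \<omega>)) \<partial>lborel) \<partial>M)"
  proof (intro nn_integral_cong)
    fix \<omega> u
    have "level n' (enn2real (\<tau> m \<omega>)) \<omega> - \<mu> * (u - enn2real (\<tau> m \<omega>)) + \<sigma> * (B u \<omega> - B (enn2real (\<tau> m \<omega>)) \<omega>) = level n' u \<omega>"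
      if "u \<ge> 0" using that by (simp add: level_def algebra_simps)
    then show "ennreal (exp (- \<beta> * u)) *
       ennreal (f (level n' (enn2real (\<tau> m \<omega>)) \<omega> - \<mu> * (u - enn2real (\<tau> m \<omega>)) +
         \<sigma> * (B u \<omega> - B (enn2real (\<tau> m \<omega>)) \<omega>))) * indicator {u. 0 \<le> u \<and> \<tau> m \<omega> \<le> ennreal u} u =
      ennreal (exp (- \<beta> * u)) * ennreal (f (level n' u \<omega>)) * indicator {u. 0 \<le> u \<and> \<tau> m \<omega> \<le> ennreal u} u"
      by (auto simp: indicator_def)
  qed
  finally show ?thesis .
qed

text \<open>Both values integrate the same uncontrolled path \<open>level (Suc n)\<close>, one from
  \<open>\<tau> n\<close> on and one from \<open>\<tau> (Suc n)\<close> on; the difference is the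
  cycle.\<close>

lemma value_post_split:
  assumes f: "continuous_on UNIV f"
  shows "value_post f n = cycle_cost f n + value_pre f (Suc n)"
proof -
  have [measurable]: "f \<in> borel_measurable borel" using f by (simp add: borel_measurable_continuous_onI)
  have [measurable]: "(\<lambda>q. cost_flow f n (fst q) (snd q)) \<in> borel_measurable (M \<Otimes>\<^sub>M lborel)"
    by (rule cost_flow_measurable) measurable
  have post: "value_post f n = (\<integral>\<^sup>+\<omega>. (\<integral>\<^sup>+u\<in>{u. 0 \<le> u \<and> \<tau> n \<omega> \<le> ennreal u}. cost_flow f n \<omega> u \<partial>lborel) \<partial>M)"
    unfolding value_post_def post_def cost_flow_def by (rule strong_markov_level[OF f]) simp
  have pre: "value_pre f (Suc n) = (\<integral>\<^sup>+\<omega>. (\<integral>\<^sup>+u\<in>{u. 0 \<le> u \<and> \<tau> (Suc n) \<omega> \<le> ennreal u}. cost_flow f n \<omega> u \<partial>lborel) \<partial>M)"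
    unfolding value_pre_def pre_def cost_flow_def by (rule strong_markov_level[OF f]) simp
  have m1: "(\<lambda>\<omega>. \<integral>\<^sup>+u\<in>{u. 0 \<le> u \<and> \<tau> n \<omega> \<le> ennreal u \<and> ennreal u < \<tau> (Suc n) \<omega>}. cost_flow f n \<omega> u \<partial>lborel) \<in> borel_measurable M"
    and m2: "(\<lambda>\<omega>. \<integral>\<^sup>+u\<in>{u. 0 \<le> u \<and> \<tau> (Suc n) \<omega> \<le> ennreal u}. cost_flow f n \<omega> u \<partial>lborel) \<in> borel_measurable M"
    unfolding cost_flow_def by measurable
  show ?thesis
    unfolding post pre cycle_cost_def
  proof (subst nn_integral_add[symmetric, OF m1 m2], rule nn_integral_cong)
    fix \<omega> assume \<omega>: "\<omega> \<in> space M"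
    have [measurable]: "cost_flow f n \<omega> \<in> borel_measurable lborel"
      unfolding cost_flow_def[abs_def] using \<omega> by measurable
    have le: "\<tau> n \<omega> \<le> \<tau> (Suc n) \<omega>" by (rule \<tau>_mono[OF \<omega>]) simp
    show "(\<integral>\<^sup>+u\<in>{u. 0 \<le> u \<and> \<tau> n \<omega> \<le> ennreal u}. cost_flow f n \<omega> u \<partial>lborel) =
      (\<integral>\<^sup>+u\<in>{u. 0 \<le> u \<and> \<tau> n \<omega> \<le> ennreal u \<and> ennreal u < \<tau> (Suc n) \<omega>}. cost_flow f n \<omega> u \<partial>lborel) +
      (\<integral>\<^sup>+u\<in>{u. 0 \<le> u \<and> \<tau> (Suc n) \<omega> \<le> ennreal u}. cost_flow f n \<omega> u \<partial>lborel)"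
      using le order_trans[OF le]
      by (subst nn_integral_add[symmetric]) (auto intro!: nn_integral_cong simp: indicator_def not_less)
  qed
qed

lemma AE_levels:
  "AE \<omega> in M. \<forall>n. \<tau> n \<omega> < \<infinity> \<longrightarrow> post n \<omega> > s \<and> (if n = 0 then pre n \<omega> = x \<and> post n \<omega> = y
    else pre n \<omega> \<ge> s \<and> post n \<omega> = (if pre n \<omega> = s then S else pre n \<omega>))"
  using B_0 by (rule AE_mp) (rule AE_I2, auto dest: levels)

text \<open>An order changes the resolvent only where the level is s, and there by a fixed amount.
  Adding crosswise avoids a difference in \<open>ennreal\<close>.\<close>

lemma value_jump:
  assumes f: "continuous_on UNIV f"
  shows "value_post f (Suc n) + resolvent p f s * order_prob (Suc n) =
    value_pre f (Suc n) + resolvent p f S * order_prob (Suc n)"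
proof -
  have [measurable]: "f \<in> borel_measurable borel" using f by (simp add: borel_measurable_continuous_onI)
  have "value_post f (Suc n) + resolvent p f s * order_prob (Suc n) =
    (\<integral>\<^sup>+\<omega>. ennreal (discount p (\<tau> (Suc n) \<omega>)) * resolvent p f (post (Suc n) \<omega>) +
      resolvent p f s * (ennreal (discount p (\<tau> (Suc n) \<omega>)) * indicator {s} (pre (Suc n) \<omega>)) \<partial>M)"
    unfolding value_post_def order_prob_def
    by (simp add: nn_integral_cmult[symmetric] nn_integral_add[symmetric])
  also have "\<dots> = (\<integral>\<^sup>+\<omega>. ennreal (discount p (\<tau> (Suc n) \<omega>)) * resolvent p f (pre (Suc n) \<omega>) +
      resolvent p f S * (ennreal (discount p (\<tau> (Suc n) \<omega>)) * indicator {s} (pre (Suc n) \<omega>)) \<partial>M)"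
  proof (rule nn_integral_cong_AE)
    show "AE \<omega> in M. ennreal (discount p (\<tau> (Suc n) \<omega>)) * resolvent p f (post (Suc n) \<omega>) +
      resolvent p f s * (ennreal (discount p (\<tau> (Suc n) \<omega>)) * indicator {s} (pre (Suc n) \<omega>)) =
      ennreal (discount p (\<tau> (Suc n) \<omega>)) * resolvent p f (pre (Suc n) \<omega>) +
      resolvent p f S * (ennreal (discount p (\<tau> (Suc n) \<omega>)) * indicator {s} (pre (Suc n) \<omega>))"
      using AE_levels
    proof eventually_elim
      case (elim \<omega>)
      show ?case
      proof (cases "\<tau> (Suc n) \<omega> = \<infinity>")
        case True
        then show ?thesis by (simp add: discount_def)
      next
        case False
        then have "post (Suc n) \<omega> = (if pre (Suc n) \<omega> = s then S else pre (Suc n) \<omega>)"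
          using elim[rule_format, of "Suc n"] by (simp add: top.not_eq_extremum)
        then show ?thesis by (auto simp: mult.commute add.commute)
      qed
    qed
  qed
  also have "\<dots> = value_pre f (Suc n) + resolvent p f S * order_prob (Suc n)"
    unfolding value_pre_def order_prob_def
    by (simp add: nn_integral_cmult[symmetric] nn_integral_add[symmetric])
  finally show ?thesis .
qed

lemma value_balance:
  assumes f: "continuous_on UNIV f"
  shows "cycle_cost f n + value_post f (Suc n) + resolvent p f s * order_prob (Suc n) =
    value_post f n + resolvent p f S * order_prob (Suc n)"
  using value_jump[OF f, of n] by (simp add: value_post_split[OF f, of n] add.assoc)

lemma value_post_0: 
  assumes f: "continuous_on UNIV f"
  shows "value_post f 0 = resolvent p f y"
proof -
  have "value_post f 0 = (\<integral>\<^sup>+\<omega>. resolvent p f y \<partial>M)"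
    unfolding value_post_def
  proof (rule nn_integral_cong_AE)
    show "AE \<omega> in M. ennreal (discount p (\<tau> 0 \<omega>)) * resolvent p f (post 0 \<omega>) = resolvent p f y"
      using AE_levels AE_space
    proof eventually_elim
      case (elim \<omega>)
      have "\<tau> 0 \<omega> = 0" by (rule \<tau>_0) (use elim in simp)
      then show ?case using elim(1)[rule_format, of 0] by (simp add: discount_def)
    qed
  qed
  then show ?thesis by (simp add: emeasure_space_1)
qed

lemma order_prob_le: "order_prob n \<le> 1"
proof -
  have "order_prob n \<le> (\<integral>\<^sup>+\<omega>. 1 \<partial>M)"
    unfolding order_prob_def
    using discount_le_1[of p "\<tau> n _"] param_pos
    by (intro nn_integral_mono) (auto simp: indicator_def)
  then show ?thesis by (simp add: emeasure_space_1)
qed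

definition P :: "nat \<Rightarrow> real" where "P n = enn2real (order_prob n)"

lemma order_prob_eq: "order_prob n = ennreal (P n)" and P_nonneg: "P n \<ge> 0"
  using order_prob_le[of n] by (auto simp: P_def ennreal_enn2real_if top_unique)

text \<open>\<open>value_balance\<close> bounds each value by its predecessor plus a finite term, so
  finiteness propagates before anything is cancelled.\<close>

lemma value_post_finite:
  assumes f: "continuous_on UNIV f" and fin: "\<And>z. s \<le> z \<Longrightarrow> resolvent p f z < \<infinity>"
  shows "value_post f n < \<infinity>"
proof (induction n)
  case 0
  then show ?case using fin[of y] y_gt by (simp add: value_post_0[OF f])
next
  case (Suc n)
  have "value_post f (Suc n) \<le> cycle_cost f n + value_post f (Suc n) + resolvent p f s * order_prob (Suc n)"
    by (simp add: add.assoc add_increasing)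
  also have "\<dots> < \<infinity>"
    unfolding value_balance[OF f] using Suc fin[of S] S_gt
    by (simp add: order_prob_eq ennreal_mult_less_top)
  finally show ?case .
qed

text \<open>The balance, telescoped in the reals. The formula r is required on [s, \<infinity>)
  only, where \<open>resolvent_below\<close> is explicit.\<close>

lemma value_sum:
  assumes f: "continuous_on UNIV f" and r: "\<And>z. s \<le> z \<Longrightarrow> resolvent p f z = ennreal (r z)"
    and r0: "\<And>z. s \<le> z \<Longrightarrow> r z \<ge> 0"
  shows "(\<Sum>m<n. enn2real (cycle_cost f m)) + enn2real (value_post f n) =
      r y + (r S - r s) * (\<Sum>m<n. P (Suc m))"
    and "cycle_cost f n < \<infinity>"
proof -
  have fin: "value_post f n < \<infinity>" for n
    by (rule value_post_finite[OF f]) (simp add: r)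
  have fin': "cycle_cost f n < \<infinity>" for n
    using fin[of n] unfolding value_post_split[OF f] by auto
  then show "cycle_cost f n < \<infinity>" .
  have step: "enn2real (cycle_cost f n) + enn2real (value_post f (Suc n)) + r s * P (Suc n) =
    enn2real (value_post f n) + r S * P (Suc n)" for n
  proof -
    have "ennreal (enn2real (cycle_cost f n) + enn2real (value_post f (Suc n)) + r s * P (Suc n)) =
      ennreal (enn2real (value_post f n) + r S * P (Suc n))"
      using value_balance[OF f, of n] fin[of n] fin[of "Suc n"] fin'[of n] r0[of s] r0[of S] S_gt P_nonneg[of "Suc n"] r[of s] r[of S]
      by (simp add: order_prob_eq ennreal_mult)
    then show ?thesis
      by (subst (asm) ennreal_inj) (use r0[of s] r0[of S] S_gt P_nonneg in auto)
  qed
  show "(\<Sum>m<n. enn2real (cycle_cost f m)) + enn2real (value_post f n) =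
      r y + (r S - r s) * (\<Sum>m<n. P (Suc m))"
  proof (induction n)
    case 0
    then show ?case using r[of y] r0[of y] y_gt by (simp add: value_post_0[OF f])
  next
    case (Suc n)
    then show ?case using step[of n] by (simp add: algebra_simps)
  qed
qed

lemma cycle_cost_zero:
  assumes f: "\<And>z. s < z \<Longrightarrow> f z = 0"
  shows "cycle_cost f n = 0"
proof -
  have "cycle_cost f n = (\<integral>\<^sup>+\<omega>. (\<integral>\<^sup>+u. 0 \<partial>(lborel :: real measure)) \<partial>M)"
    unfolding cycle_cost_def
    by (intro nn_integral_cong) (auto simp: indicator_def cost_flow_def dest!: level_gt f)
  then show ?thesis by simp
qed

section \<open>Vanishing of the remainders and the discounted number of orders\<close>

definition D :: "nat \<Rightarrow> real" where "D n = (\<integral>\<omega>. discount p (\<tau> n \<omega>) \<partial>M)"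

lemma integrable_discount: "integrable M (\<lambda>\<omega>. discount p (\<tau> n \<omega>))"
  using param_pos by (intro integrable_const_bound[of _ 1]) (auto simp: discount_nonneg discount_le_1)

lemma nn_integral_discount: "(\<integral>\<^sup>+\<omega>. ennreal (discount p (\<tau> n \<omega>)) \<partial>M) = ennreal (D n)"
  unfolding D_def by (rule nn_integral_eq_integral[OF integrable_discount]) (simp add: discount_nonneg)

lemma D_nonneg: "D n \<ge> 0"
  unfolding D_def by (simp add: discount_nonneg)

text \<open>A policy places finitely many orders up to each time, so the ordering times tend to
  infinity along every path.\<close>

lemma D_tendsto: "D \<longlonglongrightarrow> 0"
proof -
  have "D \<longlonglongrightarrow> (\<integral>\<omega>. 0 \<partial>M)"
    unfolding D_def
  proof (rule integral_dominated_convergence[where w = "\<lambda>_. 1"])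
    show "AE \<omega> in M. (\<lambda>n. discount p (\<tau> n \<omega>)) \<longlonglongrightarrow> 0"
    proof (rule AE_I2, rule LIMSEQ_I)
      fix \<omega> and e :: real assume \<omega>: "\<omega> \<in> space M" and e: "e > 0"
      define t where "t = max 0 (- ln e / \<beta>) + 1"
      have "exp (- \<beta> * t) < e"
      proof -
        have "\<beta> * t > - ln e"
        proof -
          have "- ln e / \<beta> < t" by (simp add: t_def)
          then show ?thesis unfolding pos_divide_less_eq[OF param_pos(3)] by (simp add: mult.commute)
        qed
        then have "exp (- \<beta> * t) < exp (ln e)" by simp
        then show ?thesis using e by simp
      qed
      obtain N where N: "\<And>n. \<tau> n \<omega> \<le> ennreal t \<Longrightarrow> n < N"
        using \<tau>_finite[OF \<omega>, of t] by (auto simp: finite_nat_set_iff_bounded)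
      have "norm (discount p (\<tau> n \<omega>) - 0) < e" if "n \<ge> N" for n
      proof (cases "\<tau> n \<omega>" rule: ennreal_cases)
        case (real r)
        then have "\<not> ennreal r \<le> ennreal t" using N[of n] that by auto
        then have "t < r" using ennreal_leI[of r t] by linarith
        then have "exp (- \<beta> * r) \<le> exp (- \<beta> * t)" using param_pos by simp
        then have "exp (- \<beta> * r) < e" using \<open>exp (- \<beta> * t) < e\<close> by (rule le_less_trans)
        then show ?thesis using real by (simp add: discount_def)
      next
        case top
        then show ?thesis using e by (simp add: discount_def)
      qed
      then show "\<exists>N. \<forall>n\<ge>N. norm (discount p (\<tau> n \<omega>) - 0) < e" by blast
    qed
  qed (use param_pos in \<open>auto simp: discount_nonneg discount_le_1\<close>)
  then show ?thesis by simp
qed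

lemma value_post_mono:
  assumes "\<And>z. s \<le> z \<Longrightarrow> resolvent p f z \<le> a * resolvent p h z + b"
    and [measurable]: "f \<in> borel_measurable borel" "h \<in> borel_measurable borel"
  shows "value_post f n \<le> a * value_post h n + b * ennreal (D n)"
proof -
  have "value_post f n \<le> (\<integral>\<^sup>+\<omega>. a * (ennreal (discount p (\<tau> n \<omega>)) * resolvent p h (post n \<omega>)) +
      b * ennreal (discount p (\<tau> n \<omega>)) \<partial>M)"
    unfolding value_post_def
  proof (rule nn_integral_mono_AE)
    show "AE \<omega> in M. ennreal (discount p (\<tau> n \<omega>)) * resolvent p f (post n \<omega>) \<le>
      a * (ennreal (discount p (\<tau> n \<omega>)) * resolvent p h (post n \<omega>)) + b * ennreal (discount p (\<tau> n \<omega>))"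
      using AE_levels
    proof eventually_elim
      case (elim \<omega>)
      show ?case
      proof (cases "\<tau> n \<omega> = \<infinity>")
        case False
        then have "resolvent p f (post n \<omega>) \<le> a * resolvent p h (post n \<omega>) + b"
          using elim[rule_format, of n] by (intro assms) (simp add: top.not_eq_extremum)
        then have "ennreal (discount p (\<tau> n \<omega>)) * resolvent p f (post n \<omega>) \<le>
          ennreal (discount p (\<tau> n \<omega>)) * (a * resolvent p h (post n \<omega>) + b)"
          by (rule mult_left_mono) simp
        then show ?thesis by (simp add: algebra_simps)
      qed (simp add: discount_def)
    qed
  qed
  also have "\<dots> = a * value_post h n + b * ennreal (D n)"
    unfolding value_post_def nn_integral_discount[symmetric]
    by (subst nn_integral_add) (simp_all add: nn_integral_cmult)
  finally show ?thesis .
qed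

text \<open>For the source below s all cycle costs vanish, and its resolvent is bounded on [s,
  \<infinity>), so the remainder is at most a multiple of \<open>D n\<close>. The value is the
  renewal formula exp(-l2 (y - s)) / (1 - exp(-l2 (S - s))), obtained without hitting times.\<close>

lemma order_prob_sums:
  "(\<lambda>n. P (Suc n)) sums (exp (- l2 * y) / (exp (- l2 * s) - exp (- l2 * S)))"
proof -
  let ?f = "\<lambda>z. max 0 (min 1 (s - z))" and ?E = "\<lambda>z. exp (- l2 * z)"
  obtain c where c: "c > 0" "\<And>z. s \<le> z \<Longrightarrow> resolvent p ?f z = ennreal (c * ?E z)"
    by (rule resolvent_below[of s]) blast
  have f: "continuous_on UNIV ?f" by (intro continuous_intros)
  have zero: "cycle_cost ?f n = 0" for n by (rule cycle_cost_zero) simp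
  have ES: "?E s - ?E S > 0" using S_gt lam_pos by simp
  have sum: "enn2real (value_post ?f n) = c * ?E y - c * (?E s - ?E S) * (\<Sum>m<n. P (Suc m))" for n
    using value_sum(1)[OF f c(2), of n] c(1) by (simp add: zero algebra_simps)
  have le: "enn2real (value_post ?f n) \<le> c * ?E s * D n" for n
  proof -
    have "value_post ?f n \<le> 0 * value_post ?f n + ennreal (c * ?E s) * ennreal (D n)"
    proof (rule value_post_mono)
      fix z assume "s \<le> z"
      then show "resolvent p ?f z \<le> 0 * resolvent p ?f z + ennreal (c * ?E s)"
        using c lam_pos by (auto intro!: ennreal_leI)
    qed measurable
    also have "\<dots> = ennreal (c * ?E s * D n)"
      using c(1) D_nonneg by (simp add: ennreal_mult)
    finally show ?thesis using c(1) D_nonneg by (intro enn2real_leI) auto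
  qed
  have lim: "(\<lambda>n. enn2real (value_post ?f n)) \<longlonglongrightarrow> 0"
  proof (rule tendsto_sandwich[OF _ _ tendsto_const])
    show "(\<lambda>n. c * ?E s * D n) \<longlonglongrightarrow> 0" using tendsto_mult_left[OF D_tendsto, of "c * ?E s"] by simp
    show "\<forall>\<^sub>F n in sequentially. enn2real (value_post ?f n) \<le> c * ?E s * D n"
      by (rule always_eventually, rule allI, rule le)
  qed simp
  have "(\<lambda>n. (c * ?E y - enn2real (value_post ?f n)) / (c * (?E s - ?E S))) \<longlonglongrightarrow> (c * ?E y - 0) / (c * (?E s - ?E S))"
    using mult_pos_pos[OF c(1) ES] by (intro tendsto_divide tendsto_diff tendsto_const lim) linarith
  also have "(\<lambda>n. (c * ?E y - enn2real (value_post ?f n)) / (c * (?E s - ?E S))) = (\<lambda>n. \<Sum>m<n. P (Suc m))"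
  proof (rule ext)
    fix n
    define N where "N = c * (?E s - ?E S)"
    have "N > 0" unfolding N_def by (rule mult_pos_pos[OF c(1) ES])
    then show "(c * ?E y - enn2real (value_post ?f n)) / (c * (?E s - ?E S)) = (\<Sum>m<n. P (Suc m))"
      unfolding sum N_def[symmetric] by simp
  qed
  also have "(c * ?E y - 0) / (c * (?E s - ?E S)) = ?E y / (?E s - ?E S)" using c(1) by simp
  finally show ?thesis by (simp add: sums_def)
qed

definition r :: "real \<Rightarrow> real" where
  "r z = C * (Lam1 p z + Lam2 p z + \<kappa> * exp (- l2 * z))"

lemma resolvent_r: "resolvent p g z = ennreal (r z)" and r_nonneg: "r z \<ge> 0"
  unfolding r_def by (rule resolvent_hold resolvent_hold_nonneg)+

text \<open>Since \<open>r\<^sup>2\<close> is dominated on \<open>[s, \<infinity>)\<close> by the resolvent of an exponential, whose discounted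
  expectations stay bounded, Young's inequality gives transversality.\<close>

lemma value_post_hold_tendsto: "(\<lambda>n. enn2real (value_post g n)) \<longlonglongrightarrow> 0"
proof -
  \<comment> \<open>r grows at most like exp(\<delta> z), its square like exp(\<theta> z); the
    choice keeps \<theta> = l2/2 below the threshold for finite resolvents.\<close>
  define \<delta> where "\<delta> = l2 / 4"
  define \<theta> where "\<theta> = 2 * \<delta>"
  have \<delta>: "0 < \<delta>" "\<delta> < l2" "0 < \<theta>" "\<theta> < l2" using lam_pos by (auto simp: \<delta>_def \<theta>_def)
  let ?h = "\<lambda>z. exp (\<theta> * z)"
  obtain c where c: "c > 0" "\<And>z. resolvent p ?h z = ennreal (c * exp (\<theta> * z))"
    using resolvent_exp[of \<theta>] \<delta> by auto
  obtain c1 where c1: "c1 > 0" "\<And>z. g z \<le> c1 * exp (\<delta> * \<bar>z\<bar>)" using hold_growth[OF \<delta>(1)] by blast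
  have "J \<delta> < \<infinity>" unfolding J_def using \<delta> by (intro green_exp_finite) auto
  then obtain j where j: "j \<ge> 0" "J \<delta> = ennreal j" by (cases "J \<delta>") auto
  \<comment> \<open>The factor exp(2 \<delta> |s|) pays for replacing |z| by z, as |z| \<le> 2 |s| +
    z for z \<ge> s.\<close>
  define a where "a = c1 * exp (2 * \<delta> * \<bar>s\<bar>) * j"
  have a: "a \<ge> 0" using c1(1) j(1) by (simp add: a_def)
  have r_le: "r z \<le> a * exp (\<delta> * z)" if "s \<le> z" for z
  proof -
    have "ennreal (r z) \<le> ennreal (c1 * exp (\<delta> * \<bar>z\<bar>)) * J \<delta>"
      unfolding resolvent_r[symmetric] by (rule resolvent_le) (use c1 \<delta> in auto)
    also have "\<dots> = ennreal (c1 * exp (\<delta> * \<bar>z\<bar>) * j)" using j c1 by (simp add: ennreal_mult)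
    finally have "r z \<le> c1 * exp (\<delta> * \<bar>z\<bar>) * j" using j c1 by (simp add: ennreal_le_iff)
    also have "\<dots> \<le> c1 * exp (2 * \<delta> * \<bar>s\<bar> + \<delta> * z) * j"
    proof -
      have "\<bar>z\<bar> \<le> 2 * \<bar>s\<bar> + z" using that by linarith
      then have "\<delta> * \<bar>z\<bar> \<le> \<delta> * (2 * \<bar>s\<bar> + z)" using \<delta> by (intro mult_left_mono) auto
      then show ?thesis using c1 j by (intro mult_right_mono mult_left_mono) (auto simp: algebra_simps)
    qed
    finally show ?thesis by (simp add: a_def exp_add mult_ac)
  qed
  have young: "r z \<le> \<epsilon> * (c * exp (\<theta> * z)) + a\<^sup>2 / (\<epsilon> * c)" if "s \<le> z" "\<epsilon> > 0" for z \<epsilon>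
  proof -
    define e where "e = exp (\<delta> * z)"
    have e2: "exp (\<theta> * z) = e\<^sup>2" by (simp add: e_def \<theta>_def power2_eq_square exp_add[symmetric])
    \<comment> \<open>Young's inequality as a completed square, scaled so that the quadratic term is
      \<epsilon> times the resolvent of the exponential.\<close>
    have "0 \<le> (\<epsilon> * c * e - a)\<^sup>2 / (\<epsilon> * c)" using that c(1) by simp
    also have "\<dots> = \<epsilon> * (c * e\<^sup>2) - 2 * a * e + a\<^sup>2 / (\<epsilon> * c)"
      using that c(1) by (simp add: power2_eq_square field_simps)
    finally have "2 * a * e \<le> \<epsilon> * (c * e\<^sup>2) + a\<^sup>2 / (\<epsilon> * c)" by simp
    moreover have "a * e \<le> 2 * a * e" using a by (simp add: e_def)
    ultimately show ?thesis using r_le[OF that(1)] unfolding e2 e_def[symmetric] by linarith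
  qed
  have h: "continuous_on UNIV ?h" by (intro continuous_intros)
  \<comment> \<open>A bound uniform in n: the telescoped identity with the partial sums of order
    weights replaced by their finite total.\<close>
  define b where "b = c * exp (\<theta> * y) + \<bar>c * exp (\<theta> * S) - c * exp (\<theta> * s)\<bar> * (\<Sum>n. P (Suc n))"
  have Psum: "summable (\<lambda>n. P (Suc n))" using order_prob_sums by (rule sums_summable)
  have b: "enn2real (value_post ?h n) \<le> b" for n
  proof -
    have S: "0 \<le> (\<Sum>m<n. P (Suc m))" "(\<Sum>m<n. P (Suc m)) \<le> (\<Sum>n. P (Suc n))"
      using P_nonneg by (auto intro!: sum_nonneg sum_le_suminf[OF Psum])
    have "enn2real (value_post ?h n) \<le> (\<Sum>m<n. enn2real (cycle_cost ?h m)) + enn2real (value_post ?h n)"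
      by (simp add: sum_nonneg)
    also have "\<dots> = c * exp (\<theta> * y) + (c * exp (\<theta> * S) - c * exp (\<theta> * s)) * (\<Sum>m<n. P (Suc m))"
      using value_sum(1)[OF h c(2), of n] c(1) by simp
    also have "\<dots> \<le> c * exp (\<theta> * y) + \<bar>c * exp (\<theta> * S) - c * exp (\<theta> * s)\<bar> * (\<Sum>m<n. P (Suc m))"
      using S by (intro add_left_mono mult_right_mono) auto
    also have "\<dots> \<le> b"
      unfolding b_def using S by (intro add_left_mono mult_left_mono) auto
    finally show ?thesis .
  qed
  have b0: "b \<ge> 0" using b[of 0] by (rule order_trans[rotated]) simp
  have hfin: "value_post ?h n < \<infinity>" for n by (rule value_post_finite[OF h]) (simp add: c)
  have bound: "enn2real (value_post g n) \<le> \<epsilon> * b + a\<^sup>2 / (\<epsilon> * c) * D n" if \<epsilon>: "\<epsilon> > 0" for n \<epsilon>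
  proof -
    have "value_post g n \<le> ennreal \<epsilon> * value_post ?h n + ennreal (a\<^sup>2 / (\<epsilon> * c)) * ennreal (D n)"
    proof (rule value_post_mono)
      fix z assume "s \<le> z"
      have "ennreal \<epsilon> * resolvent p ?h z + ennreal (a\<^sup>2 / (\<epsilon> * c)) = ennreal (\<epsilon> * (c * exp (\<theta> * z)) + a\<^sup>2 / (\<epsilon> * c))"
        using \<epsilon> c by (simp add: ennreal_mult)
      then show "resolvent p g z \<le> ennreal \<epsilon> * resolvent p ?h z + ennreal (a\<^sup>2 / (\<epsilon> * c))"
        using young[OF \<open>s \<le> z\<close> \<epsilon>] by (simp add: resolvent_r ennreal_leI del: ennreal_plus)
    qed measurable
    also have "\<dots> = ennreal (\<epsilon> * enn2real (value_post ?h n) + a\<^sup>2 / (\<epsilon> * c) * D n)"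
    proof -
      have pos: "0 \<le> \<epsilon>" "0 \<le> a\<^sup>2 / (\<epsilon> * c)" using \<epsilon> c(1) by auto
      have "value_post ?h n = ennreal (enn2real (value_post ?h n))" using hfin[of n] by simp
      then show ?thesis
        using pos D_nonneg[of n] by (subst ennreal_plus) (simp_all only: ennreal_mult' mult_nonneg_nonneg enn2real_nonneg)
    qed
    finally have "enn2real (value_post g n) \<le> \<epsilon> * enn2real (value_post ?h n) + a\<^sup>2 / (\<epsilon> * c) * D n"
      using \<epsilon> c(1) D_nonneg[of n] by (intro enn2real_leI) auto
    also have "\<dots> \<le> \<epsilon> * b + a\<^sup>2 / (\<epsilon> * c) * D n"
      using \<epsilon> b[of n] by simp
    finally show ?thesis .
  qed
  show ?thesis
  proof (rule LIMSEQ_I)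
    fix e :: real assume e: "e > 0"
    \<comment> \<open>The denominator uses b + 1 because b may be 0.\<close>
    define \<epsilon> where "\<epsilon> = e / (2 * (b + 1))"
    have \<epsilon>: "\<epsilon> > 0" using e b0 by (simp add: \<epsilon>_def)
    have "\<epsilon> * b \<le> e / 2" using e b0 by (simp add: \<epsilon>_def field_simps)
    have "(\<lambda>n. a\<^sup>2 / (\<epsilon> * c) * D n) \<longlonglongrightarrow> 0" using tendsto_mult_left[OF D_tendsto, of "a\<^sup>2 / (\<epsilon> * c)"] by simp
    then obtain N where N: "\<And>n. n \<ge> N \<Longrightarrow> norm (a\<^sup>2 / (\<epsilon> * c) * D n - 0) < e / 2"
      using LIMSEQ_D[of _ 0 "e / 2"] e by (meson half_gt_zero)
    have "norm (enn2real (value_post g n) - 0) < e" if "n \<ge> N" for n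
    proof -
      have "a\<^sup>2 / (\<epsilon> * c) * D n < e / 2" using N[OF that] by (simp only: real_norm_def)
      then have "enn2real (value_post g n) < e" using bound[OF \<epsilon>, of n] \<open>\<epsilon> * b \<le> e / 2\<close> by linarith
      then show ?thesis by simp
    qed
    then show "\<exists>N. \<forall>n\<ge>N. norm (enn2real (value_post g n) - 0) < e" by blast
  qed
qed

end

section \<open>The total discounted cost\<close>

context order_up_to
begin

definition hold_cost :: "'a \<Rightarrow> ennreal" where
  "hold_cost \<omega> = (\<integral>\<^sup>+t\<in>{0..}. ennreal (exp (- \<beta> * t) * g (inventory p B x \<tau> \<xi> t \<omega>)) \<partial>lborel)"

lemma hold_cost_eq:
  assumes \<omega>: "\<omega> \<in> space M"
  shows "hold_cost \<omega> = (\<Sum>n. \<integral>\<^sup>+u\<in>{u. 0 \<le> u \<and> \<tau> n \<omega> \<le> ennreal u \<and> ennreal u < \<tau> (Suc n) \<omega>}.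
     cost_flow g n \<omega> u \<partial>lborel)"
proof -
  let ?A = "\<lambda>n. {u. 0 \<le> u \<and> \<tau> n \<omega> \<le> ennreal u \<and> ennreal u < \<tau> (Suc n) \<omega>}"
  have [measurable]: "cost_flow g n \<omega> \<in> borel_measurable lborel" for n
    unfolding cost_flow_def[abs_def] using \<omega> by measurable
  have "(\<Sum>n. \<integral>\<^sup>+u\<in>?A n. cost_flow g n \<omega> u \<partial>lborel) = (\<integral>\<^sup>+u. (\<Sum>n. cost_flow g n \<omega> u * indicator (?A n) u) \<partial>lborel)"
    by (rule nn_integral_suminf[symmetric]) measurable
  also have "\<dots> = hold_cost \<omega>"
    unfolding hold_cost_def
  proof (rule nn_integral_cong)
    fix u :: real
    show "(\<Sum>n. cost_flow g n \<omega> u * indicator (?A n) u) =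
      ennreal (exp (- \<beta> * u) * g (inventory p B x \<tau> \<xi> u \<omega>)) * indicator {0..} u"
    proof (cases "0 \<le> u")
      case True
      let ?n = "order_count \<tau> u \<omega>"
      have "(\<Sum>n. cost_flow g n \<omega> u * indicator (?A n) u) = (\<Sum>n\<in>{?n}. cost_flow g n \<omega> u * indicator (?A n) u)"
        using order_count_eq[OF \<omega>, of _ u]
        by (intro suminf_finite) (auto simp: indicator_def)
      also have "\<dots> = ennreal (exp (- \<beta> * u) * g (inventory p B x \<tau> \<xi> u \<omega>)) * indicator {0..} u"
        using True order_count_bounds[OF \<omega>, of u]
        by (simp add: cost_flow_def inventory_eq_level ennreal_mult hold_nonneg)
      finally show ?thesis .
    qed simp
  qed
  finally show ?thesis ..
qed

lemma cycle_flow_measurable[measurable]: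
  "(\<lambda>\<omega>. \<integral>\<^sup>+u\<in>{u. 0 \<le> u \<and> \<tau> n \<omega> \<le> ennreal u \<and> ennreal u < \<tau> (Suc n) \<omega>}. cost_flow g n \<omega> u \<partial>lborel)
    \<in> borel_measurable M"
  unfolding cost_flow_def by measurable

lemma hold_cost_measurable: "hold_cost \<in> borel_measurable M"
  by (rule measurable_cong[THEN iffD2, OF hold_cost_eq]) measurable

lemma expected_hold_cost: "(\<integral>\<^sup>+\<omega>. hold_cost \<omega> \<partial>M) = (\<Sum>n. cycle_cost g n)"
proof -
  have "(\<integral>\<^sup>+\<omega>. hold_cost \<omega> \<partial>M) = (\<integral>\<^sup>+\<omega>. (\<Sum>n. \<integral>\<^sup>+u\<in>{u. 0 \<le> u \<and> \<tau> n \<omega> \<le> ennreal u \<and> ennreal u < \<tau> (Suc n) \<omega>}.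
     cost_flow g n \<omega> u \<partial>lborel) \<partial>M)"
    by (intro nn_integral_cong hold_cost_eq)
  also have "\<dots> = (\<Sum>n. cycle_cost g n)"
    unfolding cycle_cost_def by (rule nn_integral_suminf) measurable
  finally show ?thesis .
qed

lemma setup_cost_measurable[measurable]: "setup_cost p \<in> borel_measurable borel"
  unfolding setup_cost_def[abs_def] by measurable

definition order_cost :: "nat \<Rightarrow> 'a \<Rightarrow> ennreal" where
  "order_cost n \<omega> = ennreal (discount p (\<tau> n \<omega>) * (setup_cost p (\<xi> n \<omega>) + k * \<xi> n \<omega>))"

lemma order_cost_measurable[measurable]: "order_cost n \<in> borel_measurable M"
  unfolding order_cost_def[abs_def] by measurable

definition K0 :: real where "K0 = setup_cost p (y - x) + k * (y - x)"

lemma K0_pos: "K0 > 0"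
  using param_pos x_le y_gt by (auto simp: K0_def setup_cost_def intro!: add_pos_nonneg)

text \<open>After the first order, orders at levels above s have size 0 and are free, so the cost
  sits on the event that the level before the order is s.\<close>

lemma expected_order_cost:
  "(\<integral>\<^sup>+\<omega>. order_cost n \<omega> \<partial>M) = ennreal (case n of 0 \<Rightarrow> K0 | Suc m \<Rightarrow> (K1 + k * (S - s)) * P (Suc m))"
proof (cases n)
  case 0
  have "(\<integral>\<^sup>+\<omega>. order_cost n \<omega> \<partial>M) = (\<integral>\<^sup>+\<omega>. ennreal K0 \<partial>M)"
  proof (rule nn_integral_cong_AE)
    show "AE \<omega> in M. order_cost n \<omega> = ennreal K0"
      using AE_levels AE_space
    proof eventually_elim
      case (elim \<omega>)
      have \<tau>: "\<tau> 0 \<omega> = 0" by (rule \<tau>_0) (use elim in simp)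
      then have "\<xi> 0 \<omega> = y - x" using elim(1)[rule_format, of 0] post_eq[of 0 \<omega>] by simp
      then show ?case using \<tau> 0 by (simp add: order_cost_def discount_def K0_def)
    qed
  qed
  then show ?thesis using 0 by (simp add: emeasure_space_1)
next
  case (Suc m)
  let ?c = "K1 + k * (S - s)"
  have c: "?c \<ge> 0" using param_pos S_gt by (simp add: add_nonneg_nonneg)
  have "(\<integral>\<^sup>+\<omega>. order_cost n \<omega> \<partial>M) = (\<integral>\<^sup>+\<omega>. ennreal ?c * (ennreal (discount p (\<tau> n \<omega>)) * indicator {s} (pre n \<omega>)) \<partial>M)"
  proof (rule nn_integral_cong_AE)
    show "AE \<omega> in M. order_cost n \<omega> = ennreal ?c * (ennreal (discount p (\<tau> n \<omega>)) * indicator {s} (pre n \<omega>))"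
      using AE_levels
    proof eventually_elim
      case (elim \<omega>)
      show ?case
      proof (cases "\<tau> n \<omega> = \<infinity>")
        case False
        then have "\<xi> n \<omega> = (if pre n \<omega> = s then S - s else 0)"
          using elim[rule_format, of n] Suc post_eq[of n \<omega>] by (auto simp: top.not_eq_extremum split: if_splits)
        moreover have "setup_cost p (S - s) = K1" "setup_cost p 0 = 0"
          using S_gt S_le param_pos by (auto simp: setup_cost_def)
        ultimately show ?thesis
          using c by (auto simp: order_cost_def ennreal_mult' discount_nonneg mult.commute ennreal_mult'')
      qed (simp add: order_cost_def discount_def)
    qed
  qed
  also have "\<dots> = ennreal ?c * order_prob n"
    unfolding order_prob_def by (rule nn_integral_cmult) measurable
  also have "\<dots> = ennreal (?c * P n)"
    using c by (simp only: order_prob_eq ennreal_mult')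
  finally show ?thesis using Suc by simp
qed

text \<open>Strict positivity is recorded because comparing two costs through \<open>ennreal\<close>
  requires the larger real to be positive.\<close>

lemma DC_eq:
  defines "\<pi> \<equiv> exp (- l2 * y) / (exp (- l2 * s) - exp (- l2 * S))"
  shows "DC p M B x \<tau> \<xi> = ennreal (K0 + r y + (r S - r s + K1 + k * (S - s)) * \<pi>)"
    and "K0 + r y + (r S - r s + K1 + k * (S - s)) * \<pi> > 0"
proof -
  note sums_P = order_prob_sums[folded \<pi>_def]
  note vs = value_sum[OF hold_continuous resolvent_r r_nonneg]
  have "(\<lambda>n. r y + (r S - r s) * (\<Sum>m<n. P (Suc m)) - enn2real (value_post g n)) \<longlonglongrightarrow> r y + (r S - r s) * \<pi> - 0"
    using sums_P unfolding sums_def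
    by (intro tendsto_diff tendsto_add tendsto_mult tendsto_const value_post_hold_tendsto)
  also have "(\<lambda>n. r y + (r S - r s) * (\<Sum>m<n. P (Suc m)) - enn2real (value_post g n)) = (\<lambda>n. \<Sum>m<n. enn2real (cycle_cost g m))"
    using vs(1) by (intro ext) (simp add: algebra_simps)
  finally have sums1: "(\<lambda>n. enn2real (cycle_cost g n)) sums (r y + (r S - r s) * \<pi>)"
    by (simp add: sums_def)
  let ?w = "\<lambda>n. case n of 0 \<Rightarrow> K0 | Suc m \<Rightarrow> (K1 + k * (S - s)) * P (Suc m)"
  have "(\<lambda>n. ?w (Suc n)) sums ((K1 + k * (S - s)) * \<pi>)"
    using sums_mult[OF sums_P] by simp
  then have sums2: "?w sums ((K1 + k * (S - s)) * \<pi> + K0)"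
    by (subst (asm) sums_Suc_iff) simp
  have w0: "?w n \<ge> 0" for n
    using param_pos S_gt K0_pos P_nonneg by (auto split: nat.split intro!: mult_nonneg_nonneg add_nonneg_nonneg)
  have pos1: "0 \<le> r y + (r S - r s) * \<pi>"
    by (rule sums_le[OF _ sums_zero sums1]) simp
  have pos2: "0 < (K1 + k * (S - s)) * \<pi> + K0"
  proof -
    have "\<pi> \<ge> 0" using S_gt lam_pos by (simp add: \<pi>_def)
    moreover have "K1 + k * (S - s) \<ge> 0" using param_pos S_gt by (simp add: add_nonneg_nonneg)
    ultimately show ?thesis using K0_pos by (simp add: add_nonneg_pos)
  qed
  have "DC p M B x \<tau> \<xi> = (\<integral>\<^sup>+\<omega>. hold_cost \<omega> + (\<Sum>n. order_cost n \<omega>) \<partial>M)"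
    unfolding DC_def hold_cost_def order_cost_def ..
  also have "\<dots> = (\<Sum>n. cycle_cost g n) + (\<Sum>n. \<integral>\<^sup>+\<omega>. order_cost n \<omega> \<partial>M)"
    using hold_cost_measurable
    by (subst nn_integral_add) (simp_all add: expected_hold_cost nn_integral_suminf)
  also have "(\<Sum>n. cycle_cost g n) = (\<Sum>n. ennreal (enn2real (cycle_cost g n)))"
    using vs(2) by (intro arg_cong[where f = suminf] ext) simp
  also have "\<dots> = ennreal (r y + (r S - r s) * \<pi>)"
    using sums1 by (intro suminf_ennreal_eq) auto
  also have "(\<Sum>n. \<integral>\<^sup>+\<omega>. order_cost n \<omega> \<partial>M) = ennreal ((K1 + k * (S - s)) * \<pi> + K0)"
    unfolding expected_order_cost using sums2 w0 by (intro suminf_ennreal_eq) auto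
  also have "ennreal (r y + (r S - r s) * \<pi>) + ennreal ((K1 + k * (S - s)) * \<pi> + K0) =
      ennreal ((r y + (r S - r s) * \<pi>) + ((K1 + k * (S - s)) * \<pi> + K0))"
    using pos1 pos2 by (intro ennreal_plus[symmetric]) auto
  also have "(r y + (r S - r s) * \<pi>) + ((K1 + k * (S - s)) * \<pi> + K0) = K0 + r y + (r S - r s + K1 + k * (S - s)) * \<pi>"
    by (simp add: algebra_simps)
  finally show "DC p M B x \<tau> \<xi> = ennreal (K0 + r y + (r S - r s + K1 + k * (S - s)) * \<pi>)" .
  show "K0 + r y + (r S - r s + K1 + k * (S - s)) * \<pi> > 0"
    using pos1 pos2 by (simp add: algebra_simps)
qed

text \<open>The assumption says that v_A is indifferent to an order at s. As v_A is r minus a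
  multiple a of the exponential, each order then costs -a times the denominator in the number of
  orders, which cancels and leaves v_A(y).\<close>

lemma DC_eq_v_fun:
  assumes "v_fun p A s = v_fun p A S + K1 + k * (S - s)"
  shows "DC p M B x \<tau> \<xi> = ennreal (setup_cost p (y - x) + k * (y - x) + v_fun p A y)"
    and "setup_cost p (y - x) + k * (y - x) + v_fun p A y > 0"
proof -
  let ?E = "\<lambda>z. exp (- l2 * z)"
  define a where "a = C * (\<kappa> + A / l2\<^sup>2)"
  define d where "d = ?E s - ?E S"
  have v: "v_fun p A z = r z - a * ?E z" for z
    by (simp add: v_fun_eq r_def a_def)
  have d: "d > 0" using S_gt lam_pos by (simp add: d_def)
  have "r S - r s + K1 + k * (S - s) = - a * d"
    using assms unfolding v d_def by (simp add: algebra_simps)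
  then have eq: "(r S - r s + K1 + k * (S - s)) * (?E y / d) = - a * ?E y"
    using d by simp
  have "K0 + r y + - a * ?E y = setup_cost p (y - x) + k * (y - x) + v_fun p A y"
    unfolding K0_def v by simp
  then show "DC p M B x \<tau> \<xi> = ennreal (setup_cost p (y - x) + k * (y - x) + v_fun p A y)"
    "setup_cost p (y - x) + k * (y - x) + v_fun p A y > 0"
    using DC_eq[folded d_def, unfolded eq] by simp_all
qed

end

section \<open>Comparison of the two policies\<close>

context inventory_model
begin

text \<open>\<open>A_fun p c s S\<close> is the A for which v_A is indifferent between waiting at s
  and ordering up to S. The gain from waiting is affine and strictly increasing in A, so the
  inequalities translate as well.\<close>

lemma A_fun_eq_iff:
  assumes "s < S"
  shows "A_fun p c s S \<le> A \<longleftrightarrow> v_fun p A s \<le> v_fun p A S + c + k * (S - s)"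
    and "A_fun p c s S = A \<longleftrightarrow> v_fun p A s = v_fun p A S + c + k * (S - s)"
    and "A_fun p c s S < A \<longleftrightarrow> v_fun p A s < v_fun p A S + c + k * (S - s)"
proof -
  define N where "N = (exp (- l2 * s) - exp (- l2 * S)) / l2\<^sup>2"
  have N: "N > 0" using assms lam_pos by (simp add: N_def)
  define G where "G = (Lam1 p S - Lam1 p s) + (Lam2 p S - Lam2 p s) + (c + k * (S - s)) / C"
  \<comment> \<open>The denominator in \<open>A_fun\<close> is negative for s < S; the sign is
    pulled out to work with N > 0.\<close>
  have "l2\<^sup>2 / (exp (- l2 * S) - exp (- l2 * s)) = l2\<^sup>2 / (- (exp (- l2 * s) - exp (- l2 * S)))"
    by simp
  then have "l2\<^sup>2 / (exp (- l2 * S) - exp (- l2 * s)) = - 1 / N"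
    unfolding N_def by (simp only: divide_minus_right divide_divide_eq_right minus_divide_left mult_1)
  moreover have "\<sigma>\<^sup>2 * (l1 + l2) / 2 = 1 / C"
    by (simp add: C_def)
  ultimately have "A_fun p c s S = - 1 / N * (Lam1 p S - Lam1 p s + (Lam2 p S - Lam2 p s) + 1 / C * (c + k * (S - s)))"
    unfolding A_fun_def by (simp only:)
  also have "Lam1 p S - Lam1 p s + (Lam2 p S - Lam2 p s) + 1 / C * (c + k * (S - s)) = G"
    by (simp add: G_def)
  finally have A: "A_fun p c s S = - G / N" by simp
  have v: "v_fun p A S + c + k * (S - s) - v_fun p A s = C * (G + A * N)"
  proof -
    have CG: "C * G = C * ((Lam1 p S - Lam1 p s) + (Lam2 p S - Lam2 p s)) + c + k * (S - s)"
      unfolding G_def distrib_left[of C _ "(c + k * (S - s)) / C"] using C_pos by simp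
    have AN: "A * N = A / l2\<^sup>2 * exp (- l2 * s) - A / l2\<^sup>2 * exp (- l2 * S)"
      by (simp add: N_def diff_divide_distrib right_diff_distrib)
    show ?thesis
      unfolding v_fun_def C_def[symmetric] distrib_left[of C] CG AN by (simp add: algebra_simps)
  qed
  have "- G / N \<le> A \<longleftrightarrow> 0 \<le> C * (G + A * N)" "- G / N = A \<longleftrightarrow> C * (G + A * N) = 0" "- G / N < A \<longleftrightarrow> 0 < C * (G + A * N)"
    unfolding pos_divide_le_eq[OF N] pos_divide_less_eq[OF N] nonzero_divide_eq_eq[OF less_imp_neq[OF N, symmetric]]
    using C_pos by (auto simp: zero_le_mult_iff zero_less_mult_iff)
  then show "A_fun p c s S \<le> A \<longleftrightarrow> v_fun p A s \<le> v_fun p A S + c + k * (S - s)"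
    "A_fun p c s S = A \<longleftrightarrow> v_fun p A s = v_fun p A S + c + k * (S - s)"
    "A_fun p c s S < A \<longleftrightarrow> v_fun p A s < v_fun p A S + c + k * (S - s)"
    unfolding A v[symmetric] by linarith+
qed

text \<open>At A = 0 the exponential drops out of v_A and a nondecreasing function remains. This
  supplies the upper bound that gives the supremum in \<open>A2_star\<close> its meaning.\<close>

lemma A_fun_nonpos:
  assumes "s < S" "c \<ge> 0"
  shows "A_fun p c s S \<le> 0"
  unfolding A_fun_eq_iff(1)[OF assms(1)]
proof -
  have "C * (Lam1 p s + Lam2 p s) \<le> C * (Lam1 p S + Lam2 p S)"
    using Lam_mono[of s S] assms C_pos by simp
  moreover have "k * (S - s) \<ge> 0" using assms param_pos by simp
  ultimately show "v_fun p 0 s \<le> v_fun p 0 S + c + k * (S - s)"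
    using assms(2) unfolding v_fun_def C_def[symmetric] by simp
qed

lemma A2_star_ge:
  assumes "S - s \<ge> Q"
  shows "A_fun p K2 s S \<le> A2_star p"
  unfolding A2_star_def
proof (rule cSup_upper)
  show "A_fun p K2 s S \<in> {A_fun p K2 s S | s S. S - s \<ge> Q}" using assms by blast
  show "bdd_above {A_fun p K2 s S | s S. S - s \<ge> Q}"
    using param_pos by (intro bdd_aboveI[of _ 0]) (auto intro!: A_fun_nonpos)
qed

section \<open>What optimality says about \<open>v1\<close>, and the comparison of first
  orders\<close>

context
  fixes s1 S1 Sbar sl
  assumes opt: "optimal_pair1 p s1 S1" and A12: "A1_star p > A2_star p"
    and Sbar: "is_S_bar p S1 Sbar" and sl: "is_s_low p s1 S1 Sbar sl"
begin

lemma s1_S1: "s1 < S1" "S1 - s1 \<le> Q"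
proof -
  have "KKT1 p s1 S1" using opt unfolding optimal_pair1_def by blast
  then show "s1 < S1" "S1 - s1 \<le> Q" unfolding KKT1_def by auto
qed

lemma A_fun_le: "s < S \<Longrightarrow> S - s \<le> Q \<Longrightarrow> A_fun p K1 s S \<le> A_fun p K1 s1 S1"
  using opt unfolding optimal_pair1_def by simp

lemma A1_star_eq: "A1_star p = A_fun p K1 s1 S1"
  unfolding A1_star_def
proof (rule cSup_eq_maximum)
  show "A_fun p K1 s1 S1 \<in> {A_fun p K1 s S |s S. 0 < S - s \<and> S - s \<le> Q}"
    using s1_S1 by (intro CollectI exI[of _ s1] exI[of _ S1]) auto
qed (auto intro: A_fun_le)

lemma v1_s1: "v1 p s1 = v1 p S1 + K1 + k * (S1 - s1)"
  using A_fun_eq_iff(2)[OF s1_S1(1), of K1 "A1_star p"] by (simp add: A1_star_eq v1_def)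

lemma v1_le: "s < S \<Longrightarrow> S - s \<le> Q \<Longrightarrow> v1 p s \<le> v1 p S + K1 + k * (S - s)"
  using A_fun_eq_iff(1)[of s S K1 "A1_star p"] A_fun_le by (simp add: A1_star_eq v1_def)

text \<open>Strict because \<open>A1_star\<close> exceeds \<open>A2_star\<close>: under
  \<open>v1\<close>, an order of at least Q at setup cost K2 always loses against waiting.\<close>

lemma v1_less: "s < S \<Longrightarrow> S - s \<ge> Q \<Longrightarrow> v1 p s < v1 p S + K2 + k * (S - s)"
  using A_fun_eq_iff(3)[of s S K2 "A1_star p"] A2_star_ge[of S s] A12 by (simp add: v1_def)

lemma v1_deriv: "(v1 p has_real_derivative deriv (v1 p) z) (at z)"
  unfolding v1_def deriv_v_fun by (rule v_fun_deriv)

lemma v1_deriv_continuous: "continuous_on A (deriv (v1 p))"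
  unfolding v1_def deriv_v_fun[abs_def] by (rule v_deriv_continuous)

lemma v1_continuous: "continuous_on A (v1 p)"
  using v1_deriv by (auto intro!: continuous_at_imp_continuous_on DERIV_isCont)

lemma Sbar_ge: "S1 \<le> Sbar" and Sbar_eq: "deriv (v1 p) Sbar = - k"
  and Sbar_unique: "S1 \<le> z \<Longrightarrow> deriv (v1 p) z = - k \<Longrightarrow> z = Sbar"
  using Sbar unfolding is_S_bar_def by auto

lemma sl_bounds: "s1 - Q \<le> sl" "sl \<le> S1 - Q"
  using sl unfolding is_s_low_def by auto

text \<open>From level z, the cost of ordering exactly Q minus that of ordering up to
  \<open>Sbar\<close>.\<close>

definition hgap :: "real \<Rightarrow> real" where
  "hgap z = (v1 p (z + Q) + K1 + k * Q) - (v1 p Sbar + K2 + k * (Sbar - z))"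

lemma hgap_unique: "s1 - Q \<le> z \<Longrightarrow> z \<le> S1 - Q \<Longrightarrow> hgap z = 0 \<Longrightarrow> z = sl"
  using sl unfolding is_s_low_def hgap_def by auto

lemma hgap_continuous: "continuous_on A hgap"
  unfolding hgap_def by (intro continuous_intros continuous_on_compose2[OF v1_continuous]) auto

text \<open>\<open>sl\<close> is the only zero in the interval, so by the intermediate value theorem
  the sign at the right end extends down to it.\<close>

lemma hgap_neg:
  assumes end_neg: "hgap (S1 - Q) < 0" and z: "sl < z" "z \<le> S1 - Q"
  shows "hgap z < 0"
proof (rule ccontr)
  assume "\<not> hgap z < 0"
  then obtain w where "z \<le> w" "w \<le> S1 - Q" "hgap w = 0"
    using IVT2'[of hgap "S1 - Q" 0 z] end_neg z hgap_continuous by auto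
  then show False using hgap_unique[of w] z sl_bounds by auto
qed

text \<open>If the constraint were slack, maximality with s1 fixed would make S1 an interior minimum
  of v1(z) + k z, and its derivative would vanish there.\<close>

lemma boundary_order:
  assumes "deriv (v1 p) S1 < - k"
  shows "S1 - s1 = Q"
proof (rule ccontr)
  assume "S1 - s1 \<noteq> Q"
  then have lt: "S1 - s1 < Q" using s1_S1 by simp
  \<comment> \<open>The radius keeps z above s1 and within distance Q of it, so that
    \<open>v1_le\<close> applies.\<close>
  define d where "d = min (S1 - s1) (Q - (S1 - s1))"
  have d: "d > 0" using lt s1_S1 by (simp add: d_def)
  have "deriv (v1 p) S1 + k = 0"
  proof (rule DERIV_local_min[OF _ d])
    show "((\<lambda>z. v1 p z + k * z) has_real_derivative deriv (v1 p) S1 + k) (at S1)"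
      by (auto intro!: derivative_eq_intros v1_deriv)
    show "\<forall>z. \<bar>S1 - z\<bar> < d \<longrightarrow> v1 p S1 + k * S1 \<le> v1 p z + k * z"
    proof (intro allI impI)
      fix z assume "\<bar>S1 - z\<bar> < d"
      then have "s1 < z" "z - s1 \<le> Q" by (auto simp: d_def)
      from v1_le[OF this] show "v1 p S1 + k * S1 \<le> v1 p z + k * z"
        using v1_s1 by (simp add: algebra_simps)
    qed
  qed
  then show False using assms by simp
qed

text \<open>The derivative of \<open>v1\<close> starts below -k at S1 and, by uniqueness of
  \<open>Sbar\<close>, cannot return to -k before \<open>Sbar\<close>.\<close>

lemma Sbar_better:
  assumes "deriv (v1 p) S1 < - k"
  shows "v1 p Sbar + k * Sbar < v1 p S1 + k * S1"
proof (rule DERIV_neg_imp_decreasing_open[of S1 Sbar "\<lambda>z. v1 p z + k * z"])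
  show "S1 < Sbar" using Sbar_ge Sbar_eq assms by (cases "S1 = Sbar") auto
  show "continuous_on {S1..Sbar} (\<lambda>z. v1 p z + k * z)" by (intro continuous_intros v1_continuous)
  fix z assume z: "S1 < z" "z < Sbar"
  have "deriv (v1 p) z < - k"
  proof (rule ccontr)
    assume "\<not> deriv (v1 p) z < - k"
    then obtain w where "S1 \<le> w" "w \<le> z" "deriv (v1 p) w = - k"
      using IVT'[of "deriv (v1 p)" S1 "- k" z] assms z v1_deriv_continuous by auto
    then show False using Sbar_unique[of w] z by auto
  qed
  moreover have "((\<lambda>z. v1 p z + k * z) has_real_derivative deriv (v1 p) z + k) (at z)"
    by (auto intro!: derivative_eq_intros v1_deriv)
  ultimately show "\<exists>d. ((\<lambda>z. v1 p z + k * z) has_real_derivative d) (at z) \<and> d < 0"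
    by (intro exI conjI) auto
qed

lemma DC_order_up_to:
  assumes BM: "standard_BM M F B" and impl: "implements_order_up_to p M F B x s1 T \<tau> \<xi>"
    and "x \<le> s1" "T x > s1" "T s1 = S1"
  shows "DC p M B x \<tau> \<xi> = ennreal (setup_cost p (T x - x) + k * (T x - x) + v1 p (T x))"
    and "setup_cost p (T x - x) + k * (T x - x) + v1 p (T x) > 0"
proof -
  interpret order_up_to M F B p x s1 "T x" S1 T \<tau> \<xi>
    by unfold_locales (use assms s1_S1 in auto)
  show "DC p M B x \<tau> \<xi> = ennreal (setup_cost p (T x - x) + k * (T x - x) + v1 p (T x))"
    "setup_cost p (T x - x) + k * (T x - x) + v1 p (T x) > 0"
    using DC_eq_v_fun[of "A1_star p"] v1_s1 by (simp_all add: v1_def)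
qed

text \<open>From below S1 - Q the order up to S1 exceeds Q, which is why K2 appears on the right of
  the assumed inequality.\<close>

lemma DC_less:
  assumes BM: "standard_BM M F B" and sS: "sS_policy p M F B x s1 S1 \<tau> \<xi>"
    and gen: "generalized_policy p M F B x s1 S1 Sbar sl \<tau>' \<xi>'"
    and x: "x < S1 - Q"
    and gt: "S_star p S1 Sbar sl x > s1"
    and less: "setup_cost p (S_star p S1 Sbar sl x - x) + k * (S_star p S1 Sbar sl x - x) + v1 p (S_star p S1 Sbar sl x)
      < K2 + k * (S1 - x) + v1 p S1"
  shows "DC p M B x \<tau>' \<xi>' < DC p M B x \<tau> \<xi>"
proof -
  have x_le: "x \<le> s1" using x s1_S1 by simp
  \<comment> \<open>When S1 - s1 = Q, the level s1 falls into the middle branch of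
    \<open>S_star\<close>, and s1 + Q is again S1.\<close>
  have "S_star p S1 Sbar sl s1 = S1"
    using s1_S1 sl_bounds by (auto simp: S_star_def)
  note gen = DC_order_up_to(1)[OF BM gen[unfolded generalized_policy_def] x_le gt this]
  note sS = DC_order_up_to[OF BM sS[unfolded sS_policy_def] x_le s1_S1(1) refl]
  have "setup_cost p (S1 - x) = K2" using x param_pos by (simp add: setup_cost_def)
  then show ?thesis
    unfolding gen sS(1) using less sS(2) by (intro ennreal_lessI) auto
qed

text \<open>Ordering Q beats ordering up to \<open>Sbar\<close> by the sign of \<open>hgap\<close>,
  and the latter is no worse than ordering up to S1 at the same setup cost K2.\<close>

lemma DC_less_above_sl:
  assumes "standard_BM M F B" "sS_policy p M F B x s1 S1 \<tau> \<xi>"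
    and "generalized_policy p M F B x s1 S1 Sbar sl \<tau>' \<xi>'"
    and end_neg: "hgap (S1 - Q) < 0" and le: "v1 p Sbar + k * Sbar \<le> v1 p S1 + k * S1"
    and x: "sl < x" "x < S1 - Q"
  shows "DC p M B x \<tau>' \<xi>' < DC p M B x \<tau> \<xi>"
proof -
  have S: "S_star p S1 Sbar sl x = x + Q" using x by (simp add: S_star_def)
  have "hgap x < 0" by (rule hgap_neg[OF end_neg x(1) less_imp_le[OF x(2)]])
  moreover have "setup_cost p (x + Q - x) = K1" using param_pos by (simp add: setup_cost_def)
  ultimately have "setup_cost p (x + Q - x) + k * (x + Q - x) + v1 p (x + Q) < K2 + k * (S1 - x) + v1 p S1"
    using le by (simp add: hgap_def algebra_simps)
  moreover have "x + Q > s1" using x sl_bounds by simp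
  ultimately show ?thesis
    using x by (intro DC_less[OF assms(1-3)]) (simp_all only: S)
qed

text \<open>Here \<open>Sbar\<close> = S1, so both orders from S1 - Q coincide and
  \<open>hgap\<close> there is K1 - K2.\<close>

lemma hgap_neg_if_deriv_eq:
  assumes "deriv (v1 p) S1 = - k"
  shows "hgap (S1 - Q) < 0" "v1 p Sbar + k * Sbar \<le> v1 p S1 + k * S1"
  using Sbar_unique[OF order_refl assms] param_pos by (auto simp: hgap_def algebra_simps)

lemma hgap_neg_if_deriv_less:
  assumes "deriv (v1 p) S1 < - k"
  shows "hgap (S1 - Q) < 0"
proof -
  \<comment> \<open>The end point S1 - Q is s1 itself. Indifference at s1 turns the order of size Q
    into \<open>v1 p s1\<close>, and the order up to \<open>Sbar\<close> is a larger order.\<close>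
  have "v1 p s1 < v1 p Sbar + K2 + k * (Sbar - s1)"
    using boundary_order[OF assms] Sbar_ge s1_S1 by (intro v1_less) auto
  then show ?thesis
    using v1_s1 boundary_order[OF assms] by (simp add: hgap_def algebra_simps)
qed

text \<open>Both orders exceed Q and pay K2, so only v1(z) + k z matters. With equality instead of
  \<open>deriv (v1 p) S1 < - k\<close> one has \<open>Sbar\<close> = S1 and the two costs agree, so
  part (a) stops at \<open>sl\<close>.\<close>

lemma DC_less_below_sl:
  assumes "standard_BM M F B" "sS_policy p M F B x s1 S1 \<tau> \<xi>"
    and "generalized_policy p M F B x s1 S1 Sbar sl \<tau>' \<xi>'"
    and d: "deriv (v1 p) S1 < - k" and x: "x < sl"
  shows "DC p M B x \<tau>' \<xi>' < DC p M B x \<tau> \<xi>"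
proof -
  have x': "x < S1 - Q" using x sl_bounds by simp
  have S: "S_star p S1 Sbar sl x = Sbar" using x x' by (simp add: S_star_def)
  have "setup_cost p (Sbar - x) = K2" using x' Sbar_ge param_pos by (simp add: setup_cost_def)
  then have "setup_cost p (Sbar - x) + k * (Sbar - x) + v1 p Sbar < K2 + k * (S1 - x) + v1 p S1"
    using Sbar_better[OF d] by (simp add: algebra_simps)
  moreover have "Sbar > s1" using Sbar_ge s1_S1 by simp
  ultimately show ?thesis
    using x' by (intro DC_less[OF assms(1-3)]) (simp_all only: S)
qed

end

end

theorem theorem3p3:
  fixes p :: inventory_data
    and M :: "'a measure" and F :: "ennreal \<Rightarrow> 'a measure" and B :: "real \<Rightarrow> 'a \<Rightarrow> real"
    and s1 S1 Sbar sl :: real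
  assumes "inventory_assumptions p"
    and "standard_BM M F B"
    and "optimal_pair1 p s1 S1"
    and "A1_star p > A2_star p"
    and "is_S_bar p S1 Sbar"
    and "is_s_low p s1 S1 Sbar sl"
  shows
    "(deriv (v1 p) s1 = deriv (v1 p) S1 \<and> deriv (v1 p) S1 = - unit_cost p \<longrightarrow>
        (\<forall>x \<in> {sl<..<S1 - qty p}. \<forall>\<tau> \<xi> \<tau>' \<xi>'.
           sS_policy p M F B x s1 S1 \<tau> \<xi> \<longrightarrow>
           generalized_policy p M F B x s1 S1 Sbar sl \<tau>' \<xi>' \<longrightarrow>
           DC p M B x \<tau> \<xi> > DC p M B x \<tau>' \<xi>')) \<and>
     (deriv (v1 p) s1 = deriv (v1 p) S1 \<and> deriv (v1 p) S1 < - unit_cost p \<longrightarrow>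
        (\<forall>x \<in> {..<S1 - qty p} - {sl}. \<forall>\<tau> \<xi> \<tau>' \<xi>'.
           sS_policy p M F B x s1 S1 \<tau> \<xi> \<longrightarrow>
           generalized_policy p M F B x s1 S1 Sbar sl \<tau>' \<xi>' \<longrightarrow>
           DC p M B x \<tau> \<xi> > DC p M B x \<tau>' \<xi>'))"
proof -
  interpret inventory_model p by unfold_locales (rule assms(1))
  note BM = assms(2) and opt = assms(3-6)
  show ?thesis
  proof (intro conjI impI ballI allI; elim conjE)
    fix x \<tau> \<xi> \<tau>' \<xi>'
    assume "x \<in> {sl<..<S1 - Q}" "deriv (v1 p) S1 = - k"
      "sS_policy p M F B x s1 S1 \<tau> \<xi>" "generalized_policy p M F B x s1 S1 Sbar sl \<tau>' \<xi>'"
    then show "DC p M B x \<tau>' \<xi>' < DC p M B x \<tau> \<xi>"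
      using DC_less_above_sl[OF opt BM] hgap_neg_if_deriv_eq[OF opt] by auto
  next
    fix x \<tau> \<xi> \<tau>' \<xi>'
    assume x: "x \<in> {..<S1 - Q} - {sl}" and d: "deriv (v1 p) S1 < - k"
      and pol: "sS_policy p M F B x s1 S1 \<tau> \<xi>" "generalized_policy p M F B x s1 S1 Sbar sl \<tau>' \<xi>'"
    show "DC p M B x \<tau>' \<xi>' < DC p M B x \<tau> \<xi>"
    proof (cases "x < sl")
      case True
      then show ?thesis by (rule DC_less_below_sl[OF opt BM pol d])
    next
      case False
      then show ?thesis
        using x by (intro DC_less_above_sl[OF opt BM pol hgap_neg_if_deriv_less[OF opt d] less_imp_le[OF Sbar_better[OF opt d]]]) auto
    qed
  qed
qed

end
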